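(* Let $G$ be a finite group with cyclic center, let $(i,\alpha)$ and $(j,\beta)$ be cocentral actions of a (finite) cyclic group $\Gamma$ on $G$, and put $H=G/i(\widehat{\Gamma})=G/j(\widehat{\Gamma})$ (the two subgroups coincide because $Z(G)$ is cyclic). Assume that $|H^2(H,\widehat{\Gamma})|\leq 2$ (or, more generally, that the natural actions of $\mathrm{Aut}(H)$ and $\mathrm{Aut}(\widehat{\Gamma})$ on $H^2(H,\widehat{\Gamma})$ are trivial) and that $\mathrm{Hom}(H,\widehat{\Gamma})=\{1\}$. Then the following assertions are equivalent. (1) The Hopf algebras $\mathcal{O}(G)^{i,\alpha}$ and $\mathcal{O}(G)^{j,\beta}$ are isomorphic. (2) The cocentral actions $(i,\alpha)$ and $(j,\beta)$ are equivalent. (3) The cocentral actions $(i,\alpha)$ and $(j,\beta)$ are weakly equivalent.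
   Context: The base field $k$ is algebraically closed of characteristic zero. For a finite group $G$, $\mathcal{O}(G)$ is the Hopf algebra of functions $G\to k$. For a group $\Gamma$, $\widehat{\Gamma}=\mathrm{Hom}(\Gamma,k^\times)$. $H^2(H,\widehat\Gamma)$ is group cohomology with coefficients in the trivial $H$-module $\widehat\Gamma$. A cocentral action of a finite abelian group $\Gamma$ on a finite group $G$ is a pair $(i,\alpha)$ where $i:\widehat{\Gamma}\to Z(G)$ is an injective group morphism and $\alpha:\Gamma\to\mathrm{Aut}(G)$, $g\mapsto\alpha_g$, is a group morphism such that each $\alpha_g$ fixes every element of $i(\widehat{\Gamma})$. It gives a grading $\mathcal{O}(G)=\bigoplus_{g\in\Gamma}\mathcal{O}(G)_g$ with $\mathcal{O}(G)_g=\{\phi : \phi(x\,i(\chi))=\chi(g)\phi(x)\ \forall x\in G,\chi\in\widehat\Gamma\}$, and an action of $\Gamma$ on $\mathcal{O}(G)$ by Hopf algebra automorphisms $\alpha_g(\phi)=\phi\circ\alpha_g^{-1}$. The graded twisting $\mathcal{O}(G)^{i,\alpha}$ is the Hopf algebra having $\mathcal{O}(G)$ as underlying coalgebra, with product $\phi\cdot\psi=\phi\,\alpha_g(\psi)$ for $\phi\in\mathcal{O}(G)_g$, $\psi\in\mathcal{O}(G)$, and antipode $\phi\mapsto\alpha_{g^{-1}}(S(\phi))$ for $\phi\in\mathcal{O}(G)_g$. Two cocentral actions $(i,\alpha)$, $(j,\beta)$ of $\Gamma$ on $G$ are equivalent if there exist $u\in\mathrm{Aut}(\Gamma)$ and $f\in\mathrm{Aut}(G)$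 such that $i\circ\widehat{u}=f\circ j$ (where $\widehat{u}(\chi)=\chi\circ u$) and $f^{-1}\circ\alpha_g\circ f=\beta_{u(g)}$ for all $g\in\Gamma$. They are weakly equivalent if there exist $u\in\mathrm{Aut}(\Gamma)$ and a group isomorphism $f:G/j(\widehat{\Gamma})\to G/i(\widehat{\Gamma})$ such that $f^{-1}\circ\overline{\alpha}_g\circ f=\overline{\beta}_{u(g)}$ for all $g\in\Gamma$, where $\overline{\alpha}_g$ and $\overline{\beta}_{u(g)}$ are the automorphisms induced by $\alpha_g$ on $G/i(\widehat\Gamma)$ and by $\beta_{u(g)}$ on $G/j(\widehat\Gamma)$. *)

theory Defs
  imports
    "HOL-Algebra.Algebra"
    "HOL-Library.Multiset"
    "HOL-Computational_Algebra.Polynomial"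
begin

section \<open>Groups\<close>

definition center :: "('a, 'm) monoid_scheme \<Rightarrow> 'a set" where
  "center G = {z \<in> carrier G. \<forall>x \<in> carrier G. z \<otimes>\<^bsub>G\<^esub> x = x \<otimes>\<^bsub>G\<^esub> z}"

definition mult_group_of_field :: "'k::field monoid" where
  "mult_group_of_field = \<lparr>carrier = UNIV - {0}, monoid.mult = (*), one = 1\<rparr>"

text \<open>Characters are extensional functions, so that each element of \<open>Hom(\<Gamma>, k\<^sup>\<times>)\<close> has
  exactly one representative.\<close>

definition char_group :: "('g, 'n) monoid_scheme \<Rightarrow> ('g \<Rightarrow> 'k::field) monoid" where
  "char_group \<Gamma> = product_group (carrier \<Gamma>) (\<lambda>_. mult_group_of_field)
     \<lparr>carrier := hom \<Gamma> mult_group_of_field \<inter> extensional (carrier \<Gamma>)\<rparr>"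

definition char_pullback :: "('g, 'n) monoid_scheme \<Rightarrow> ('g \<Rightarrow> 'g) \<Rightarrow> ('g \<Rightarrow> 'k) \<Rightarrow> ('g \<Rightarrow> 'k)" where
  "char_pullback \<Gamma> u \<chi> = compose (carrier \<Gamma>) \<chi> u"


section \<open>Second cohomology with trivial coefficients\<close>

definition cocycles2 :: "('h, 'm) monoid_scheme \<Rightarrow> ('b, 'n) monoid_scheme \<Rightarrow> ('h \<times> 'h \<Rightarrow> 'b) set" where
  "cocycles2 H A = {c \<in> carrier H \<times> carrier H \<rightarrow>\<^sub>E carrier A.
     \<forall>x \<in> carrier H. \<forall>y \<in> carrier H. \<forall>z \<in> carrier H.
       c (y, z) \<otimes>\<^bsub>A\<^esub> c (x, y \<otimes>\<^bsub>H\<^esub> z) = c (x \<otimes>\<^bsub>H\<^esub> y, z) \<otimes>\<^bsub>A\<^esub> c (x, y)}"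

definition coboundaries2 :: "('h, 'm) monoid_scheme \<Rightarrow> ('b, 'n) monoid_scheme \<Rightarrow> ('h \<times> 'h \<Rightarrow> 'b) set" where
  "coboundaries2 H A =
     {\<lambda>(x, y) \<in> carrier H \<times> carrier H. b y \<otimes>\<^bsub>A\<^esub> inv\<^bsub>A\<^esub> (b (x \<otimes>\<^bsub>H\<^esub> y)) \<otimes>\<^bsub>A\<^esub> b x
      | b. b \<in> carrier H \<rightarrow>\<^sub>E carrier A}"

definition H2 :: "('h, 'm) monoid_scheme \<Rightarrow> ('b, 'n) monoid_scheme \<Rightarrow> ('h \<times> 'h \<Rightarrow> 'b) set monoid" where
  "H2 H A = (product_group (carrier H \<times> carrier H) (\<lambda>_. A)) \<lparr>carrier := cocycles2 H A\<rparr>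
     Mod coboundaries2 H A"

text \<open>The maps on cohomology induced by automorphisms of the group and of the coefficients.
  Elements of \<^const>\<open>H2\<close> are cosets of coboundaries, and the maps below act on cosets by taking
  images.  Pullback is a right action of \<open>Aut(H)\<close>; the corresponding left action
  uses the inverse automorphism.\<close>

definition H2_pullback ::
  "('h, 'm) monoid_scheme \<Rightarrow> ('h \<Rightarrow> 'h) \<Rightarrow> ('h \<times> 'h \<Rightarrow> 'b) set \<Rightarrow> ('h \<times> 'h \<Rightarrow> 'b) set" where
  "H2_pullback H \<sigma> C = (\<lambda>c. \<lambda>(x, y) \<in> carrier H \<times> carrier H. c (\<sigma> x, \<sigma> y)) ` C"

definition H2_pushforward ::
  "('h, 'm) monoid_scheme \<Rightarrow> ('b \<Rightarrow> 'b) \<Rightarrow> ('h \<times> 'h \<Rightarrow> 'b) set \<Rightarrow> ('h \<times> 'h \<Rightarrow> 'b) set" where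
  "H2_pushforward H \<tau> C = (\<lambda>c. compose (carrier H \<times> carrier H) \<tau> c) ` C"

definition H2_actions_trivial :: "('h, 'm) monoid_scheme \<Rightarrow> ('b, 'n) monoid_scheme \<Rightarrow> bool" where
  "H2_actions_trivial H A \<longleftrightarrow>
     (\<forall>\<sigma> \<in> auto H. \<forall>C \<in> carrier (H2 H A). H2_pullback H \<sigma> C = C) \<and>
     (\<forall>\<tau> \<in> auto A. \<forall>C \<in> carrier (H2 H A). H2_pushforward H \<tau> C = C)"


section \<open>Tensor products and Hopf algebra isomorphisms\<close>

text \<open>Scalars form the whole type \<open>'k\<close>, so only the operations of the vector space record are
  used.  A multiset of pairs stands for the corresponding sum of pure tensors; \<open>A \<otimes> B\<close> is the free
  commutative monoid on \<open>A \<times> B\<close> modulo the congruence generated by bilinearity (negatives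
  exist in the quotient because of the scalar \<open>-1\<close>).\<close>

inductive tensor_eq ::
  "('k, 'a, 'm) module_scheme \<Rightarrow> ('k, 'b, 'n) module_scheme \<Rightarrow>
   ('a \<times> 'b) multiset \<Rightarrow> ('a \<times> 'b) multiset \<Rightarrow> bool"
  for A B where
  tensor_refl: "set_mset M \<subseteq> carrier A \<times> carrier B \<Longrightarrow> tensor_eq A B M M"
| tensor_sym: "tensor_eq A B M N \<Longrightarrow> tensor_eq A B N M"
| tensor_trans: "tensor_eq A B M N \<Longrightarrow> tensor_eq A B N P \<Longrightarrow> tensor_eq A B M P"
| tensor_plus: "tensor_eq A B M N \<Longrightarrow> tensor_eq A B M' N' \<Longrightarrow> tensor_eq A B (M + M') (N + N')"
| tensor_add_left: "a \<in> carrier A \<Longrightarrow> a' \<in> carrier A \<Longrightarrow> b \<in> carrier B \<Longrightarrow>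
    tensor_eq A B {#(a \<oplus>\<^bsub>A\<^esub> a', b)#} {#(a, b), (a', b)#}"
| tensor_add_right: "a \<in> carrier A \<Longrightarrow> b \<in> carrier B \<Longrightarrow> b' \<in> carrier B \<Longrightarrow>
    tensor_eq A B {#(a, b \<oplus>\<^bsub>B\<^esub> b')#} {#(a, b), (a, b')#}"
| tensor_smult: "a \<in> carrier A \<Longrightarrow> b \<in> carrier B \<Longrightarrow>
    tensor_eq A B {#(r \<odot>\<^bsub>A\<^esub> a, b)#} {#(a, r \<odot>\<^bsub>B\<^esub> b)#}"
| tensor_zero: "b \<in> carrier B \<Longrightarrow> tensor_eq A B {#(\<zero>\<^bsub>A\<^esub>, b)#} {#}"

type_synonym ('a, 'b) tensor = "('a \<times> 'b) multiset set"

definition tensor_class ::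
  "('k, 'a, 'm) module_scheme \<Rightarrow> ('k, 'b, 'n) module_scheme \<Rightarrow> ('a \<times> 'b) multiset \<Rightarrow> ('a, 'b) tensor" where
  "tensor_class A B M = {N. tensor_eq A B M N}"

definition tensor_map ::
  "('k, 'c, 'm) module_scheme \<Rightarrow> ('k, 'd, 'n) module_scheme \<Rightarrow> ('a \<Rightarrow> 'c) \<Rightarrow> ('b \<Rightarrow> 'd) \<Rightarrow>
   ('a, 'b) tensor \<Rightarrow> ('c, 'd) tensor" where
  "tensor_map C D F F' T = (\<Union>M \<in> T. tensor_class C D (image_mset (map_prod F F') M))"

record ('k, 'a) hopf_algebra = "('k, 'a) module" +
  comult :: "'a \<Rightarrow> ('a, 'a) tensor"
  counit :: "'a \<Rightarrow> 'k"
  antipode :: "'a \<Rightarrow> 'a"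

definition hopf_iso ::
  "('k, 'a, 'm) hopf_algebra_scheme \<Rightarrow> ('k, 'b, 'n) hopf_algebra_scheme \<Rightarrow> ('a \<Rightarrow> 'b) set" where
  "hopf_iso A B = {F \<in> ring_iso A B.
     (\<forall>r. \<forall>a \<in> carrier A. F (r \<odot>\<^bsub>A\<^esub> a) = r \<odot>\<^bsub>B\<^esub> F a) \<and>
     (\<forall>a \<in> carrier A. tensor_map B B F F (comult A a) = comult B (F a)) \<and>
     (\<forall>a \<in> carrier A. counit A a = counit B (F a)) \<and>
     (\<forall>a \<in> carrier A. F (antipode A a) = antipode B (F a))}"

definition hopf_isomorphic ::
  "('k, 'a, 'm) hopf_algebra_scheme \<Rightarrow> ('k, 'b, 'n) hopf_algebra_scheme \<Rightarrow> bool" where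
  "hopf_isomorphic A B \<longleftrightarrow> hopf_iso A B \<noteq> {}"


section \<open>The function algebra of a finite group and its graded twistings\<close>

definition fun_space :: "('a, 'm) monoid_scheme \<Rightarrow> ('k::field, 'a \<Rightarrow> 'k) module" where
  "fun_space G =
     \<lparr>carrier = carrier G \<rightarrow>\<^sub>E UNIV,
      monoid.mult = (\<lambda>\<phi> \<psi>. \<lambda>x \<in> carrier G. \<phi> x * \<psi> x),
      one = (\<lambda>x \<in> carrier G. 1),
      ring.zero = (\<lambda>x \<in> carrier G. 0),
      ring.add = (\<lambda>\<phi> \<psi>. \<lambda>x \<in> carrier G. \<phi> x + \<psi> x),
      module.smult = (\<lambda>r \<phi>. \<lambda>x \<in> carrier G. r * \<phi> x)\<rparr>"

definition delta_fun :: "('a, 'm) monoid_scheme \<Rightarrow> 'a \<Rightarrow> ('a \<Rightarrow> 'k::field)" where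
  "delta_fun G x = (\<lambda>y \<in> carrier G. if y = x then 1 else 0)"

text \<open>The comultiplication is dual to the product of \<open>G\<close>: under
  \<open>\<O>(G) \<otimes> \<O>(G) = \<O>(G \<times> G)\<close> it sends \<open>\<phi>\<close> to \<open>(x, y) \<mapsto> \<phi>(x y)\<close>, that is, to
  \<open>\<Sum>x y. \<phi>(x y) \<delta>\<^sub>x \<otimes> \<delta>\<^sub>y\<close>.\<close>

definition fun_hopf :: "('a, 'm) monoid_scheme \<Rightarrow> ('k::field, 'a \<Rightarrow> 'k) hopf_algebra" where
  "fun_hopf G = module.extend (fun_space G)
     \<lparr>comult = (\<lambda>\<phi>. tensor_class (fun_space G) (fun_space G)
        (image_mset (\<lambda>(x, y). (\<phi> (x \<otimes>\<^bsub>G\<^esub> y) \<odot>\<^bsub>fun_space G\<^esub> delta_fun G x, delta_fun G y))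
          (mset_set (carrier G \<times> carrier G)))),
      counit = (\<lambda>\<phi>. \<phi> \<one>\<^bsub>G\<^esub>),
      antipode = (\<lambda>\<phi>. \<lambda>x \<in> carrier G. \<phi> (inv\<^bsub>G\<^esub> x))\<rparr>"

definition cocentral_action ::
  "('g, 'n) monoid_scheme \<Rightarrow> ('a, 'm) monoid_scheme \<Rightarrow> (('g \<Rightarrow> 'k::field) \<Rightarrow> 'a) \<Rightarrow> ('g \<Rightarrow> 'a \<Rightarrow> 'a) \<Rightarrow> bool"
  where
  "cocentral_action \<Gamma> G i \<alpha> \<longleftrightarrow>
     i \<in> mon (char_group \<Gamma>) (G\<lparr>carrier := center G\<rparr>) \<and>
     \<alpha> \<in> hom \<Gamma> (AutoGroup G) \<and>
     (\<forall>g \<in> carrier \<Gamma>. \<forall>\<chi> \<in> carrier (char_group \<Gamma>). \<alpha> g (i \<chi>) = i \<chi>)"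

definition fun_degree ::
  "('g, 'n) monoid_scheme \<Rightarrow> ('a, 'm) monoid_scheme \<Rightarrow> (('g \<Rightarrow> 'k::field) \<Rightarrow> 'a) \<Rightarrow> 'g \<Rightarrow> ('a \<Rightarrow> 'k) set"
  where
  "fun_degree \<Gamma> G i g = {\<phi> \<in> carrier (fun_space G).
     \<forall>x \<in> carrier G. \<forall>\<chi> \<in> carrier (char_group \<Gamma>). \<phi> (x \<otimes>\<^bsub>G\<^esub> i \<chi>) = \<chi> g * \<phi> x}"

text \<open>The degree \<open>g\<close> component of \<open>\<phi>\<close> in \<open>\<O>(G) = \<Oplus>\<^sub>g \<O>(G)\<^sub>g\<close>.\<close>

definition fun_component ::
  "('g, 'n) monoid_scheme \<Rightarrow> ('a, 'm) monoid_scheme \<Rightarrow> (('g \<Rightarrow> 'k::field) \<Rightarrow> 'a) \<Rightarrow>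
   ('a \<Rightarrow> 'k) \<Rightarrow> 'g \<Rightarrow> ('a \<Rightarrow> 'k)" where
  "fun_component \<Gamma> G i \<phi> =
     (THE c. c \<in> (\<Pi>\<^sub>E g \<in> carrier \<Gamma>. fun_degree \<Gamma> G i g) \<and>
             \<phi> = (\<lambda>x \<in> carrier G. \<Sum>g \<in> carrier \<Gamma>. c g x))"

definition fun_act :: "('a, 'm) monoid_scheme \<Rightarrow> ('a \<Rightarrow> 'a) \<Rightarrow> ('a \<Rightarrow> 'k) \<Rightarrow> ('a \<Rightarrow> 'k)" where
  "fun_act G a \<phi> = compose (carrier G) \<phi> (inv_into (carrier G) a)"

text \<open>The product \<open>\<phi> \<cdot> \<psi> = \<phi> \<alpha>\<^sub>g(\<psi>)\<close> and the antipode \<open>\<phi> \<mapsto> \<alpha>(inv g)(S(\<phi>))\<close> for \<open>\<phi>\<close> of degree \<open>g\<close>,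
  extended additively in \<open>\<phi>\<close>.\<close>

definition graded_twist ::
  "('g, 'n) monoid_scheme \<Rightarrow> ('a, 'm) monoid_scheme \<Rightarrow> (('g \<Rightarrow> 'k::field) \<Rightarrow> 'a) \<Rightarrow> ('g \<Rightarrow> 'a \<Rightarrow> 'a) \<Rightarrow>
   ('k, 'a \<Rightarrow> 'k) hopf_algebra" where
  "graded_twist \<Gamma> G i \<alpha> = (fun_hopf G)
     \<lparr>monoid.mult := (\<lambda>\<phi> \<psi>. \<lambda>x \<in> carrier G.
        \<Sum>g \<in> carrier \<Gamma>. (fun_component \<Gamma> G i \<phi> g \<otimes>\<^bsub>fun_hopf G\<^esub> fun_act G (\<alpha> g) \<psi>) x),
      antipode := (\<lambda>\<phi>. \<lambda>x \<in> carrier G.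
        \<Sum>g \<in> carrier \<Gamma>.
          fun_act G (\<alpha> (inv\<^bsub>\<Gamma>\<^esub> g)) (antipode (fun_hopf G) (fun_component \<Gamma> G i \<phi> g)) x)\<rparr>"


section \<open>Equivalence of cocentral actions\<close>

definition equivalent_actions ::
  "('g, 'n) monoid_scheme \<Rightarrow> ('a, 'm) monoid_scheme \<Rightarrow>
   (('g \<Rightarrow> 'k::field) \<Rightarrow> 'a) \<Rightarrow> ('g \<Rightarrow> 'a \<Rightarrow> 'a) \<Rightarrow>
   (('g \<Rightarrow> 'k) \<Rightarrow> 'a) \<Rightarrow> ('g \<Rightarrow> 'a \<Rightarrow> 'a) \<Rightarrow> bool" where
  "equivalent_actions \<Gamma> G i \<alpha> j \<beta> \<longleftrightarrow>
     (\<exists>u \<in> auto \<Gamma>. \<exists>f \<in> auto G.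
        (\<forall>\<chi> \<in> carrier (char_group \<Gamma>). i (char_pullback \<Gamma> u \<chi>) = f (j \<chi>)) \<and>
        (\<forall>g \<in> carrier \<Gamma>. \<forall>x \<in> carrier G.
           inv_into (carrier G) f (\<alpha> g (f x)) = \<beta> (u g) x))"

text \<open>An automorphism \<open>a\<close> of \<open>G\<close> preserving a subgroup induces on the quotient the map
  \<open>C \<mapsto> a ` C\<close> of cosets.\<close>

definition weakly_equivalent_actions ::
  "('g, 'n) monoid_scheme \<Rightarrow> ('a, 'm) monoid_scheme \<Rightarrow>
   (('g \<Rightarrow> 'k::field) \<Rightarrow> 'a) \<Rightarrow> ('g \<Rightarrow> 'a \<Rightarrow> 'a) \<Rightarrow>
   (('g \<Rightarrow> 'k) \<Rightarrow> 'a) \<Rightarrow> ('g \<Rightarrow> 'a \<Rightarrow> 'a) \<Rightarrow> bool" where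
  "weakly_equivalent_actions \<Gamma> G i \<alpha> j \<beta> \<longleftrightarrow>
     (let Gi = G Mod (i ` carrier (char_group \<Gamma>)); Gj = G Mod (j ` carrier (char_group \<Gamma>)) in
      \<exists>u \<in> auto \<Gamma>. \<exists>f \<in> iso Gj Gi.
        \<forall>g \<in> carrier \<Gamma>. \<forall>C \<in> carrier Gj.
          inv_into (carrier Gj) f (\<alpha> g ` f C) = \<beta> (u g) ` C)"

end

theory Submission
  imports Defs
begin

text \<open>
  An equivalence \<open>(u, f)\<close> induces the Hopf algebra isomorphism \<open>\<phi> \<mapsto> \<phi> \<circ> f\<close> as well as a weak equivalence.

  Let \<open>G\<close> be viewed as a central extension of \<open>H\<close> by \<open>\<Gamma>^\<close> through \<open>i\<close> and through \<open>j\<close>.  As \<open>Aut(H)\<close> and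
  \<open>Aut(\<Gamma>^)\<close> act trivially on cohomology, every pair of automorphisms of \<open>H\<close> and \<open>\<Gamma>^\<close> lifts to \<open>G\<close>.  A lift
  \<open>f\<close> of a weak equivalence intertwines \<open>\<alpha>\<close> and \<open>\<beta>\<close> up to homomorphisms \<open>H \<rightarrow> \<Gamma>^\<close>, and these are trivial.

  Let \<open>F\<close> be an isomorphism of the twistings and \<open>\<chi>0\<close> a generator of \<open>\<Gamma>^\<close>.  Dually, \<open>F\<^sup>*(j \<chi>0)\<close> is a central
  grouplike element \<open>y\<close> of the dual of the first twisting, which is \<open>k[G]\<close> with a twisted coproduct.
  Multiplicativity on functions on \<open>H\<close> shows that \<open>y\<close> is supported on one coset \<open>x i(\<Gamma>^)\<close>, and centrality with
  \<open>Hom(H, \<Gamma>^) = 1\<close> shows that \<open>x\<close> is central in \<open>G\<close>.  There can be such \<open>y\<close> outside \<open>k[i(\<Gamma>^)]\<close>: if \<open>Z(G)\<close> has order 4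
  and \<open>\<Gamma>\<close>, of order 2, inverts it, the central grouplike elements form a Klein four-group.  What excludes
  them is that \<open>F\<close> maps the functions fixed by \<open>y\<close> into functions on \<open>H\<close>, which commute; so if a
  character \<open>\<omega>\<close> of \<open>Z(G)\<close> of degree \<open>g\<close> has \<open>\<omega>(y) = 1\<close>, then \<open>\<alpha>\<^sub>g = id\<close>.  Counting the characters with
  \<open>\<omega>(y) = 1\<close> gives \<open>x\<^sup>n = 1\<close> for \<open>n = |\<Gamma>|\<close>, hence \<open>x \<in> i(\<Gamma>^)\<close>, and then \<open>y = i \<chi>1\<close> for a generator \<open>\<chi>1\<close>.
  Thus \<open>F\<close> respects the gradings up to an automorphism of \<open>\<Gamma>\<close>.  Restricted to degree one it comes from an
  automorphism of \<open>H\<close>, which is equivariant because \<open>\<phi> \<cdot> \<psi> = \<alpha>\<^sub>g(\<psi>) \<cdot> \<phi>\<close> for \<open>\<phi>\<close> of degree \<open>g\<close> and \<open>\<psi>\<close> of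
  degree one.
\<close>

section \<open>Characters of finite cyclic groups\<close>

text \<open>A pair of automorphisms of \<open>\<Gamma>^\<close> and \<open>H\<close> lifts to
  \<open>G\<close> exactly when the extension class pushed forward along the first equals the class
  pulled back along the second. With at most two classes this is automatic: both operations are
  invertible and fix the trivial class. The hypothesis \<open>Hom(H, \<Gamma>^) = 1\<close> always
  enters in one way. The failure of an identity is recorded by a map \<open>c\<close> from
  \<open>G\<close> to central elements; centrality of its values makes \<open>c\<close>
  multiplicative, and it is trivial on \<open>i(\<Gamma>^)\<close>, so it descends to
  \<open>H\<close>. The isomorphism \<open>F\<close> is compatible with translations and with the
  twisted products, but not visibly with the gradings. The point \<open>j \<chi>0\<close> is used
  because \<beta> fixes it: evaluation there is multiplicative for the twisted product, which
  evaluation at a general point of \<open>G\<close> need not be. Functions on \<open>H\<close> only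
  show that \<open>x^n\<close> lies in \<open>i(\<Gamma>^)\<close>, that is,
  \<open>x^(n^2) = 1\<close>; the comparison of commuting products serves to lower the exponent from
  \<open>n^2\<close> to \<open>n\<close>.\<close>

lemma carrier_mult_group_of_field [simp]: "carrier mult_group_of_field = UNIV - {0}"
  and mult_mult_group_of_field [simp]: "x \<otimes>\<^bsub>mult_group_of_field\<^esub> y = x * y"
  and one_mult_group_of_field [simp]: "\<one>\<^bsub>mult_group_of_field\<^esub> = 1"
  by (simp_all add: mult_group_of_field_def)

lemma comm_group_mult_group_of_field: "comm_group (mult_group_of_field :: 'k::field monoid)"
  by (rule comm_groupI) (auto intro!: bexI[of _ "inverse _"])

lemma carrier_char_group: "carrier (char_group C) = hom C mult_group_of_field \<inter> extensional (carrier C)"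
  and mult_char_group: "\<chi> \<otimes>\<^bsub>char_group C\<^esub> \<psi> = (\<lambda>x\<in>carrier C. \<chi> x * \<psi> x)"
  and one_char_group: "\<one>\<^bsub>char_group C\<^esub> = (\<lambda>x\<in>carrier C. 1)"
  by (simp_all add: char_group_def)

lemma char_group_memI:
  assumes "\<And>x. x \<in> carrier C \<Longrightarrow> \<chi> x \<noteq> 0"
    and "\<And>x y. x \<in> carrier C \<Longrightarrow> y \<in> carrier C \<Longrightarrow> \<chi> (x \<otimes>\<^bsub>C\<^esub> y) = \<chi> x * \<chi> y"
    and "\<chi> \<in> extensional (carrier C)"
  shows "\<chi> \<in> carrier (char_group C)"
  using assms by (auto simp: carrier_char_group hom_def)

lemma char_eqI:
  assumes "\<chi> \<in> carrier (char_group C)" "\<psi> \<in> carrier (char_group C)" "\<And>x. x \<in> carrier C \<Longrightarrow> \<chi> x = \<psi> x"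
  shows "\<chi> = \<psi>"
  using assms by (auto simp: carrier_char_group intro: extensionalityI)

lemma char_mult_apply [simp]: "x \<in> carrier C \<Longrightarrow> (\<chi> \<otimes>\<^bsub>char_group C\<^esub> \<psi>) x = \<chi> x * \<psi> x"
  and char_one_apply [simp]: "x \<in> carrier C \<Longrightarrow> \<one>\<^bsub>char_group C\<^esub> x = 1"
  by (simp_all add: mult_char_group one_char_group)

lemma char_pow_apply [simp]: "x \<in> carrier C \<Longrightarrow> (\<chi> [^]\<^bsub>char_group C\<^esub> (k::nat)) x = \<chi> x ^ k"
  by (induction k) (simp_all add: nat_pow_def)

context group
begin

lemma char_nonzero: "\<chi> \<in> carrier (char_group G) \<Longrightarrow> x \<in> carrier G \<Longrightarrow> \<chi> x \<noteq> 0"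
  by (auto simp: carrier_char_group hom_def Pi_iff)

lemma char_mult: "\<chi> \<in> carrier (char_group G) \<Longrightarrow> x \<in> carrier G \<Longrightarrow> y \<in> carrier G \<Longrightarrow>
    \<chi> (x \<otimes> y) = \<chi> x * \<chi> y"
  by (simp add: carrier_char_group hom_def)

lemma char_one: assumes "\<chi> \<in> carrier (char_group G)" shows "\<chi> \<one> = 1"
  using char_mult[OF assms, of \<one> \<one>] char_nonzero[OF assms, of \<one>] by simp

lemma char_inv: assumes "\<chi> \<in> carrier (char_group G)" "x \<in> carrier G" shows "\<chi> (inv x) = inverse (\<chi> x)"
  using char_mult[OF assms, of "inv x"] char_one[OF assms(1)] assms
  by (simp add: inverse_unique)

lemma char_pow: assumes "\<chi> \<in> carrier (char_group G)" "x \<in> carrier G" shows "\<chi> (x [^] (k::nat)) = \<chi> x ^ k"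
  using assms by (induction k) (simp_all add: char_one char_mult)

lemma comm_group_char_group: "comm_group (char_group G :: ('a \<Rightarrow> 'k::field) monoid)"
proof (rule comm_groupI)
  fix \<chi> \<psi> \<rho> :: "'a \<Rightarrow> 'k"
  assume 1: "\<chi> \<in> carrier (char_group G)"
  then show "\<one>\<^bsub>char_group G\<^esub> \<otimes>\<^bsub>char_group G\<^esub> \<chi> = \<chi>"
    by (auto simp: mult_char_group one_char_group carrier_char_group fun_eq_iff extensional_def)
  show "\<exists>\<psi>\<in>carrier (char_group G). \<psi> \<otimes>\<^bsub>char_group G\<^esub> \<chi> = \<one>\<^bsub>char_group G\<^esub>"
  proof
    show "(\<lambda>x\<in>carrier G. inverse (\<chi> x)) \<in> carrier (char_group G)"
      using 1 by (intro char_group_memI) (auto simp: char_nonzero char_mult)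
  qed (use 1 in \<open>auto simp: mult_char_group one_char_group char_nonzero fun_eq_iff\<close>)
  assume 2: "\<psi> \<in> carrier (char_group G)"
  show "\<chi> \<otimes>\<^bsub>char_group G\<^esub> \<psi> \<in> carrier (char_group G)"
    using 1 2 by (intro char_group_memI) (auto simp: char_nonzero char_mult mult_char_group)
  show "\<chi> \<otimes>\<^bsub>char_group G\<^esub> \<psi> = \<psi> \<otimes>\<^bsub>char_group G\<^esub> \<chi>"
    by (simp add: mult_char_group mult.commute)
  show "\<chi> \<otimes>\<^bsub>char_group G\<^esub> \<psi> \<otimes>\<^bsub>char_group G\<^esub> \<rho> = \<chi> \<otimes>\<^bsub>char_group G\<^esub> (\<psi> \<otimes>\<^bsub>char_group G\<^esub> \<rho>)"
    by (auto simp: mult_char_group fun_eq_iff mult.assoc)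
next
  show "\<one>\<^bsub>char_group G\<^esub> \<in> carrier (char_group G :: ('a \<Rightarrow> 'k) monoid)"
    by (intro char_group_memI) (auto simp: one_char_group)
qed

lemma group_char_group: "group (char_group G :: ('a \<Rightarrow> 'k::field) monoid)"
  using comm_group_char_group comm_group.axioms(2) by blast

lemma char_inv_apply [simp]:
  assumes "\<chi> \<in> carrier (char_group G)" "x \<in> carrier G"
  shows "(inv\<^bsub>char_group G\<^esub> \<chi>) x = inverse (\<chi> x)"
proof -
  interpret D: group "char_group G" by (rule group_char_group)
  have "(inv\<^bsub>char_group G\<^esub> \<chi> \<otimes>\<^bsub>char_group G\<^esub> \<chi>) x = 1" using assms by simp
  then show ?thesis using assms
    by (metis char_mult_apply inverse_unique mult.commute)
qed

text \<open>Translation by \<open>a\<close> permutes the group and multiplies the sum by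
  \<open>f a\<close>. The function is arbitrary rather than an element of
  \<open>char_group G\<close>, so that evaluation at a point can serve as a character of the dual
  group.\<close>

lemma sum_char:
  assumes "finite (carrier G)" "\<And>x. x \<in> carrier G \<Longrightarrow> f x \<noteq> (0::'k::field)"
    and "\<And>x y. x \<in> carrier G \<Longrightarrow> y \<in> carrier G \<Longrightarrow> f (x \<otimes> y) = f x * f y"
    and "a \<in> carrier G" "f a \<noteq> 1"
  shows "(\<Sum>x\<in>carrier G. f x) = 0"
proof -
  have bij: "bij_betw (\<lambda>x. a \<otimes> x) (carrier G) (carrier G)"
    using assms(4) by (intro bij_betwI[where g = "\<lambda>x. inv a \<otimes> x"]) (auto simp: m_assoc[symmetric])
  have "(\<Sum>x\<in>carrier G. f x) = (\<Sum>x\<in>carrier G. f (a \<otimes> x))"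
    using sum.reindex_bij_betw[OF bij, of f] by simp
  also have "\<dots> = f a * (\<Sum>x\<in>carrier G. f x)"
    using assms by (simp add: sum_distrib_left)
  finally have "(f a - 1) * (\<Sum>x\<in>carrier G. f x) = 0" by (simp add: algebra_simps)
  then show ?thesis using assms(5) by simp
qed

end

text \<open>In characteristic zero \<open>X^N - 1\<close> is separable, because its derivative
  vanishes at most at 0; over an algebraically closed field it therefore has \<open>N\<close>
  distinct roots.\<close>

lemma card_roots_of_unity:
  assumes "N > 0"
  shows "finite {v::'k::{alg_closed_field, field_char_0}. v ^ N = 1}"
    and "card {v::'k. v ^ N = 1} = N"
proof -
  define p :: "'k poly" where "p = monom 1 N - 1"
  have deg: "degree p = N"
  proof -
    have "degree (- 1 + monom 1 N :: 'k poly) = degree (monom 1 N :: 'k poly)"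
      by (rule degree_add_eq_right) (use assms in \<open>simp add: degree_monom_eq\<close>)
    then show ?thesis by (simp add: p_def degree_monom_eq)
  qed
  then have p0: "p \<noteq> 0" using assms by auto
  have roots: "{v. poly p v = 0} = {v. v ^ N = 1}" by (auto simp: p_def poly_monom)
  then show fin: "finite {v::'k. v ^ N = 1}" using poly_roots_finite[OF p0] by simp
  have "rsquarefree p"
    unfolding rsquarefree_roots
  proof (intro allI notI)
    fix a assume a: "poly p a = 0 \<and> poly (pderiv p) a = 0"
    then have 1: "a ^ N = 1" by (simp add: p_def poly_monom)
    from a have "of_nat N * a ^ (N - 1) = 0"
      by (simp add: p_def pderiv_diff pderiv_monom poly_monom)
    then have "a = 0" using assms by auto
    with 1 assms show False by (simp add: power_0_left)
  qed
  then have ord: "order x p = 1" if "x \<in> {v. poly p v = 0}" for x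
    using that p0 rsquarefree_root_order by auto
  obtain A where A: "size A = degree p" "p = smult (lead_coeff p) (\<Prod>x\<in>#A. [:- x, 1:])"
    using alg_closed_imp_factorization[OF p0] by metis
  have lc: "lead_coeff p \<noteq> 0" using p0 by simp
  \<comment> \<open>Multiplicities in the multiset of linear factors are orders of roots. By
    separability \<open>A\<close> contains each root once, and its size counts the roots.\<close>
  have "order x p = count A x" for x
  proof -
    have "order x p = order x (\<Prod>x\<in>#A. [:- x, 1:])"
      by (subst A(2), subst order_smult[OF lc]) (rule refl)
    also have "\<dots> = count A x"
    proof (induction A)
      case (add y A)
      have nz: "[:- y, 1:] * (\<Prod>x\<in>#A. [:- x, 1:]) \<noteq> 0"
        by (auto simp only: mult_eq_0_iff prod_mset_zero_iff) auto
      have "order x (\<Prod>x\<in>#add_mset y A. [:- x, 1:]) = order x [:- y, 1:] + order x (\<Prod>x\<in>#A. [:- x, 1:])"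
        using order_mult[OF nz] by simp
      moreover have "order x [:- y, 1:] = (if x = y then 1 else 0)"
        using order_power_n_n[of y 1] by (auto simp: order_0I)
      ultimately show ?case using add by auto
    qed simp
    finally show ?thesis .
  qed
  then have cnt: "count A x = (if poly p x = 0 then 1 else 0)" for x
    using ord[of x] order_root[of p x] p0 by (auto simp: not_in_iff)
  have "set_mset A = {v. poly p v = 0}"
    by (auto simp: cnt set_mset_def)
  then have "size A = (\<Sum>x\<in>{v. poly p v = 0}. count A x)"
    by (simp add: size_multiset_overloaded_eq)
  also have "\<dots> = card {v. poly p v = 0}" by (simp add: cnt)
  finally show "card {v::'k. v ^ N = 1} = N" using A(1) deg roots by simp
qed

hide_const (open) Polynomial.order

section \<open>Duality for finite cyclic groups\<close>

locale finite_cyclic_group = group G for G (structure) +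
  assumes finite_carrier: "finite (carrier G)" and cyclic: "cyclic_group G"
begin

lemma order_pos: "order G > 0"
  using finite_carrier order_gt_0_iff_finite by blast

lemma generator:
  obtains z where "z \<in> carrier G" "carrier G = (\<lambda>k. z [^] k) ` {..<order G}"
    "\<And>k::nat. z [^] k = \<one> \<longleftrightarrow> order G dvd k"
proof -
  obtain z where z: "z \<in> carrier G" "carrier G = range (\<lambda>k::int. z [^] k)"
    using cyclic cyclic_group by blast
  have eq: "carrier G = (\<lambda>k::nat. z [^] k) ` {..<order G}"
  proof
    show "carrier G \<subseteq> (\<lambda>k::nat. z [^] k) ` {..<order G}"
    proof
      fix x assume "x \<in> carrier G"
      then obtain k :: int where k: "x = z [^] k" unfolding z(2) by blast
      have "z [^] (int (order G)) = \<one>" using z(1) pow_order_eq_1 by (simp add: int_pow_int)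
      have "x = z [^] (k mod int (order G) + int (order G) * (k div int (order G)))" using k by simp
      also have "\<dots> = z [^] (k mod int (order G)) \<otimes> (z [^] (int (order G))) [^] (k div int (order G))"
        using z(1) by (simp only: int_pow_mult int_pow_pow)
      also have "\<dots> = z [^] (k mod int (order G))"
        using z(1) \<open>z [^] (int (order G)) = \<one>\<close> by simp
      also have "\<dots> = z [^] (nat (k mod int (order G)))"
        using order_pos by (simp flip: int_pow_int)
      finally show "x \<in> (\<lambda>k::nat. z [^] k) ` {..<order G}"
        using order_pos by (intro image_eqI[of _ _ "nat (k mod int (order G))"]) (auto simp: nat_less_iff)
    qed
  qed (use z(1) in auto)
  have inj: "inj_on (\<lambda>k::nat. z [^] k) {..<order G}"
    by (rule eq_card_imp_inj_on) (use eq in \<open>auto simp: Coset.order_def\<close>)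
  have "z [^] k = \<one> \<longleftrightarrow> order G dvd k" for k :: nat
  proof
    assume *: "z [^] k = \<one>"
    have "z [^] k = z [^] (order G * (k div order G) + k mod order G)" by simp
    also have "\<dots> = (z [^] order G) [^] (k div order G) \<otimes> z [^] (k mod order G)"
      using z(1) by (simp only: nat_pow_mult nat_pow_pow)
    also have "\<dots> = z [^] (k mod order G)" using z(1) by (simp add: pow_order_eq_1)
    finally have "z [^] (k mod order G) = z [^] (0::nat)" using * by simp
    then have "k mod order G = 0"
      by (rule inj_onD[OF inj]) (use order_pos in auto)
    then show "order G dvd k" by auto
  next
    assume "order G dvd k"
    then obtain l where "k = order G * l" by (rule dvdE)
    then show "z [^] k = \<one>" using z(1) by (simp add: nat_pow_pow[symmetric] pow_order_eq_1)
  qed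
  with z(1) eq that show thesis by blast
qed

lemma exponent_eq: 
  assumes "z \<in> carrier G" "\<And>k::nat. z [^] k = \<one> \<longleftrightarrow> order G dvd k"
  shows "z [^] (k::nat) = z [^] (l::nat) \<longleftrightarrow> k mod order G = l mod order G"
proof -
  have *: "z [^] k = z [^] l \<longleftrightarrow> k mod order G = l mod order G" if "k \<le> l" for k l :: nat
  proof -
    have "z [^] l = z [^] k \<otimes> z [^] (l - k)" using that assms(1) by (simp add: nat_pow_mult)
    then have "z [^] k = z [^] l \<longleftrightarrow> z [^] (l - k) = \<one>"
      using assms(1) by (simp only: nat_pow_closed l_cancel_one')
    also have "\<dots> \<longleftrightarrow> k mod order G = l mod order G"
      using that assms(2) by (metis mod_eq_dvd_iff_nat)
    finally show ?thesis .
  qed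
  show ?thesis using *[of k l] *[of l k] by (metis nat_le_linear)
qed

text \<open>A character is determined by its value at a generator, and every root of unity of order
  dividing \<open>order G\<close> is allowed there.\<close>

lemma bij_betw_char_group:
  assumes z: "z \<in> carrier G" "carrier G = (\<lambda>k. z [^] k) ` {..<order G}"
    "\<And>k::nat. z [^] k = \<one> \<longleftrightarrow> order G dvd k"
  shows "bij_betw (\<lambda>\<chi>. \<chi> z) (carrier (char_group G :: ('a \<Rightarrow> 'k::{alg_closed_field, field_char_0}) monoid))
           {v. v ^ order G = 1}"
proof (rule bij_betw_imageI)
  show "inj_on (\<lambda>\<chi>. \<chi> z) (carrier (char_group G :: ('a \<Rightarrow> 'k) monoid))"
  proof (rule inj_onI)
    fix \<chi> \<psi> :: "'a \<Rightarrow> 'k"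
    assume *: "\<chi> \<in> carrier (char_group G)" "\<psi> \<in> carrier (char_group G)" "\<chi> z = \<psi> z"
    show "\<chi> = \<psi>"
    proof (rule char_eqI[OF *(1,2)])
      fix x assume "x \<in> carrier G"
      then obtain k :: nat where "x = z [^] k" using z(2) by blast
      then show "\<chi> x = \<psi> x" using * z(1) by (simp add: char_pow)
    qed
  qed
  show "(\<lambda>\<chi>. \<chi> z) ` carrier (char_group G :: ('a \<Rightarrow> 'k) monoid) = {v. v ^ order G = 1}"
  proof
    show "(\<lambda>\<chi>. \<chi> z) ` carrier (char_group G :: ('a \<Rightarrow> 'k) monoid) \<subseteq> {v. v ^ order G = 1}"
      using z(1) by (auto simp flip: char_pow simp: pow_order_eq_1 char_one)
    show "{v. v ^ order G = 1} \<subseteq> (\<lambda>\<chi>. \<chi> z) ` carrier (char_group G :: ('a \<Rightarrow> 'k) monoid)"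
    proof
      fix v :: 'k assume "v \<in> {v. v ^ order G = 1}"
      then have v: "v ^ order G = 1" by simp
      then have v0: "v \<noteq> 0" using order_pos by (auto simp: power_0_left)
      have vmod: "v ^ k = v ^ (k mod order G)" for k
      proof -
        have "v ^ k = (v ^ order G) ^ (k div order G) * v ^ (k mod order G)"
          by (simp flip: power_mult power_add)
        then show ?thesis using v by simp
      qed
      \<comment> \<open>The chosen exponent is determined only modulo \<open>order G\<close>, which
        is harmless because \<open>v ^ order G = 1\<close>.\<close>
      define \<chi> where "\<chi> = (\<lambda>x\<in>carrier G. v ^ (SOME k. x = z [^] k))"
      have \<chi>: "\<chi> (z [^] k) = v ^ k" for k :: nat
      proof -
        have "\<exists>l::nat. z [^] k = z [^] l" by blast
        then have "z [^] k = z [^] (SOME l::nat. z [^] k = z [^] l)" by (rule someI_ex)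
        then have "k mod order G = (SOME l::nat. z [^] k = z [^] l) mod order G"
          using exponent_eq[OF z(1,3)] by metis
        then show ?thesis using z(1) unfolding \<chi>_def
          by (simp, metis vmod)
      qed
      have "\<chi> \<in> carrier (char_group G)"
      proof (rule char_group_memI)
        fix x y assume "x \<in> carrier G" "y \<in> carrier G"
        then obtain k l :: nat where "x = z [^] k" "y = z [^] l" using z(2) by blast
        then show "\<chi> (x \<otimes> y) = \<chi> x * \<chi> y" using z(1) by (simp add: nat_pow_mult \<chi> power_add)
      qed (auto simp: v0 \<chi>_def)
      moreover have "\<chi> z = v" using \<chi>[of 1] z(1) by simp
      ultimately show "v \<in> (\<lambda>\<chi>. \<chi> z) ` carrier (char_group G)" by blast
    qed
  qed
qed

lemma card_char_group:
  "finite (carrier (char_group G :: ('a \<Rightarrow> 'k::{alg_closed_field, field_char_0}) monoid))"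
  "order (char_group G :: ('a \<Rightarrow> 'k) monoid) = order G"
proof -
  obtain z where "z \<in> carrier G" "carrier G = (\<lambda>k. z [^] k) ` {..<order G}"
    "\<And>k::nat. z [^] k = \<one> \<longleftrightarrow> order G dvd k"
    by (rule generator) blast
  from bij_betw_char_group[OF this, where 'k = 'k] card_roots_of_unity[OF order_pos, where 'k = 'k]
  show "finite (carrier (char_group G :: ('a \<Rightarrow> 'k) monoid))"
    "order (char_group G :: ('a \<Rightarrow> 'k) monoid) = order G"
    by (auto simp: Coset.order_def dest: bij_betw_finite bij_betw_same_card)
qed

text \<open>If all characters are 1 at \<open>z [^] k\<close>, then all \<open>order G\<close> roots
  of unity are already \<open>k\<close>-th roots of unity; for \<open>0 < k < order G\<close> there
  are only \<open>k\<close> of those.\<close>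

lemma chars_separate:
  assumes "x \<in> carrier G" "\<And>\<chi> :: 'a \<Rightarrow> 'k::{alg_closed_field, field_char_0}. \<chi> \<in> carrier (char_group G) \<Longrightarrow> \<chi> x = 1"
  shows "x = \<one>"
proof -
  obtain z where z: "z \<in> carrier G" "carrier G = (\<lambda>k. z [^] k) ` {..<order G}"
    "\<And>k::nat. z [^] k = \<one> \<longleftrightarrow> order G dvd k"
    by (rule generator) blast
  obtain k where k: "x = z [^] k" "k < order G" using z(2) assms(1) by blast
  have sub: "{v::'k. v ^ order G = 1} \<subseteq> {v. v ^ k = 1}"
  proof
    fix v :: 'k assume "v \<in> {v. v ^ order G = 1}"
    then obtain \<chi> where "\<chi> \<in> carrier (char_group G)" "v = \<chi> z"
      using bij_betw_char_group[OF z, where 'k = 'k] by (auto simp: bij_betw_def)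
    then show "v \<in> {v. v ^ k = 1}" using assms(2)[of \<chi>] z(1) k by (simp add: char_pow)
  qed
  have "k = 0"
  proof (rule ccontr)
    assume "k \<noteq> 0"
    then have "order G \<le> k"
      using card_mono[OF _ sub] card_roots_of_unity[of k, where 'k = 'k]
        card_roots_of_unity[OF order_pos, where 'k = 'k] by simp
    with k show False by simp
  qed
  then show ?thesis using k by simp
qed

lemma sum_over_chars:
  assumes "x \<in> carrier G"
  shows "(\<Sum>\<chi>\<in>carrier (char_group G). \<chi> x :: 'k::{alg_closed_field, field_char_0})
           = (if x = \<one> then of_nat (order G) else 0)"
proof (cases "x = \<one>")
  case True
  then show ?thesis
    using card_char_group(2)[where 'k = 'k] by (simp add: char_one Coset.order_def)
next
  case False
  then obtain \<psi> :: "'a \<Rightarrow> 'k" where "\<psi> \<in> carrier (char_group G)" "\<psi> x \<noteq> 1"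
    using chars_separate[OF assms] by blast
  then show ?thesis using False
    group.sum_char[OF group_char_group card_char_group(1), where f = "\<lambda>\<chi>. \<chi> x :: 'k"] assms
    by (auto simp: char_nonzero)
qed

lemma sum_char_over_group:
  assumes "\<chi> \<in> carrier (char_group G)"
  shows "(\<Sum>x\<in>carrier G. \<chi> x :: 'k::{alg_closed_field, field_char_0})
           = (if \<chi> = \<one>\<^bsub>char_group G\<^esub> then of_nat (order G) else 0)"
proof (cases "\<chi> = \<one>\<^bsub>char_group G\<^esub>")
  case True
  then show ?thesis by (simp add: Coset.order_def)
next
  case False
  interpret D: group "char_group G :: ('a \<Rightarrow> 'k) monoid" by (rule group_char_group)
  obtain x where "x \<in> carrier G" "\<chi> x \<noteq> 1"
    using False char_eqI[OF assms D.one_closed] by auto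
  then show ?thesis using False sum_char[OF finite_carrier, where f = \<chi>] assms
    by (auto simp: char_nonzero char_mult)
qed

text \<open>A subgroup of a cyclic group is determined by its order: the
  \<open>card S\<close>-torsion consists of powers \<open>z [^] (d * l)\<close> with
  \<open>l < card S\<close>, so it is not larger than \<open>S\<close>. This is what identifies the
  images of \<open>i\<close> and \<open>j\<close> inside the center.\<close>

lemma subgroup_eq_torsion:
  assumes "subgroup S G"
  shows "S = {x \<in> carrier G. x [^] card S = \<one>}"
proof -
  obtain z where z: "z \<in> carrier G" "carrier G = (\<lambda>k. z [^] k) ` {..<order G}"
    "\<And>k::nat. z [^] k = \<one> \<longleftrightarrow> order G dvd k"
    by (rule generator) blast
  have finS: "finite S" using assms finite_carrier finite_subset subgroup.subset by metis
  have pos: "card S > 0" using finS subgroup.one_closed[OF assms] by (auto simp: card_gt_0_iff)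
  have "card S dvd order G" using lagrange[OF assms] by (metis dvd_triv_right)
  then obtain d where d: "order G = card S * d" by (rule dvdE)
  define T where "T = {x \<in> carrier G. x [^] card S = \<one>}"
  have sub: "S \<subseteq> T"
  proof
    fix x assume x: "x \<in> S"
    have "group (G\<lparr>carrier := S\<rparr>)" using assms subgroup.subgroup_is_group is_group by blast
    from group.pow_order_eq_1[OF this, of x] x show "x \<in> T"
      using subgroup.mem_carrier[OF assms x] unfolding T_def
      by (simp add: Coset.order_def nat_pow_def)
  qed
  have "T \<subseteq> (\<lambda>l. z [^] (d * l)) ` {..<card S}"
  proof
    fix x assume "x \<in> T"
    then obtain k where k: "k < order G" "x = z [^] k" "x [^] card S = \<one>" using z(2) by (auto simp: T_def)
    then have "order G dvd k * card S" using z(1,3) by (simp add: nat_pow_pow)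
    then have "d dvd k" using pos d by (simp add: mult.commute)
    then obtain l where l: "k = d * l" by (rule dvdE)
    then have "l < card S" using k(1) d by (metis mult.commute mult_less_cancel1)
    then show "x \<in> (\<lambda>l. z [^] (d * l)) ` {..<card S}" using k l by blast
  qed
  then have "card T \<le> card S" and "finite T"
    using surj_card_le[of "{..<card S}" T] finite_surj[of "{..<card S}" T] by auto
  with sub have "S = T" by (intro card_seteq) auto
  then show ?thesis by (simp add: T_def)
qed

text \<open>Evaluation embeds the group in its bidual because characters separate points, and both
  have the same order. Cyclicity of the dual is assumed so that its characters can be counted in the
  same way; for cocentral actions \<open>cyclic_D\<close> supplies it.\<close>

lemma bidual_surj:
  assumes cyc: "cyclic_group (char_group G :: ('a \<Rightarrow> 'k::{alg_closed_field, field_char_0}) monoid)"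
    and \<omega>: "\<omega> \<in> carrier (char_group (char_group G :: ('a \<Rightarrow> 'k) monoid) :: (('a \<Rightarrow> 'k) \<Rightarrow> 'k) monoid)"
  obtains g where "g \<in> carrier G" "\<And>\<chi>. \<chi> \<in> carrier (char_group G) \<Longrightarrow> \<omega> \<chi> = \<chi> g"
proof -
  let ?D = "char_group G :: ('a \<Rightarrow> 'k) monoid"
  let ?DD = "char_group ?D :: (('a \<Rightarrow> 'k) \<Rightarrow> 'k) monoid"
  interpret D: finite_cyclic_group ?D
    using cyc card_char_group(1) group_char_group by (simp add: finite_cyclic_group_def finite_cyclic_group_axioms_def)
  define ev where "ev = (\<lambda>g. \<lambda>\<chi>\<in>carrier ?D. \<chi> g)"
  have "ev ` carrier G \<subseteq> carrier ?DD"
    by (auto simp: ev_def char_nonzero char_mult intro!: char_group_memI)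
  moreover have "inj_on ev (carrier G)"
  proof (rule inj_onI)
    fix g h assume *: "g \<in> carrier G" "h \<in> carrier G" "ev g = ev h"
    have "g \<otimes> inv h = \<one>"
    proof (rule chars_separate)
      fix \<chi> :: "'a \<Rightarrow> 'k" assume \<chi>: "\<chi> \<in> carrier ?D"
      then have "\<chi> g = \<chi> h" using *(3) by (metis ev_def restrict_apply)
      then show "\<chi> (g \<otimes> inv h) = 1" using \<chi> * by (simp add: char_mult char_inv char_nonzero)
    qed (use * in auto)
    then show "g = h" using * by (metis inv_equality inv_inv inv_closed)
  qed
  moreover have "card (carrier ?DD) = card (carrier G)"
    using D.card_char_group(2)[where 'k = 'k] card_char_group(2)[where 'k = 'k] by (simp add: Coset.order_def)
  ultimately have "ev ` carrier G = carrier ?DD"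
    using D.card_char_group(1)[where 'k = 'k] by (intro card_subset_eq) (auto simp: card_image)
  then obtain g where "g \<in> carrier G" "\<omega> = ev g" using \<omega> by auto
  then show thesis using that by (auto simp: ev_def)
qed

end

section \<open>The Hopf algebra of functions\<close>

lemma fun_space_simps [simp]:
  "carrier (fun_space G) = extensional (carrier G)"
  "\<phi> \<otimes>\<^bsub>fun_space G\<^esub> \<psi> = (\<lambda>x\<in>carrier G. \<phi> x * \<psi> x)"
  "\<one>\<^bsub>fun_space G\<^esub> = (\<lambda>x\<in>carrier G. 1)"
  "\<zero>\<^bsub>fun_space G\<^esub> = (\<lambda>x\<in>carrier G. 0)"
  "\<phi> \<oplus>\<^bsub>fun_space G\<^esub> \<psi> = (\<lambda>x\<in>carrier G. \<phi> x + \<psi> x)"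
  "r \<odot>\<^bsub>fun_space G\<^esub> \<phi> = (\<lambda>x\<in>carrier G. r * \<phi> x)"
  by (auto simp: fun_space_def PiE_def)

definition comult_terms :: "('a, 'm) monoid_scheme \<Rightarrow> ('a \<Rightarrow> 'k::field) \<Rightarrow> (('a \<Rightarrow> 'k) \<times> ('a \<Rightarrow> 'k)) multiset" where
  "comult_terms G \<phi> = image_mset (\<lambda>(x, y). (\<phi> (x \<otimes>\<^bsub>G\<^esub> y) \<odot>\<^bsub>fun_space G\<^esub> delta_fun G x, delta_fun G y))
     (mset_set (carrier G \<times> carrier G))"

lemma graded_twist_simps [simp]:
  "carrier (graded_twist \<Gamma> G i \<alpha>) = extensional (carrier G)"
  "\<one>\<^bsub>graded_twist \<Gamma> G i \<alpha>\<^esub> = (\<lambda>x\<in>carrier G. 1)"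
  "\<zero>\<^bsub>graded_twist \<Gamma> G i \<alpha>\<^esub> = (\<lambda>x\<in>carrier G. 0)"
  "\<phi> \<oplus>\<^bsub>graded_twist \<Gamma> G i \<alpha>\<^esub> \<psi> = (\<lambda>x\<in>carrier G. \<phi> x + \<psi> x)"
  "r \<odot>\<^bsub>graded_twist \<Gamma> G i \<alpha>\<^esub> \<phi> = (\<lambda>x\<in>carrier G. r * \<phi> x)"
  "comult (graded_twist \<Gamma> G i \<alpha>) \<phi> = tensor_class (fun_space G) (fun_space G) (comult_terms G \<phi>)"
  "counit (graded_twist \<Gamma> G i \<alpha>) \<phi> = \<phi> \<one>\<^bsub>G\<^esub>"
  by (simp_all add: graded_twist_def fun_hopf_def module.defs fun_space_def PiE_def comult_terms_def)

lemma graded_twist_mult: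
  "\<phi> \<otimes>\<^bsub>graded_twist \<Gamma> G i \<alpha>\<^esub> \<psi> = (\<lambda>x\<in>carrier G.
        \<Sum>g \<in> carrier \<Gamma>. (\<lambda>x\<in>carrier G. fun_component \<Gamma> G i \<phi> g x * fun_act G (\<alpha> g) \<psi> x) x)"
  by (simp add: graded_twist_def fun_hopf_def module.defs fun_space_def)

lemma graded_twist_antipode:
  "antipode (graded_twist \<Gamma> G i \<alpha>) \<phi> = (\<lambda>x \<in> carrier G.
        \<Sum>g \<in> carrier \<Gamma>.
          fun_act G (\<alpha> (inv\<^bsub>\<Gamma>\<^esub> g)) (\<lambda>x\<in>carrier G. fun_component \<Gamma> G i \<phi> g (inv\<^bsub>G\<^esub> x)) x)"
  by (simp add: graded_twist_def fun_hopf_def module.defs fun_space_def)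

lemma delta_fun_ext [simp]: "delta_fun G x \<in> extensional (carrier G)"
  by (simp add: delta_fun_def)

lemma delta_fun_apply: "y \<in> carrier G \<Longrightarrow> delta_fun G x y = (if y = x then 1 else 0)"
  by (simp add: delta_fun_def)

lemma sum_delta_fun:
  assumes "finite (carrier G)" "t \<in> carrier G"
  shows "(\<Sum>y\<in>carrier G. f y * delta_fun G y t) = f t"
proof -
  have "(\<Sum>y\<in>carrier G. f y * delta_fun G y t) = (\<Sum>y\<in>carrier G. if t = y then f y else 0)"
    using assms(2) by (intro sum.cong) (auto simp: delta_fun_apply)
  then show ?thesis using assms by (simp add: sum.delta)
qed

text \<open>A linear map respects each generating relation. This makes \<open>tensor_map\<close>
  independent of the representative.\<close>

lemma tensor_eq_mono:
  assumes "tensor_eq A A M N"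
    and "\<And>a. a \<in> carrier A \<Longrightarrow> F a \<in> carrier B"
    and "\<And>a b. a \<in> carrier A \<Longrightarrow> b \<in> carrier A \<Longrightarrow> F (a \<oplus>\<^bsub>A\<^esub> b) = F a \<oplus>\<^bsub>B\<^esub> F b"
    and "\<And>r a. a \<in> carrier A \<Longrightarrow> F (r \<odot>\<^bsub>A\<^esub> a) = r \<odot>\<^bsub>B\<^esub> F a"
    and "F \<zero>\<^bsub>A\<^esub> = \<zero>\<^bsub>B\<^esub>"
  shows "tensor_eq B B (image_mset (map_prod F F) M) (image_mset (map_prod F F) N)"
  using assms(1)
proof induction
  case (tensor_refl M)
  then show ?case by (intro tensor_eq.tensor_refl) (auto simp: assms(2))
next
  case (tensor_sym M N)
  from tensor_sym.IH show ?case by (rule tensor_eq.tensor_sym)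
next
  case (tensor_trans M N P)
  then show ?case by (blast intro: tensor_eq.tensor_trans)
next
  case (tensor_plus M N M' N')
  then show ?case by (auto intro: tensor_eq.tensor_plus)
next
  case (tensor_add_left a a' b)
  then show ?case using tensor_eq.tensor_add_left[of "F a" B "F a'" "F b" B] by (simp add: assms)
next
  case (tensor_add_right a b b')
  then show ?case using tensor_eq.tensor_add_right[of "F a" B "F b" B "F b'"] by (simp add: assms)
next
  case (tensor_smult a b r)
  then show ?case using tensor_eq.tensor_smult[of "F a" B "F b" B r] by (simp add: assms)
next
  case (tensor_zero b)
  then show ?case using tensor_eq.tensor_zero[of "F b" B B] by (simp add: assms)
qed

lemma tensor_map_class:
  assumes "set_mset M \<subseteq> carrier A \<times> carrier A"
    and "\<And>a. a \<in> carrier A \<Longrightarrow> F a \<in> carrier B"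
    and "\<And>a b. a \<in> carrier A \<Longrightarrow> b \<in> carrier A \<Longrightarrow> F (a \<oplus>\<^bsub>A\<^esub> b) = F a \<oplus>\<^bsub>B\<^esub> F b"
    and "\<And>r a. a \<in> carrier A \<Longrightarrow> F (r \<odot>\<^bsub>A\<^esub> a) = r \<odot>\<^bsub>B\<^esub> F a"
    and "F \<zero>\<^bsub>A\<^esub> = \<zero>\<^bsub>B\<^esub>"
  shows "tensor_map B B F F (tensor_class A A M) = tensor_class B B (image_mset (map_prod F F) M)"
proof -
  have "tensor_class B B (image_mset (map_prod F F) N) = tensor_class B B (image_mset (map_prod F F) M)"
    if "tensor_eq A A M N" for N
    using tensor_eq_mono[OF that assms(2-5)]
    by (auto simp: tensor_class_def intro: tensor_trans tensor_sym)
  then have "tensor_map B B F F (tensor_class A A M)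
      = (\<Union>N\<in>tensor_class A A M. tensor_class B B (image_mset (map_prod F F) M))"
    unfolding tensor_map_def by (intro SUP_cong) (simp_all add: tensor_class_def)
  moreover have "M \<in> tensor_class A A M"
    unfolding tensor_class_def using assms(1) by (simp add: tensor_refl)
  ultimately show ?thesis by blast
qed

text \<open>Twisting leaves the vector space unchanged, so the identity is linear in both
  directions.\<close>

lemma tensor_class_graded_twist:
  "tensor_class (graded_twist \<Gamma> G i \<alpha>) (graded_twist \<Gamma> G i \<alpha>) M = tensor_class (fun_space G) (fun_space G) M"
proof -
  have "tensor_eq (graded_twist \<Gamma> G i \<alpha>) (graded_twist \<Gamma> G i \<alpha>) M N \<longleftrightarrow> tensor_eq (fun_space G) (fun_space G) M N" for N
    using tensor_eq_mono[where F = "\<lambda>x. x" and A = "graded_twist \<Gamma> G i \<alpha>" and B = "fun_space G" and M = M and N = N]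
      tensor_eq_mono[where F = "\<lambda>x. x" and B = "graded_twist \<Gamma> G i \<alpha>" and A = "fun_space G" and M = M and N = N]
    by (auto simp: prod.map_ident)
  then show ?thesis by (simp add: tensor_class_def)
qed

text \<open>Evaluation at \<open>(x, y)\<close> is bilinear, hence an invariant of the class.
  Equalities of tensors thereby become equations between functions on pairs of points.\<close>

lemma tensor_eq_eval:
  assumes "tensor_eq (fun_space G) (fun_space G) M N" "x \<in> carrier G" "y \<in> carrier G"
  shows "(\<Sum>(a, b)\<in>#M. a x * b y) = (\<Sum>(a, b)\<in>#N. a x * b y)"
  using assms(1) by induction (auto simp: assms algebra_simps)

lemma comult_terms_carrier:
  "set_mset (comult_terms G \<phi>) \<subseteq> extensional (carrier G) \<times> extensional (carrier G)"
  by (auto simp: comult_terms_def)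

text \<open>The last two facts express \<open>F\<close> through the values
  \<open>F (delta_fun G x) s\<close>: one is linearity, the other is compatibility with the
  comultiplication, evaluated at the pair \<open>(s, t)\<close>. Closedness of the product is a
  premise because \<open>G\<close> is not assumed to be a group here.\<close>

lemma hopf_iso_graded_twistD:
  assumes F: "F \<in> hopf_iso (graded_twist \<Gamma> G i \<alpha>) (graded_twist \<Gamma> G j \<beta> :: ('k::field, 'a \<Rightarrow> 'k) hopf_algebra)"
    and fin: "finite (carrier G)"
  shows "bij_betw F (extensional (carrier G)) (extensional (carrier G))"
    and "\<phi> \<in> extensional (carrier G) \<Longrightarrow> \<psi> \<in> extensional (carrier G) \<Longrightarrow>
           F (\<phi> \<otimes>\<^bsub>graded_twist \<Gamma> G i \<alpha>\<^esub> \<psi>) = F \<phi> \<otimes>\<^bsub>graded_twist \<Gamma> G j \<beta>\<^esub> F \<psi>"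
    and "F (\<lambda>x\<in>carrier G. 1) = (\<lambda>x\<in>carrier G. 1)"
    and "\<phi> \<in> extensional (carrier G) \<Longrightarrow> s \<in> carrier G \<Longrightarrow> F \<phi> s = (\<Sum>x\<in>carrier G. \<phi> x * F (delta_fun G x) s)"
    and "\<phi> \<in> extensional (carrier G) \<Longrightarrow> s \<in> carrier G \<Longrightarrow> t \<in> carrier G \<Longrightarrow> s \<otimes>\<^bsub>G\<^esub> t \<in> carrier G \<Longrightarrow>
           F \<phi> (s \<otimes>\<^bsub>G\<^esub> t) = (\<Sum>x\<in>carrier G. \<Sum>y\<in>carrier G. \<phi> (x \<otimes>\<^bsub>G\<^esub> y) * F (delta_fun G x) s * F (delta_fun G y) t)"
proof -
  let ?E = "extensional (carrier G)"
  have bij: "bij_betw F ?E ?E" and hom: "F \<in> ring_hom (graded_twist \<Gamma> G i \<alpha>) (graded_twist \<Gamma> G j \<beta>)"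
    and sm: "\<And>r \<phi>. \<phi> \<in> ?E \<Longrightarrow> F (\<lambda>x\<in>carrier G. r * \<phi> x) = (\<lambda>x\<in>carrier G. r * F \<phi> x)"
    and co: "\<And>\<phi>. \<phi> \<in> ?E \<Longrightarrow> tensor_map (graded_twist \<Gamma> G j \<beta>) (graded_twist \<Gamma> G j \<beta>) F F
        (tensor_class (fun_space G) (fun_space G) (comult_terms G \<phi>))
        = tensor_class (fun_space G) (fun_space G) (comult_terms G (F \<phi>))"
    using F by (auto simp: hopf_iso_def ring_iso_def)
  have add: "F (\<lambda>x\<in>carrier G. \<phi> x + \<psi> x) = (\<lambda>x\<in>carrier G. F \<phi> x + F \<psi> x)" if "\<phi> \<in> ?E" "\<psi> \<in> ?E" for \<phi> \<psi>
    using ring_hom_add[OF hom, of \<phi> \<psi>] that by simp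
  have cl: "F \<phi> \<in> ?E" if "\<phi> \<in> ?E" for \<phi> using bij that by (auto simp: bij_betw_def)
  have zero: "F (\<lambda>x\<in>carrier G. 0) = (\<lambda>x\<in>carrier G. 0)"
    using sm[of "\<lambda>x\<in>carrier G. 0" 0] by simp
  show "bij_betw F ?E ?E" by fact
  show "F (\<phi> \<otimes>\<^bsub>graded_twist \<Gamma> G i \<alpha>\<^esub> \<psi>) = F \<phi> \<otimes>\<^bsub>graded_twist \<Gamma> G j \<beta>\<^esub> F \<psi>" if "\<phi> \<in> ?E" "\<psi> \<in> ?E" for \<phi> \<psi>
    using ring_hom_mult[OF hom] that by simp
  show "F (\<lambda>x\<in>carrier G. 1) = (\<lambda>x\<in>carrier G. 1)"
    using ring_hom_one[OF hom] by simp
  show lin: "F \<phi> s = (\<Sum>x\<in>carrier G. \<phi> x * F (delta_fun G x) s)" if "\<phi> \<in> ?E" "s \<in> carrier G" for \<phi> s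
  proof -
    \<comment> \<open>Additivity of \<open>F\<close> concerns two summands, so the expansion in
      delta functions is handled by induction on the index set.\<close>
    have *: "F (\<lambda>y\<in>carrier G. \<Sum>x\<in>S. \<phi> x * delta_fun G x y) s = (\<Sum>x\<in>S. \<phi> x * F (delta_fun G x) s)"
      if "finite S" for S
      using that
    proof induction
      case empty
      show ?case using \<open>s \<in> carrier G\<close> unfolding sum.empty zero by simp
    next
      case (insert x S)
      have "(\<lambda>y\<in>carrier G. \<Sum>x\<in>insert x S. \<phi> x * delta_fun G x y)
          = (\<lambda>y\<in>carrier G. (\<lambda>y\<in>carrier G. \<phi> x * delta_fun G x y) y + (\<lambda>y\<in>carrier G. \<Sum>x\<in>S. \<phi> x * delta_fun G x y) y)"
        using insert by (auto simp: fun_eq_iff)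
      then show ?case using insert \<open>s \<in> carrier G\<close> by (simp only: add sm restrict_extensional delta_fun_ext) simp
    qed
    have "\<phi> = (\<lambda>y\<in>carrier G. \<Sum>x\<in>carrier G. \<phi> x * delta_fun G x y)"
      using that(1) fin
      by (intro extensionalityI[of _ "carrier G"]) (simp_all add: sum_delta_fun)
    then show ?thesis using *[OF fin] by metis
  qed
  show "F \<phi> (s \<otimes>\<^bsub>G\<^esub> t) = (\<Sum>x\<in>carrier G. \<Sum>y\<in>carrier G. \<phi> (x \<otimes>\<^bsub>G\<^esub> y) * F (delta_fun G x) s * F (delta_fun G y) t)"
    if "\<phi> \<in> ?E" and st: "s \<in> carrier G" "t \<in> carrier G" "s \<otimes>\<^bsub>G\<^esub> t \<in> carrier G" for \<phi> s t
  proof -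
    have "tensor_class (fun_space G) (fun_space G) (image_mset (map_prod F F) (comult_terms G \<phi>))
        = tensor_class (fun_space G) (fun_space G) (comult_terms G (F \<phi>))"
      using co[OF \<open>\<phi> \<in> ?E\<close>] tensor_map_class[where A = "fun_space G" and B = "graded_twist \<Gamma> G j \<beta>" and F = F and M = "comult_terms G \<phi>"]
        comult_terms_carrier[of G \<phi>] cl add sm zero
      by (simp add: tensor_class_graded_twist)
    moreover have "tensor_eq (fun_space G) (fun_space G) (comult_terms G (F \<phi>)) (comult_terms G (F \<phi>))"
      by (rule tensor_refl) (use comult_terms_carrier in simp)
    ultimately have "tensor_eq (fun_space G) (fun_space G) (image_mset (map_prod F F) (comult_terms G \<phi>)) (comult_terms G (F \<phi>))"
      by (auto simp: tensor_class_def)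
    from tensor_eq_eval[OF this st(1,2)]
    have "(\<Sum>(x, y)\<in>carrier G \<times> carrier G. F (\<lambda>u\<in>carrier G. \<phi> (x \<otimes>\<^bsub>G\<^esub> y) * delta_fun G x u) s * F (delta_fun G y) t)
        = (\<Sum>(x, y)\<in>carrier G \<times> carrier G. F \<phi> (x \<otimes>\<^bsub>G\<^esub> y) * delta_fun G x s * delta_fun G y t)"
      using st by (simp add: comult_terms_def image_mset.compositionality o_def case_prod_unfold sum_unfold_sum_mset)
    also have "\<dots> = (\<Sum>x\<in>carrier G. \<Sum>y\<in>carrier G. F \<phi> (x \<otimes>\<^bsub>G\<^esub> y) * delta_fun G x s * delta_fun G y t)"
      by (simp add: sum.cartesian_product)
    also have "\<dots> = F \<phi> (s \<otimes>\<^bsub>G\<^esub> t)"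
      by (simp add: sum_delta_fun[OF fin st(2)] sum_delta_fun[OF fin st(1)])
    finally have "F \<phi> (s \<otimes>\<^bsub>G\<^esub> t)
        = (\<Sum>(x, y)\<in>carrier G \<times> carrier G. F (\<lambda>u\<in>carrier G. \<phi> (x \<otimes>\<^bsub>G\<^esub> y) * delta_fun G x u) s * F (delta_fun G y) t)"
      by (rule sym)
    then show ?thesis
      using st(1) by (simp only: sm delta_fun_ext restrict_apply' sum.cartesian_product)
  qed
qed

section \<open>Cocentral actions and the induced grading\<close>

locale cocentral = group G + \<Gamma>: finite_cyclic_group \<Gamma>
  for G :: "('a, 'm) monoid_scheme" (structure) and \<Gamma> :: "('g, 'n) monoid_scheme"
    and i :: "('g \<Rightarrow> 'k::{alg_closed_field, field_char_0}) \<Rightarrow> 'a" and \<alpha> :: "'g \<Rightarrow> 'a \<Rightarrow> 'a" +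
  assumes finite_G: "finite (carrier G)" and action: "cocentral_action \<Gamma> G i \<alpha>"
begin

abbreviation D :: "('g \<Rightarrow> 'k) monoid" where "D \<equiv> char_group \<Gamma>"

sublocale D: comm_group D by (rule \<Gamma>.comm_group_char_group)

lemma finite_D: "finite (carrier D)" and card_D: "card (carrier D) = order \<Gamma>"
  using \<Gamma>.card_char_group[where 'k = 'k] by (simp_all add: Coset.order_def)

lemma order_nonzero [simp]: "order \<Gamma> \<noteq> 0"
  using \<Gamma>.order_pos by simp

lemma i_mon: "i \<in> mon D (G\<lparr>carrier := center G\<rparr>)"
  and \<alpha>_hom: "\<alpha> \<in> hom \<Gamma> (AutoGroup G)"
  and \<alpha>_i [simp]: "g \<in> carrier \<Gamma> \<Longrightarrow> \<chi> \<in> carrier D \<Longrightarrow> \<alpha> g (i \<chi>) = i \<chi>"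
  using action by (auto simp: cocentral_action_def)

lemma i_center: "\<chi> \<in> carrier D \<Longrightarrow> i \<chi> \<in> center G"
  and i_mult: "\<chi> \<in> carrier D \<Longrightarrow> \<psi> \<in> carrier D \<Longrightarrow> i (\<chi> \<otimes>\<^bsub>D\<^esub> \<psi>) = i \<chi> \<otimes> i \<psi>"
  and i_inj: "inj_on i (carrier D)"
  using i_mon by (auto simp: mon_def hom_def)

lemma i_closed [simp]: "\<chi> \<in> carrier D \<Longrightarrow> i \<chi> \<in> carrier G"
  and i_comm: "\<chi> \<in> carrier D \<Longrightarrow> x \<in> carrier G \<Longrightarrow> i \<chi> \<otimes> x = x \<otimes> i \<chi>"
  using i_center by (auto simp: center_def)

lemma i_one: "i \<one>\<^bsub>D\<^esub> = \<one>"
  using i_mult[of "\<one>\<^bsub>D\<^esub>" "\<one>\<^bsub>D\<^esub>"] by (simp add: l_cancel_one')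

lemma i_group_hom: "group_hom D G i"
  by unfold_locales (auto simp: hom_def i_mult)

lemma i_pow: "\<chi> \<in> carrier D \<Longrightarrow> i (\<chi> [^]\<^bsub>D\<^esub> (k::nat)) = i \<chi> [^] k"
  using group_hom.hom_nat_pow[OF i_group_hom] by auto

lemma \<alpha>_auto: "g \<in> carrier \<Gamma> \<Longrightarrow> \<alpha> g \<in> auto G"
  using \<alpha>_hom by (auto simp: hom_def AutoGroup_def)

lemma \<alpha>_closed [simp]: "g \<in> carrier \<Gamma> \<Longrightarrow> x \<in> carrier G \<Longrightarrow> \<alpha> g x \<in> carrier G"
  and \<alpha>_mult: "g \<in> carrier \<Gamma> \<Longrightarrow> x \<in> carrier G \<Longrightarrow> y \<in> carrier G \<Longrightarrow> \<alpha> g (x \<otimes> y) = \<alpha> g x \<otimes> \<alpha> g y"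
  using \<alpha>_auto by (auto simp: auto_def hom_def Pi_iff)

lemma \<alpha>_comp:
  assumes "g \<in> carrier \<Gamma>" "h \<in> carrier \<Gamma>" "x \<in> carrier G"
  shows "\<alpha> (g \<otimes>\<^bsub>\<Gamma>\<^esub> h) x = \<alpha> g (\<alpha> h x)"
proof -
  have "\<alpha> (g \<otimes>\<^bsub>\<Gamma>\<^esub> h) = \<alpha> g \<otimes>\<^bsub>AutoGroup G\<^esub> \<alpha> h"
    using \<alpha>_hom assms by (simp add: hom_def)
  then show ?thesis
    using \<alpha>_auto[OF assms(1)] \<alpha>_auto[OF assms(2)] assms
    by (simp add: AutoGroup_def BijGroup_def auto_def compose_def)
qed

lemma \<alpha>_one [simp]: assumes "x \<in> carrier G" shows "\<alpha> \<one>\<^bsub>\<Gamma>\<^esub> x = x"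
proof -
  have "inj_on (\<alpha> \<one>\<^bsub>\<Gamma>\<^esub>) (carrier G)"
    using \<alpha>_auto[of "\<one>\<^bsub>\<Gamma>\<^esub>"] by (auto simp: auto_def Bij_def bij_betw_def)
  moreover have "\<alpha> \<one>\<^bsub>\<Gamma>\<^esub> (\<alpha> \<one>\<^bsub>\<Gamma>\<^esub> x) = \<alpha> \<one>\<^bsub>\<Gamma>\<^esub> x"
    using \<alpha>_comp[of "\<one>\<^bsub>\<Gamma>\<^esub>" "\<one>\<^bsub>\<Gamma>\<^esub>" x] assms by simp
  ultimately show ?thesis using assms by (auto dest: inj_onD)
qed

lemma \<alpha>_inv [simp]:
  assumes "g \<in> carrier \<Gamma>" "x \<in> carrier G"
  shows "\<alpha> (inv\<^bsub>\<Gamma>\<^esub> g) (\<alpha> g x) = x" "\<alpha> g (\<alpha> (inv\<^bsub>\<Gamma>\<^esub> g) x) = x"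
  using assms by (simp_all flip: \<alpha>_comp)

lemma inv_into_\<alpha>: 
  assumes "g \<in> carrier \<Gamma>" "x \<in> carrier G" shows "inv_into (carrier G) (\<alpha> g) x = \<alpha> (inv\<^bsub>\<Gamma>\<^esub> g) x"
proof (rule inv_into_f_eq)
  show "inj_on (\<alpha> g) (carrier G)" using \<alpha>_auto[OF assms(1)] by (auto simp: auto_def Bij_def bij_betw_def)
qed (use assms in auto)

lemma fun_act_\<alpha>: "g \<in> carrier \<Gamma> \<Longrightarrow> fun_act G (\<alpha> g) \<phi> = (\<lambda>x\<in>carrier G. \<phi> (\<alpha> (inv\<^bsub>\<Gamma>\<^esub> g) x))"
  by (auto simp: fun_act_def compose_def inv_into_\<alpha> fun_eq_iff)

abbreviation "dgr \<equiv> fun_degree \<Gamma> G i"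

lemma degI:
  assumes "\<phi> \<in> extensional (carrier G)"
    and "\<And>x \<chi>. x \<in> carrier G \<Longrightarrow> \<chi> \<in> carrier D \<Longrightarrow> \<phi> (x \<otimes> i \<chi>) = \<chi> g * \<phi> x"
  shows "\<phi> \<in> dgr g"
  using assms by (simp add: fun_degree_def)

lemma deg_ext: "\<phi> \<in> dgr g \<Longrightarrow> \<phi> \<in> extensional (carrier G)"
  and degD: "\<phi> \<in> dgr g \<Longrightarrow> x \<in> carrier G \<Longrightarrow> \<chi> \<in> carrier D \<Longrightarrow> \<phi> (x \<otimes> i \<chi>) = \<chi> g * \<phi> x"
  by (simp_all add: fun_degree_def)

text \<open>The projection onto degree \<open>g\<close>, written as the isotypic projection for the
  translations by \<open>i(\<Gamma>^)\<close>.\<close>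

definition avg :: "('a \<Rightarrow> 'k) \<Rightarrow> 'g \<Rightarrow> 'a \<Rightarrow> 'k" where
  "avg \<phi> g = (\<lambda>x\<in>carrier G. (\<Sum>\<chi>\<in>carrier D. inverse (\<chi> g) * \<phi> (x \<otimes> i \<chi>)) / of_nat (order \<Gamma>))"

lemma avg_deg:
  assumes g: "g \<in> carrier \<Gamma>"
  shows "avg \<phi> g \<in> dgr g"
proof (rule degI)
  fix x \<psi> assume x: "x \<in> carrier G" and \<psi>: "\<psi> \<in> carrier D"
  have bij: "bij_betw (\<lambda>\<chi>. \<psi> \<otimes>\<^bsub>D\<^esub> \<chi>) (carrier D) (carrier D)"
    using \<psi> by (intro bij_betwI[where g = "\<lambda>\<chi>. inv\<^bsub>D\<^esub> \<psi> \<otimes>\<^bsub>D\<^esub> \<chi>"]) (auto simp: D.m_assoc[symmetric])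
  have "(\<Sum>\<chi>\<in>carrier D. inverse (\<chi> g) * \<phi> (x \<otimes> i \<psi> \<otimes> i \<chi>))
      = (\<Sum>\<chi>\<in>carrier D. \<psi> g * (inverse ((\<psi> \<otimes>\<^bsub>D\<^esub> \<chi>) g) * \<phi> (x \<otimes> i (\<psi> \<otimes>\<^bsub>D\<^esub> \<chi>))))"
    using g x \<psi> \<Gamma>.char_nonzero[OF \<psi> g] by (intro sum.cong) (auto simp: i_mult m_assoc)
  also have "\<dots> = \<psi> g * (\<Sum>\<chi>\<in>carrier D. inverse (\<chi> g) * \<phi> (x \<otimes> i \<chi>))"
    using sum.reindex_bij_betw[OF bij, of "\<lambda>\<chi>. inverse (\<chi> g) * \<phi> (x \<otimes> i \<chi>)"]
    by (simp only: sum_distrib_left[symmetric])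
  finally show "avg \<phi> g (x \<otimes> i \<psi>) = \<psi> g * avg \<phi> g x"
    using x \<psi> by (simp add: avg_def)
qed (simp add: avg_def)

text \<open>Orthogonality over \<Gamma>: summing the coefficients over \<open>g\<close> leaves only
  the term of the trivial character.\<close>

lemma sum_avg:
  assumes x: "x \<in> carrier G"
  shows "(\<Sum>g\<in>carrier \<Gamma>. avg \<phi> g x) = \<phi> x"
proof -
  have "(\<Sum>g\<in>carrier \<Gamma>. avg \<phi> g x) = (\<Sum>\<chi>\<in>carrier D. (\<Sum>g\<in>carrier \<Gamma>. (inv\<^bsub>D\<^esub> \<chi>) g) * \<phi> (x \<otimes> i \<chi>)) / of_nat (order \<Gamma>)"
    using x by (simp add: avg_def sum_divide_distrib[symmetric] sum_distrib_right sum.swap[of _ "carrier \<Gamma>"])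
  also have "\<dots> = (\<Sum>\<chi>\<in>carrier D. if \<chi> = \<one>\<^bsub>D\<^esub> then of_nat (order \<Gamma>) * \<phi> (x \<otimes> i \<chi>) else 0) / of_nat (order \<Gamma>)"
  proof (intro arg_cong2[where f = "(/)"] sum.cong refl)
    fix \<chi> assume \<chi>: "\<chi> \<in> carrier D"
    have *: "(\<Sum>g\<in>carrier \<Gamma>. (inv\<^bsub>D\<^esub> \<chi>) g) = (if \<chi> = \<one>\<^bsub>D\<^esub> then of_nat (order \<Gamma>) else 0)"
      using \<Gamma>.sum_char_over_group[OF D.inv_closed[OF \<chi>]] \<chi> by (simp only: D.inv_eq_1_iff)
    show "(\<Sum>g\<in>carrier \<Gamma>. (inv\<^bsub>D\<^esub> \<chi>) g) * \<phi> (x \<otimes> i \<chi>)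
        = (if \<chi> = \<one>\<^bsub>D\<^esub> then of_nat (order \<Gamma>) * \<phi> (x \<otimes> i \<chi>) else 0)"
      unfolding * by simp
  qed
  also have "\<dots> = \<phi> x"
    using x finite_D by (simp add: i_one)
  finally show ?thesis .
qed

text \<open>The dual orthogonality relation: averaging over characters extracts \<open>c h\<close>
  from any homogeneous decomposition, which makes decompositions unique.\<close>

lemma avg_sum_deg:
  assumes c: "\<And>g. g \<in> carrier \<Gamma> \<Longrightarrow> c g \<in> dgr g"
    and \<phi>: "\<And>x. x \<in> carrier G \<Longrightarrow> \<phi> x = (\<Sum>g\<in>carrier \<Gamma>. c g x)" and h: "h \<in> carrier \<Gamma>"
  shows "avg \<phi> h = c h"
proof (rule extensionalityI[of _ "carrier G"])
  fix x assume x: "x \<in> carrier G"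
  have "(\<Sum>\<chi>\<in>carrier D. inverse (\<chi> h) * \<phi> (x \<otimes> i \<chi>))
      = (\<Sum>\<chi>\<in>carrier D. \<Sum>g\<in>carrier \<Gamma>. \<chi> (inv\<^bsub>\<Gamma>\<^esub> h \<otimes>\<^bsub>\<Gamma>\<^esub> g) * c g x)"
    using x h by (intro sum.cong) (auto simp: \<phi> sum_distrib_left degD[OF c] \<Gamma>.char_mult \<Gamma>.char_inv mult.assoc)
  also have "\<dots> = (\<Sum>g\<in>carrier \<Gamma>. (\<Sum>\<chi>\<in>carrier D. \<chi> (inv\<^bsub>\<Gamma>\<^esub> h \<otimes>\<^bsub>\<Gamma>\<^esub> g)) * c g x)"
    by (subst sum.swap) (simp add: sum_distrib_right)
  also have "\<dots> = (\<Sum>g\<in>carrier \<Gamma>. if g = h then of_nat (order \<Gamma>) * c g x else 0)"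
  proof (rule sum.cong[OF refl])
    fix g assume g: "g \<in> carrier \<Gamma>"
    have "inv\<^bsub>\<Gamma>\<^esub> h \<otimes>\<^bsub>\<Gamma>\<^esub> g = \<one>\<^bsub>\<Gamma>\<^esub> \<longleftrightarrow> g = h"
      using g h by (metis \<Gamma>.inv_closed \<Gamma>.inv_equality \<Gamma>.inv_inv \<Gamma>.l_inv \<Gamma>.inv_comm)
    then show "(\<Sum>\<chi>\<in>carrier D. \<chi> (inv\<^bsub>\<Gamma>\<^esub> h \<otimes>\<^bsub>\<Gamma>\<^esub> g)) * c g x = (if g = h then of_nat (order \<Gamma>) * c g x else 0)"
      using g h by (simp add: \<Gamma>.sum_over_chars)
  qed
  also have "\<dots> = of_nat (order \<Gamma>) * c h x"
    using h \<Gamma>.finite_carrier by simp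
  finally show "avg \<phi> h x = c h x" using x by (simp add: avg_def)
qed (use deg_ext[OF c[OF h]] in \<open>auto simp: avg_def\<close>)

text \<open>Existence and uniqueness of the homogeneous decomposition turn the definite description
  into an explicit average.\<close>

lemma fun_component_eq:
  assumes "\<phi> \<in> extensional (carrier G)"
  shows "fun_component \<Gamma> G i \<phi> = (\<lambda>g\<in>carrier \<Gamma>. avg \<phi> g)"
  unfolding fun_component_def
proof (rule the_equality)
  show "(\<lambda>g\<in>carrier \<Gamma>. avg \<phi> g) \<in> Pi\<^sub>E (carrier \<Gamma>) dgr \<and>
      \<phi> = (\<lambda>x\<in>carrier G. \<Sum>g\<in>carrier \<Gamma>. (\<lambda>g\<in>carrier \<Gamma>. avg \<phi> g) g x)"
    using assms by (auto simp: avg_deg sum_avg intro: extensionalityI)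
next
  fix c assume c: "c \<in> Pi\<^sub>E (carrier \<Gamma>) dgr \<and> \<phi> = (\<lambda>x\<in>carrier G. \<Sum>g\<in>carrier \<Gamma>. c g x)"
  have "avg \<phi> g = c g" if "g \<in> carrier \<Gamma>" for g
    using avg_sum_deg[of c \<phi> g] c that by (auto simp: PiE_iff)
  then show "c = (\<lambda>g\<in>carrier \<Gamma>. avg \<phi> g)"
    using c by (intro extensionalityI[of _ "carrier \<Gamma>"]) (auto simp: PiE_iff)
qed

lemma avg_of_deg:
  assumes \<phi>: "\<phi> \<in> dgr g" and g: "g \<in> carrier \<Gamma>" and h: "h \<in> carrier \<Gamma>"
  shows "avg \<phi> h = (if h = g then \<phi> else (\<lambda>x\<in>carrier G. 0))"
proof (rule avg_sum_deg[OF _ _ h])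
  show "(if h = g then \<phi> else (\<lambda>x\<in>carrier G. 0)) \<in> dgr h" for h
    using \<phi> by (auto intro: degI)
  show "\<phi> x = (\<Sum>h\<in>carrier \<Gamma>. (if h = g then \<phi> else (\<lambda>x\<in>carrier G. 0)) x)" if "x \<in> carrier G" for x
  proof -
    have "(\<Sum>h\<in>carrier \<Gamma>. (if h = g then \<phi> else (\<lambda>x\<in>carrier G. 0)) x) = (\<Sum>h\<in>carrier \<Gamma>. if h = g then \<phi> x else 0)"
      using that by (intro sum.cong) auto
    then show ?thesis using g \<Gamma>.finite_carrier by simp
  qed
qed

abbreviation twist_mult :: "('a \<Rightarrow> 'k) \<Rightarrow> ('a \<Rightarrow> 'k) \<Rightarrow> 'a \<Rightarrow> 'k" (infixl "\<star>" 70) where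
  "\<phi> \<star> \<psi> \<equiv> \<phi> \<otimes>\<^bsub>graded_twist \<Gamma> G i \<alpha>\<^esub> \<psi>"

lemma twist_mult_eq:
  assumes "\<phi> \<in> extensional (carrier G)"
  shows "\<phi> \<star> \<psi> = (\<lambda>x\<in>carrier G. \<Sum>g\<in>carrier \<Gamma>. avg \<phi> g x * \<psi> (\<alpha> (inv\<^bsub>\<Gamma>\<^esub> g) x))"
  using assms by (auto simp: graded_twist_mult fun_component_eq fun_act_\<alpha> fun_eq_iff intro!: sum.cong)

lemma twist_mult_deg:
  assumes \<phi>: "\<phi> \<in> dgr g" and g: "g \<in> carrier \<Gamma>"
  shows "\<phi> \<star> \<psi> = (\<lambda>x\<in>carrier G. \<phi> x * \<psi> (\<alpha> (inv\<^bsub>\<Gamma>\<^esub> g) x))"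
proof (rule extensionalityI[of _ "carrier G"])
  fix x assume x: "x \<in> carrier G"
  have "(\<phi> \<star> \<psi>) x = (\<Sum>h\<in>carrier \<Gamma>. if h = g then \<phi> x * \<psi> (\<alpha> (inv\<^bsub>\<Gamma>\<^esub> g) x) else 0)"
    using x deg_ext[OF \<phi>] by (auto simp: twist_mult_eq avg_of_deg[OF \<phi> g] intro!: sum.cong)
  then show "(\<phi> \<star> \<psi>) x = (\<lambda>x\<in>carrier G. \<phi> x * \<psi> (\<alpha> (inv\<^bsub>\<Gamma>\<^esub> g) x)) x"
    using x g \<Gamma>.finite_carrier by simp
qed (use deg_ext[OF \<phi>] in \<open>auto simp: twist_mult_eq\<close>)

lemma twist_antipode_eq:
  assumes "\<phi> \<in> extensional (carrier G)"
  shows "antipode (graded_twist \<Gamma> G i \<alpha>) \<phi> = (\<lambda>x\<in>carrier G. \<Sum>g\<in>carrier \<Gamma>. avg \<phi> g (inv (\<alpha> g x)))"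
  using assms by (auto simp: graded_twist_antipode fun_component_eq fun_act_\<alpha> fun_eq_iff intro!: sum.cong)

end

section \<open>Equivalent actions have isomorphic twistings\<close>

locale cocentral_pair = A: cocentral G \<Gamma> i \<alpha> + B: cocentral G \<Gamma> j \<beta>
  for G :: "('a, 'm) monoid_scheme" (structure) and \<Gamma> :: "('g, 'n) monoid_scheme"
    and i j :: "('g \<Rightarrow> 'k::{alg_closed_field, field_char_0}) \<Rightarrow> 'a" and \<alpha> \<beta> :: "'g \<Rightarrow> 'a \<Rightarrow> 'a"
begin

lemma char_pullback_closed:
  assumes "u \<in> auto \<Gamma>" "\<chi> \<in> carrier A.D"
  shows "char_pullback \<Gamma> u \<chi> \<in> carrier A.D"
proof (rule char_group_memI)
  have u: "u g \<in> carrier \<Gamma>" "u (g \<otimes>\<^bsub>\<Gamma>\<^esub> h) = u g \<otimes>\<^bsub>\<Gamma>\<^esub> u h" if "g \<in> carrier \<Gamma>" "h \<in> carrier \<Gamma>" for g h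
    using assms(1) that by (auto simp: auto_def hom_def)
  show "char_pullback \<Gamma> u \<chi> g \<noteq> 0" if "g \<in> carrier \<Gamma>" for g
    using that u assms(2) by (simp add: char_pullback_def compose_def A.\<Gamma>.char_nonzero)
  show "char_pullback \<Gamma> u \<chi> (g \<otimes>\<^bsub>\<Gamma>\<^esub> h) = char_pullback \<Gamma> u \<chi> g * char_pullback \<Gamma> u \<chi> h"
    if "g \<in> carrier \<Gamma>" "h \<in> carrier \<Gamma>" for g h
    using that u assms(2) by (simp add: char_pullback_def compose_def A.\<Gamma>.char_mult)
qed (simp add: char_pullback_def)

lemma bij_char_pullback:
  assumes u: "u \<in> auto \<Gamma>"
  shows "bij_betw (char_pullback \<Gamma> u) (carrier A.D) (carrier A.D)"
proof -
  have surj: "u ` carrier \<Gamma> = carrier \<Gamma>" using u by (auto simp: auto_def Bij_def bij_betw_def)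
  have inj: "inj_on (char_pullback \<Gamma> u) (carrier A.D)"
  proof (rule inj_onI)
    fix \<chi> \<psi> assume *: "\<chi> \<in> carrier A.D" "\<psi> \<in> carrier A.D" "char_pullback \<Gamma> u \<chi> = char_pullback \<Gamma> u \<psi>"
    show "\<chi> = \<psi>"
    proof (rule char_eqI[OF *(1,2)])
      fix g assume "g \<in> carrier \<Gamma>"
      then obtain h where "h \<in> carrier \<Gamma>" "g = u h" using surj by blast
      then show "\<chi> g = \<psi> g" using fun_cong[OF *(3), of h] by (simp add: char_pullback_def compose_def)
    qed
  qed
  then show ?thesis
    using endo_inj_surj[OF A.finite_D, of "char_pullback \<Gamma> u"] char_pullback_closed[OF u]
    by (auto simp: bij_betw_def)
qed

lemma equivalent_imp_hopf_isomorphic: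
  assumes "equivalent_actions \<Gamma> G i \<alpha> j \<beta>"
  shows "hopf_isomorphic (graded_twist \<Gamma> G i \<alpha>) (graded_twist \<Gamma> G j \<beta>)"
proof -
  obtain u f where u: "u \<in> auto \<Gamma>" and f: "f \<in> auto G"
    and fj: "\<And>\<chi>. \<chi> \<in> carrier A.D \<Longrightarrow> f (j \<chi>) = i (char_pullback \<Gamma> u \<chi>)"
    and conj: "\<And>g x. g \<in> carrier \<Gamma> \<Longrightarrow> x \<in> carrier G \<Longrightarrow> inv_into (carrier G) f (\<alpha> g (f x)) = \<beta> (u g) x"
    using assms unfolding equivalent_actions_def by metis
  have f_cl [simp]: "f x \<in> carrier G" if "x \<in> carrier G" for x
    using f that by (auto simp: auto_def hom_def)
  have f_mult: "f (x \<otimes> y) = f x \<otimes> f y" if "x \<in> carrier G" "y \<in> carrier G" for x y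
    using f that by (auto simp: auto_def hom_def)
  have f_bij: "bij_betw f (carrier G) (carrier G)" using f by (simp add: auto_def Bij_def)
  have f_hom: "group_hom G G f" using f_mult by unfold_locales (auto simp: hom_def)
  have u_cl [simp]: "u g \<in> carrier \<Gamma>" if "g \<in> carrier \<Gamma>" for g
    using u that by (auto simp: auto_def hom_def)
  have u_hom: "group_hom \<Gamma> \<Gamma> u" using u by unfold_locales (auto simp: auto_def)
  have u_bij: "bij_betw u (carrier \<Gamma>) (carrier \<Gamma>)" using u by (simp add: auto_def Bij_def)
  have act: "\<alpha> g (f x) = f (\<beta> (u g) x)" if "g \<in> carrier \<Gamma>" "x \<in> carrier G" for g x
    using conj[OF that] f_inv_into_f[of "\<alpha> g (f x)" f "carrier G"] that f_bij by (simp add: bij_betw_def)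
  have act': "\<alpha> (inv\<^bsub>\<Gamma>\<^esub> g) (f x) = f (\<beta> (inv\<^bsub>\<Gamma>\<^esub> (u g)) x)" if "g \<in> carrier \<Gamma>" "x \<in> carrier G" for g x
    using act[of "inv\<^bsub>\<Gamma>\<^esub> g" x] that group_hom.hom_inv[OF u_hom] by simp
  define F :: "('a \<Rightarrow> 'k) \<Rightarrow> 'a \<Rightarrow> 'k" where "F \<phi> = (\<lambda>x\<in>carrier G. \<phi> (f x))" for \<phi>
  have F_apply: "F \<phi> x = \<phi> (f x)" if "x \<in> carrier G" for \<phi> x using that by (simp add: F_def)
  let ?E = "extensional (carrier G) :: ('a \<Rightarrow> 'k) set"
  \<comment> \<open>Since \<open>f\<close> carries translation by \<open>j \<chi>\<close> to
    translation by \<open>i (char_pullback \<Gamma> u \<chi>)\<close>, reindexing the characters by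
    \<open>u\<close> turns the projection to degree \<open>u g\<close> for \<open>j\<close> into the
    projection to degree \<open>g\<close> for \<open>i\<close>.\<close>
  have F_avg: "B.avg (F \<phi>) (u g) x = A.avg \<phi> g (f x)" if g: "g \<in> carrier \<Gamma>" and x: "x \<in> carrier G" for \<phi> g x
  proof -
    have "(\<Sum>\<chi>\<in>carrier A.D. inverse (\<chi> (u g)) * F \<phi> (x \<otimes> j \<chi>))
        = (\<Sum>\<chi>\<in>carrier A.D. inverse (char_pullback \<Gamma> u \<chi> g) * \<phi> (f x \<otimes> i (char_pullback \<Gamma> u \<chi>)))"
      using g x by (intro sum.cong) (auto simp: F_def f_mult fj char_pullback_def compose_def)
    also have "\<dots> = (\<Sum>\<chi>\<in>carrier A.D. inverse (\<chi> g) * \<phi> (f x \<otimes> i \<chi>))"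
      using sum.reindex_bij_betw[OF bij_char_pullback[OF u], of "\<lambda>\<chi>. inverse (\<chi> g) * \<phi> (f x \<otimes> i \<chi>)"] by simp
    finally show ?thesis using x by (simp add: A.avg_def B.avg_def)
  qed
  have F_bij: "bij_betw F ?E ?E"
  proof (rule bij_betw_byWitness[where f' = "\<lambda>\<phi>. \<lambda>x\<in>carrier G. \<phi> (inv_into (carrier G) f x)"])
    show "\<forall>\<phi>\<in>?E. (\<lambda>x\<in>carrier G. F \<phi> (inv_into (carrier G) f x)) = \<phi>"
      using f_bij by (auto simp: F_def fun_eq_iff bij_betw_def f_inv_into_f inv_into_into extensional_def)
    show "\<forall>\<phi>\<in>?E. F (\<lambda>x\<in>carrier G. \<phi> (inv_into (carrier G) f x)) = \<phi>"
      using f_bij by (auto simp: F_def fun_eq_iff bij_betw_def extensional_def)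
  qed (auto simp: F_def)
  have "F \<in> hopf_iso (graded_twist \<Gamma> G i \<alpha>) (graded_twist \<Gamma> G j \<beta>)"
    unfolding hopf_iso_def ring_iso_def ring_hom_def
  proof (intro CollectI conjI ballI allI impI)
    fix \<phi> \<psi> assume "\<phi> \<in> carrier (graded_twist \<Gamma> G i \<alpha>) \<and> \<psi> \<in> carrier (graded_twist \<Gamma> G i \<alpha>)"
    then have \<phi>: "\<phi> \<in> ?E" by simp
    show "F (\<phi> \<otimes>\<^bsub>graded_twist \<Gamma> G i \<alpha>\<^esub> \<psi>) = F \<phi> \<otimes>\<^bsub>graded_twist \<Gamma> G j \<beta>\<^esub> F \<psi>"
    proof (rule extensionalityI[of _ "carrier G"])
      fix x assume x: "x \<in> carrier G"
      have "F (\<phi> \<otimes>\<^bsub>graded_twist \<Gamma> G i \<alpha>\<^esub> \<psi>) x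
          = (\<Sum>g\<in>carrier \<Gamma>. B.avg (F \<phi>) (u g) x * F \<psi> (\<beta> (inv\<^bsub>\<Gamma>\<^esub> (u g)) x))"
        using x \<phi> by (simp add: A.twist_mult_eq F_avg act' F_apply)
      also have "\<dots> = (\<Sum>g\<in>carrier \<Gamma>. B.avg (F \<phi>) g x * F \<psi> (\<beta> (inv\<^bsub>\<Gamma>\<^esub> g) x))"
        by (rule sum.reindex_bij_betw[OF u_bij])
      also have "\<dots> = (F \<phi> \<otimes>\<^bsub>graded_twist \<Gamma> G j \<beta>\<^esub> F \<psi>) x"
        using x by (simp add: B.twist_mult_eq F_def[of \<phi>])
      finally show "F (\<phi> \<otimes>\<^bsub>graded_twist \<Gamma> G i \<alpha>\<^esub> \<psi>) x = (F \<phi> \<otimes>\<^bsub>graded_twist \<Gamma> G j \<beta>\<^esub> F \<psi>) x" .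
    qed (auto simp: F_def B.twist_mult_eq)
    show "F (\<phi> \<oplus>\<^bsub>graded_twist \<Gamma> G i \<alpha>\<^esub> \<psi>) = F \<phi> \<oplus>\<^bsub>graded_twist \<Gamma> G j \<beta>\<^esub> F \<psi>"
      by (auto simp: F_def fun_eq_iff)
  next
    fix \<phi> assume "\<phi> \<in> carrier (graded_twist \<Gamma> G i \<alpha>)"
    then have \<phi>: "\<phi> \<in> ?E" by simp
    show "F (antipode (graded_twist \<Gamma> G i \<alpha>) \<phi>) = antipode (graded_twist \<Gamma> G j \<beta>) (F \<phi>)"
    proof (rule extensionalityI[of _ "carrier G"])
      fix x assume x: "x \<in> carrier G"
      have "F (antipode (graded_twist \<Gamma> G i \<alpha>) \<phi>) x = (\<Sum>g\<in>carrier \<Gamma>. A.avg \<phi> g (f (inv (\<beta> (u g) x))))"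
        using x \<phi> by (auto simp: A.twist_antipode_eq F_def act group_hom.hom_inv[OF f_hom])
      also have "\<dots> = (\<Sum>g\<in>carrier \<Gamma>. B.avg (F \<phi>) (u g) (inv (\<beta> (u g) x)))"
        using x by (intro sum.cong) (auto simp: F_avg)
      also have "\<dots> = (\<Sum>g\<in>carrier \<Gamma>. B.avg (F \<phi>) g (inv (\<beta> g x)))"
        by (rule sum.reindex_bij_betw[OF u_bij])
      also have "\<dots> = antipode (graded_twist \<Gamma> G j \<beta>) (F \<phi>) x"
        using x by (simp add: B.twist_antipode_eq F_def[of \<phi>])
      finally show "F (antipode (graded_twist \<Gamma> G i \<alpha>) \<phi>) x = antipode (graded_twist \<Gamma> G j \<beta>) (F \<phi>) x" .
    qed (auto simp: F_def B.twist_antipode_eq)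
    show "counit (graded_twist \<Gamma> G i \<alpha>) \<phi> = counit (graded_twist \<Gamma> G j \<beta>) (F \<phi>)"
      using group_hom.hom_one[OF f_hom] by (simp add: F_def)
    \<comment> \<open>The map \<open>f\<close> permutes the pairs \<open>(x, y)\<close>, and
      \<open>F\<close> sends \<open>delta_fun G (f x)\<close> to \<open>delta_fun G x\<close>; after
      this reindexing the two sums of pure tensors agree term by term.\<close>
    have "image_mset (map_prod F F) (comult_terms G \<phi>) = comult_terms G (F \<phi>)"
    proof -
      let ?P = "carrier G \<times> carrier G"
      have bij: "bij_betw (map_prod f f) ?P ?P" using f_bij f_bij by (rule bij_betw_map_prod)
      let ?t = "\<lambda>(x, y). (\<phi> (x \<otimes> y) \<odot>\<^bsub>fun_space G\<^esub> delta_fun G x, delta_fun G y)"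
      have "image_mset (map_prod f f) (mset_set ?P) = mset_set ?P"
        using image_mset_mset_set[of "map_prod f f" ?P] bij by (simp add: bij_betw_def)
      then have "image_mset (map_prod F F) (comult_terms G \<phi>)
        = image_mset (map_prod F F) (image_mset ?t (image_mset (map_prod f f) (mset_set ?P)))"
        by (simp only: comult_terms_def)
      also have "\<dots> = image_mset (\<lambda>p. map_prod F F (?t (map_prod f f p))) (mset_set ?P)"
        by (simp only: image_mset.compositionality o_def)
      also have "\<dots> = comult_terms G (F \<phi>)"
        unfolding comult_terms_def
      proof (rule image_mset_cong)
        fix p assume "p \<in># mset_set ?P"
        then obtain x y where p: "p = (x, y)" "x \<in> carrier G" "y \<in> carrier G"
          using A.finite_G by auto
        have "F (delta_fun G (f x)) = delta_fun G x" if "x \<in> carrier G" for x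
          using that f_bij by (auto simp: F_def delta_fun_def fun_eq_iff bij_betw_def dest: inj_onD)
        moreover have "F (\<lambda>x\<in>carrier G. r * \<psi> x) = (\<lambda>x\<in>carrier G. r * F \<psi> x)" for r \<psi>
          by (auto simp: F_def fun_eq_iff)
        ultimately show "map_prod F F ((\<lambda>(x, y). (\<phi> (x \<otimes> y) \<odot>\<^bsub>fun_space G\<^esub> delta_fun G x, delta_fun G y)) (map_prod f f p))
            = (\<lambda>(x, y). (F \<phi> (x \<otimes> y) \<odot>\<^bsub>fun_space G\<^esub> delta_fun G x, delta_fun G y)) p"
          using p f_mult[OF p(2,3)] by (simp add: F_def[of \<phi>])
      qed
      finally show ?thesis .
    qed
    moreover have "tensor_map (graded_twist \<Gamma> G j \<beta>) (graded_twist \<Gamma> G j \<beta>) F F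
        (tensor_class (fun_space G) (fun_space G) (comult_terms G \<phi>))
        = tensor_class (graded_twist \<Gamma> G j \<beta>) (graded_twist \<Gamma> G j \<beta>) (image_mset (map_prod F F) (comult_terms G \<phi>))"
      using comult_terms_carrier[of G \<phi>]
      by (intro tensor_map_class) (auto simp: F_def fun_eq_iff)
    ultimately show "tensor_map (graded_twist \<Gamma> G j \<beta>) (graded_twist \<Gamma> G j \<beta>) F F (comult (graded_twist \<Gamma> G i \<alpha>) \<phi>)
        = comult (graded_twist \<Gamma> G j \<beta>) (F \<phi>)"
      by (simp add: tensor_class_graded_twist)
  qed (use F_bij in \<open>auto simp: F_def fun_eq_iff group_hom.hom_one[OF f_hom]\<close>)
  then show ?thesis by (auto simp: hopf_isomorphic_def)
qed

end

section \<open>Second cohomology\<close>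

lemma auto_inverse:
  assumes "group H" "\<sigma> \<in> auto H"
  shows "\<exists>\<tau>\<in>auto H. \<forall>x\<in>carrier H. \<sigma> (\<tau> x) = x \<and> \<tau> (\<sigma> x) = x"
proof -
  interpret group H by fact
  have hom: "\<sigma> \<in> hom H H" and b: "\<sigma> \<in> Bij (carrier H)" using assms(2) by (auto simp: auto_def)
  define \<tau> where "\<tau> = restrict (inv_into (carrier H) \<sigma>) (carrier H)"
  have "\<tau> \<in> auto H"
    using restrict_inv_into_hom[OF hom b] restrict_inv_into_Bij[OF b] by (simp add: auto_def \<tau>_def)
  moreover have "\<sigma> (\<tau> x) = x" "\<tau> (\<sigma> x) = x" if "x \<in> carrier H" for x
    using b that by (auto simp: \<tau>_def Bij_def bij_betw_def f_inv_into_f)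
  ultimately show ?thesis by blast
qed

lemma autoD:
  assumes "\<sigma> \<in> auto H" "x \<in> carrier H"
  shows "\<sigma> x \<in> carrier H" "y \<in> carrier H \<Longrightarrow> \<sigma> (x \<otimes>\<^bsub>H\<^esub> y) = \<sigma> x \<otimes>\<^bsub>H\<^esub> \<sigma> y"
  using assms by (auto simp: auto_def hom_def)

locale cohomology = H: group H + A: comm_group A
  for H :: "('h, 'm) monoid_scheme" and A :: "('b, 'n) monoid_scheme"
begin

abbreviation "cochain_group \<equiv> product_group (carrier H \<times> carrier H) (\<lambda>_. A)"
abbreviation "cocycle_group \<equiv> cochain_group\<lparr>carrier := cocycles2 H A\<rparr>"
abbreviation "B2 \<equiv> coboundaries2 H A"

definition coboundary :: "('h \<Rightarrow> 'b) \<Rightarrow> 'h \<times> 'h \<Rightarrow> 'b" where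
  "coboundary b = (\<lambda>(x, y) \<in> carrier H \<times> carrier H. b y \<otimes>\<^bsub>A\<^esub> inv\<^bsub>A\<^esub> (b (x \<otimes>\<^bsub>H\<^esub> y)) \<otimes>\<^bsub>A\<^esub> b x)"

lemma coboundary_mem: 
  assumes "\<And>x. x \<in> carrier H \<Longrightarrow> b x \<in> carrier A"
  shows "coboundary b \<in> B2"
proof -
  have "coboundary b = coboundary (restrict b (carrier H))"
    by (auto simp: coboundary_def fun_eq_iff)
  then show ?thesis using assms
    by (auto simp: coboundaries2_def coboundary_def intro!: exI[of _ "restrict b (carrier H)"])
qed

lemma coboundaryE:
  assumes "c \<in> B2"
  obtains b where "\<And>x. x \<in> carrier H \<Longrightarrow> b x \<in> carrier A" "c = coboundary b"
  using assms by (auto simp: coboundaries2_def coboundary_def PiE_iff)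

lemma cochain_group: "group cochain_group"
  by (rule product_group) (rule A.is_group)

lemma cocycleI:
  assumes "c \<in> extensional (carrier H \<times> carrier H)"
    and "\<And>x y. x \<in> carrier H \<Longrightarrow> y \<in> carrier H \<Longrightarrow> c (x, y) \<in> carrier A"
    and "\<And>x y z. x \<in> carrier H \<Longrightarrow> y \<in> carrier H \<Longrightarrow> z \<in> carrier H \<Longrightarrow>
       c (y, z) \<otimes>\<^bsub>A\<^esub> c (x, y \<otimes>\<^bsub>H\<^esub> z) = c (x \<otimes>\<^bsub>H\<^esub> y, z) \<otimes>\<^bsub>A\<^esub> c (x, y)"
  shows "c \<in> cocycles2 H A"
  using assms by (auto simp: cocycles2_def PiE_iff)

lemma cocycleD:
  assumes "c \<in> cocycles2 H A" "x \<in> carrier H" "y \<in> carrier H"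
  shows "c (x, y) \<in> carrier A"
    and "z \<in> carrier H \<Longrightarrow> c (y, z) \<otimes>\<^bsub>A\<^esub> c (x, y \<otimes>\<^bsub>H\<^esub> z) = c (x \<otimes>\<^bsub>H\<^esub> y, z) \<otimes>\<^bsub>A\<^esub> c (x, y)"
  using assms by (auto simp: cocycles2_def PiE_iff)

lemma cocycle_ext: "c \<in> cocycles2 H A \<Longrightarrow> c \<in> extensional (carrier H \<times> carrier H)"
  by (auto simp: cocycles2_def PiE_iff)

lemma cocycle_cochain: "c \<in> cocycles2 H A \<Longrightarrow> c \<in> carrier H \<times> carrier H \<rightarrow>\<^sub>E carrier A"
  by (auto simp: cocycles2_def)

lemma subgroup_cocycles: "subgroup (cocycles2 H A) cochain_group"
proof (rule group.subgroupI[OF cochain_group])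
  show "cocycles2 H A \<subseteq> carrier cochain_group"
    by (auto simp: cocycles2_def)
  have "(\<lambda>p\<in>carrier H \<times> carrier H. \<one>\<^bsub>A\<^esub>) \<in> cocycles2 H A"
    by (rule cocycleI) auto
  then show "cocycles2 H A \<noteq> {}" by blast
next
  fix c assume c: "c \<in> cocycles2 H A"
  have eq: "inv\<^bsub>cochain_group\<^esub> c = (\<lambda>p\<in>carrier H \<times> carrier H. inv\<^bsub>A\<^esub> c p)"
    using inv_product_group[OF cocycle_cochain[OF c]] by (simp add: A.is_group)
  have "(\<lambda>p\<in>carrier H \<times> carrier H. inv\<^bsub>A\<^esub> c p) \<in> cocycles2 H A"
    by (rule cocycleI) (use c in \<open>auto simp: cocycleD A.inv_mult[symmetric]\<close>)
  then show "inv\<^bsub>cochain_group\<^esub> c \<in> cocycles2 H A" by (simp only: eq)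
next
  fix c d assume c: "c \<in> cocycles2 H A" and d: "d \<in> cocycles2 H A"
  have "(\<lambda>p\<in>carrier H \<times> carrier H. c p \<otimes>\<^bsub>A\<^esub> d p) \<in> cocycles2 H A"
  proof (rule cocycleI)
    fix x y z assume [simp]: "x \<in> carrier H" "y \<in> carrier H" "z \<in> carrier H"
    have "(c (y, z) \<otimes>\<^bsub>A\<^esub> d (y, z)) \<otimes>\<^bsub>A\<^esub> (c (x, y \<otimes>\<^bsub>H\<^esub> z) \<otimes>\<^bsub>A\<^esub> d (x, y \<otimes>\<^bsub>H\<^esub> z))
        = (c (y, z) \<otimes>\<^bsub>A\<^esub> c (x, y \<otimes>\<^bsub>H\<^esub> z)) \<otimes>\<^bsub>A\<^esub> (d (y, z) \<otimes>\<^bsub>A\<^esub> d (x, y \<otimes>\<^bsub>H\<^esub> z))"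
      using c d by (simp add: cocycleD(1) A.m_ac)
    also have "\<dots> = (c (x \<otimes>\<^bsub>H\<^esub> y, z) \<otimes>\<^bsub>A\<^esub> c (x, y)) \<otimes>\<^bsub>A\<^esub> (d (x \<otimes>\<^bsub>H\<^esub> y, z) \<otimes>\<^bsub>A\<^esub> d (x, y))"
      using c d by (simp add: cocycleD(2))
    also have "\<dots> = (c (x \<otimes>\<^bsub>H\<^esub> y, z) \<otimes>\<^bsub>A\<^esub> d (x \<otimes>\<^bsub>H\<^esub> y, z)) \<otimes>\<^bsub>A\<^esub> (c (x, y) \<otimes>\<^bsub>A\<^esub> d (x, y))"
      using c d by (simp add: cocycleD(1) A.m_ac)
    finally show "(\<lambda>p\<in>carrier H \<times> carrier H. c p \<otimes>\<^bsub>A\<^esub> d p) (y, z) \<otimes>\<^bsub>A\<^esub>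
          (\<lambda>p\<in>carrier H \<times> carrier H. c p \<otimes>\<^bsub>A\<^esub> d p) (x, y \<otimes>\<^bsub>H\<^esub> z) =
          (\<lambda>p\<in>carrier H \<times> carrier H. c p \<otimes>\<^bsub>A\<^esub> d p) (x \<otimes>\<^bsub>H\<^esub> y, z) \<otimes>\<^bsub>A\<^esub>
          (\<lambda>p\<in>carrier H \<times> carrier H. c p \<otimes>\<^bsub>A\<^esub> d p) (x, y)" by simp
  qed (use c d in \<open>auto simp: cocycleD\<close>)
  then show "c \<otimes>\<^bsub>cochain_group\<^esub> d \<in> cocycles2 H A" by simp
qed

lemma group_cocycle_group: "group cocycle_group"
  using subgroup.subgroup_is_group[OF subgroup_cocycles cochain_group] by simp

lemma coboundary_cocycle:
  assumes b: "\<And>x. x \<in> carrier H \<Longrightarrow> b x \<in> carrier A"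
  shows "coboundary b \<in> cocycles2 H A"
proof (rule cocycleI)
  fix x y z assume [simp]: "x \<in> carrier H" "y \<in> carrier H" "z \<in> carrier H"
  have rearrange: "(b z \<otimes>\<^bsub>A\<^esub> p' \<otimes>\<^bsub>A\<^esub> b y) \<otimes>\<^bsub>A\<^esub> (p \<otimes>\<^bsub>A\<^esub> q \<otimes>\<^bsub>A\<^esub> b x) = (p \<otimes>\<^bsub>A\<^esub> p') \<otimes>\<^bsub>A\<^esub> (b z \<otimes>\<^bsub>A\<^esub> q \<otimes>\<^bsub>A\<^esub> b y \<otimes>\<^bsub>A\<^esub> b x)"
    "(b z \<otimes>\<^bsub>A\<^esub> q \<otimes>\<^bsub>A\<^esub> p) \<otimes>\<^bsub>A\<^esub> (b y \<otimes>\<^bsub>A\<^esub> p' \<otimes>\<^bsub>A\<^esub> b x) = (p \<otimes>\<^bsub>A\<^esub> p') \<otimes>\<^bsub>A\<^esub> (b z \<otimes>\<^bsub>A\<^esub> q \<otimes>\<^bsub>A\<^esub> b y \<otimes>\<^bsub>A\<^esub> b x)"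
    if "p \<in> carrier A" "p' \<in> carrier A" "q \<in> carrier A" for p p' q
    using that b by (simp_all add: A.m_ac)
  show "coboundary b (y, z) \<otimes>\<^bsub>A\<^esub> coboundary b (x, y \<otimes>\<^bsub>H\<^esub> z) = coboundary b (x \<otimes>\<^bsub>H\<^esub> y, z) \<otimes>\<^bsub>A\<^esub> coboundary b (x, y)"
    using b by (simp add: coboundary_def rearrange H.m_assoc)
qed (use b in \<open>auto simp: coboundary_def\<close>)

lemma subgroup_coboundaries: "subgroup B2 cocycle_group"
proof (rule group.subgroupI[OF group_cocycle_group])
  show "B2 \<subseteq> carrier cocycle_group"
    using coboundary_cocycle by (auto elim!: coboundaryE)
  show "B2 \<noteq> {}" using coboundary_mem[of "\<lambda>_. \<one>\<^bsub>A\<^esub>"] by auto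
next
  fix c assume "c \<in> B2"
  then obtain b where b: "\<And>x. x \<in> carrier H \<Longrightarrow> b x \<in> carrier A" and c: "c = coboundary b"
    by (rule coboundaryE) blast
  have cc: "c \<in> cocycles2 H A" using c coboundary_cocycle[OF b] by simp
  have "inv\<^bsub>cocycle_group\<^esub> c = inv\<^bsub>cochain_group\<^esub> c"
    using group.m_inv_consistent[OF cochain_group subgroup_cocycles cc] by simp
  also have "\<dots> = (\<lambda>p\<in>carrier H \<times> carrier H. inv\<^bsub>A\<^esub> c p)"
    using inv_product_group[OF cocycle_cochain[OF cc]] by (simp add: A.is_group)
  also have "\<dots> = coboundary (\<lambda>x. inv\<^bsub>A\<^esub> b x)"
    using b by (auto simp: c coboundary_def fun_eq_iff A.inv_mult)
  finally show "inv\<^bsub>cocycle_group\<^esub> c \<in> B2" using b by (auto intro: coboundary_mem)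
next
  fix c d assume "c \<in> B2" "d \<in> B2"
  then obtain b b' where b: "\<And>x. x \<in> carrier H \<Longrightarrow> b x \<in> carrier A" "\<And>x. x \<in> carrier H \<Longrightarrow> b' x \<in> carrier A"
    and c: "c = coboundary b" "d = coboundary b'"
    by (elim coboundaryE) blast
  have "c \<otimes>\<^bsub>cocycle_group\<^esub> d = coboundary (\<lambda>x. b x \<otimes>\<^bsub>A\<^esub> b' x)"
    using b by (auto simp: c coboundary_def fun_eq_iff A.inv_mult A.m_ac)
  then show "c \<otimes>\<^bsub>cocycle_group\<^esub> d \<in> B2" using b by (auto intro: coboundary_mem)
qed

lemma carrier_H2: "carrier (H2 H A) = rcosets\<^bsub>cocycle_group\<^esub> B2"
  by (simp add: H2_def FactGroup_def)

lemma cohomologousD: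
  assumes "d \<in> B2 #>\<^bsub>cocycle_group\<^esub> c"
  shows "\<exists>b \<in> carrier H \<rightarrow> carrier A. \<forall>x \<in> carrier H. \<forall>y \<in> carrier H.
       d (x, y) = b y \<otimes>\<^bsub>A\<^esub> inv\<^bsub>A\<^esub> (b (x \<otimes>\<^bsub>H\<^esub> y)) \<otimes>\<^bsub>A\<^esub> b x \<otimes>\<^bsub>A\<^esub> c (x, y)"
proof -
  obtain e where "e \<in> B2" and d: "d = e \<otimes>\<^bsub>cocycle_group\<^esub> c"
    using assms by (auto simp: r_coset_def)
  from this(1) obtain b where b: "\<And>x. x \<in> carrier H \<Longrightarrow> b x \<in> carrier A" and e: "e = coboundary b"
    by (rule coboundaryE) blast
  show ?thesis by (intro bexI[of _ b]) (simp_all add: d e coboundary_def b)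
qed

text \<open>If \<open>c\<close> and \<open>d\<close> are both coboundaries, their classes agree. If
  neither is and the classes differ, then \<open>B2\<close> and the two cosets are three distinct
  classes.\<close>

lemma cohomologous_if_small:
  assumes "finite (carrier H)" "finite (carrier A)" and card: "card (carrier (H2 H A)) \<le> 2"
    and c: "c \<in> cocycles2 H A" and d: "d \<in> cocycles2 H A" and iff: "c \<in> B2 \<longleftrightarrow> d \<in> B2"
  shows "d \<in> B2 #>\<^bsub>cocycle_group\<^esub> c"
proof (rule ccontr)
  interpret K: group cocycle_group by (rule group_cocycle_group)
  interpret B: subgroup B2 cocycle_group by (rule subgroup_coboundaries)
  assume neg: "d \<notin> B2 #>\<^bsub>cocycle_group\<^esub> c"
  have self: "c \<in> B2 #>\<^bsub>cocycle_group\<^esub> c" "d \<in> B2 #>\<^bsub>cocycle_group\<^esub> d"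
    by (rule K.rcos_self[OF _ subgroup_coboundaries], use c d in simp)+
  have cn: "c \<notin> B2"
  proof
    assume "c \<in> B2"
    then have "B2 #>\<^bsub>cocycle_group\<^esub> c = B2" using K.coset_join2[OF _ subgroup_coboundaries, of c] c by simp
    with \<open>c \<in> B2\<close> iff neg show False by simp
  qed
  then have "card {B2, B2 #>\<^bsub>cocycle_group\<^esub> c, B2 #>\<^bsub>cocycle_group\<^esub> d} = 3"
    using self neg iff by (subst card_insert_disjoint) (auto simp: card_insert_if)
  moreover have "{B2, B2 #>\<^bsub>cocycle_group\<^esub> c, B2 #>\<^bsub>cocycle_group\<^esub> d} \<subseteq> carrier (H2 H A)"
  proof -
    have "B2 #>\<^bsub>cocycle_group\<^esub> e \<in> carrier (H2 H A)" if "e \<in> cocycles2 H A" for e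
      unfolding carrier_H2 by (rule K.rcosetsI[OF B.subset]) (use that in simp)
    moreover have "B2 \<in> carrier (H2 H A)"
      unfolding carrier_H2 by (rule B.subgroup_in_rcosets[OF group_cocycle_group])
    ultimately show ?thesis using c d by blast
  qed
  moreover have "finite (carrier (H2 H A))"
  proof -
    have "finite (cocycles2 H A)"
      by (rule finite_subset[of _ "carrier H \<times> carrier H \<rightarrow>\<^sub>E carrier A"])
        (use assms(1,2) cocycle_cochain in \<open>auto intro: finite_PiE\<close>)
    then show ?thesis unfolding carrier_H2 by (simp add: RCOSETS_def)
  qed
  ultimately have "3 \<le> card (carrier (H2 H A))" by (metis card_mono)
  with card show False by simp
qed

lemma pullback_cocycle:
  assumes "\<sigma> \<in> auto H" "c \<in> cocycles2 H A"
  shows "(\<lambda>(x, y) \<in> carrier H \<times> carrier H. c (\<sigma> x, \<sigma> y)) \<in> cocycles2 H A"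
  by (rule cocycleI) (use assms in \<open>auto simp: autoD cocycleD\<close>)

lemma pullback_coboundary:
  assumes "\<sigma> \<in> auto H" "c \<in> B2"
  shows "(\<lambda>(x, y) \<in> carrier H \<times> carrier H. c (\<sigma> x, \<sigma> y)) \<in> B2"
proof -
  obtain b where b: "\<And>x. x \<in> carrier H \<Longrightarrow> b x \<in> carrier A" and c: "c = coboundary b"
    using assms(2) by (rule coboundaryE) blast
  have "(\<lambda>(x, y) \<in> carrier H \<times> carrier H. c (\<sigma> x, \<sigma> y)) = coboundary (\<lambda>x. b (\<sigma> x))"
    using assms(1) by (auto simp: c coboundary_def fun_eq_iff autoD)
  then show ?thesis using b assms(1) by (auto intro: coboundary_mem simp: autoD)
qed

lemma pushforward_cocycle:
  assumes "\<tau> \<in> auto A" "c \<in> cocycles2 H A"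
  shows "compose (carrier H \<times> carrier H) \<tau> c \<in> cocycles2 H A"
  by (rule cocycleI) (use assms in \<open>auto simp: autoD cocycleD compose_def simp flip: autoD(2)\<close>)

lemma auto_A_inv: "\<tau> \<in> auto A \<Longrightarrow> a \<in> carrier A \<Longrightarrow> \<tau> (inv\<^bsub>A\<^esub> a) = inv\<^bsub>A\<^esub> (\<tau> a)"
  by (intro group_hom.hom_inv[of A A]) (auto simp: auto_def group_hom_def group_hom_axioms_def A.is_group)

lemma pushforward_coboundary:
  assumes "\<tau> \<in> auto A" "c \<in> B2"
  shows "compose (carrier H \<times> carrier H) \<tau> c \<in> B2"
proof -
  obtain b where b: "\<And>x. x \<in> carrier H \<Longrightarrow> b x \<in> carrier A" and c: "c = coboundary b"
    using assms(2) by (rule coboundaryE) blast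
  have "compose (carrier H \<times> carrier H) \<tau> c = coboundary (\<lambda>x. \<tau> (b x))"
    using assms(1) b by (auto simp: c coboundary_def fun_eq_iff autoD compose_def auto_A_inv)
  then show ?thesis using b assms(1) by (auto intro: coboundary_mem simp: autoD)
qed

text \<open>Pullback fixes the trivial class and, \<sigma> being invertible, sends no other class to
  it; with at most two classes it therefore fixes all of them.\<close>

lemma pullback_cohomologous:
  assumes fin: "finite (carrier H)" "finite (carrier A)"
    and small: "card (carrier (H2 H A)) \<le> 2 \<or> H2_actions_trivial H A"
    and \<sigma>: "\<sigma> \<in> auto H" and c: "c \<in> cocycles2 H A"
  shows "(\<lambda>(x, y) \<in> carrier H \<times> carrier H. c (\<sigma> x, \<sigma> y)) \<in> B2 #>\<^bsub>cocycle_group\<^esub> c"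
  using small
proof
  assume "H2_actions_trivial H A"
  moreover have "B2 #>\<^bsub>cocycle_group\<^esub> c \<in> carrier (H2 H A)"
    unfolding carrier_H2 using c subgroup.subset[OF subgroup_coboundaries]
    by (intro group.rcosetsI[OF group_cocycle_group]) auto
  moreover have "c \<in> B2 #>\<^bsub>cocycle_group\<^esub> c"
    by (rule group.rcos_self[OF group_cocycle_group _ subgroup_coboundaries]) (use c in simp)
  ultimately show ?thesis using \<sigma> unfolding H2_actions_trivial_def H2_pullback_def by blast
next
  assume *: "card (carrier (H2 H A)) \<le> 2"
  obtain \<rho> where \<rho>: "\<rho> \<in> auto H" "\<forall>x\<in>carrier H. \<sigma> (\<rho> x) = x \<and> \<rho> (\<sigma> x) = x"
    using auto_inverse[OF H.is_group \<sigma>] by blast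
  have "c = (\<lambda>(x, y) \<in> carrier H \<times> carrier H. (\<lambda>(x, y) \<in> carrier H \<times> carrier H. c (\<sigma> x, \<sigma> y)) (\<rho> x, \<rho> y))"
    using \<rho> by (intro extensionalityI[OF cocycle_ext[OF c]]) (auto simp: autoD)
  then have "c \<in> B2 \<longleftrightarrow> (\<lambda>(x, y) \<in> carrier H \<times> carrier H. c (\<sigma> x, \<sigma> y)) \<in> B2"
    using pullback_coboundary[OF \<sigma>] pullback_coboundary[OF \<rho>(1)] by metis
  then show ?thesis using cohomologous_if_small[OF fin * c pullback_cocycle[OF \<sigma> c]] by blast
qed

lemma pushforward_cohomologous:
  assumes fin: "finite (carrier H)" "finite (carrier A)"
    and small: "card (carrier (H2 H A)) \<le> 2 \<or> H2_actions_trivial H A"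
    and \<tau>: "\<tau> \<in> auto A" and c: "c \<in> cocycles2 H A"
  shows "compose (carrier H \<times> carrier H) \<tau> c \<in> B2 #>\<^bsub>cocycle_group\<^esub> c"
  using small
proof
  assume "H2_actions_trivial H A"
  moreover have "B2 #>\<^bsub>cocycle_group\<^esub> c \<in> carrier (H2 H A)"
    unfolding carrier_H2 using c subgroup.subset[OF subgroup_coboundaries]
    by (intro group.rcosetsI[OF group_cocycle_group]) auto
  moreover have "c \<in> B2 #>\<^bsub>cocycle_group\<^esub> c"
    by (rule group.rcos_self[OF group_cocycle_group _ subgroup_coboundaries]) (use c in simp)
  ultimately show ?thesis using \<tau> unfolding H2_actions_trivial_def H2_pushforward_def by blast
next
  assume *: "card (carrier (H2 H A)) \<le> 2"
  obtain \<rho> where \<rho>: "\<rho> \<in> auto A" "\<forall>x\<in>carrier A. \<tau> (\<rho> x) = x \<and> \<rho> (\<tau> x) = x"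
    using auto_inverse[OF A.is_group \<tau>] by blast
  have "c = compose (carrier H \<times> carrier H) \<rho> (compose (carrier H \<times> carrier H) \<tau> c)"
    using \<rho> c by (intro extensionalityI[OF cocycle_ext[OF c]]) (auto simp: compose_def cocycleD)
  then have "c \<in> B2 \<longleftrightarrow> compose (carrier H \<times> carrier H) \<tau> c \<in> B2"
    using pushforward_coboundary[OF \<tau>] pushforward_coboundary[OF \<rho>(1)] by metis
  then show ?thesis using cohomologous_if_small[OF fin * c pushforward_cocycle[OF \<tau> c]] by blast
qed

end

section \<open>Weakly equivalent actions are equivalent\<close>

lemma (in group) subgroup_center: "subgroup (center G) G"
proof (rule subgroupI)
  show "inv z \<in> center G" if z: "z \<in> center G" for z
  proof -
    have z': "z \<in> carrier G" "\<And>x. x \<in> carrier G \<Longrightarrow> z \<otimes> x = x \<otimes> z" using z by (auto simp: center_def)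
    have "inv z \<otimes> x = x \<otimes> inv z" if x: "x \<in> carrier G" for x
    proof -
      have "inv z \<otimes> x = inv z \<otimes> (x \<otimes> z) \<otimes> inv z" using x z'(1) by (simp add: m_assoc)
      also have "\<dots> = inv z \<otimes> (z \<otimes> x) \<otimes> inv z" using x z' by simp
      also have "\<dots> = x \<otimes> inv z" using x z'(1) by (simp add: m_assoc[symmetric])
      finally show ?thesis .
    qed
    then show ?thesis using z'(1) by (simp add: center_def)
  qed
  show "z \<otimes> w \<in> center G" if "z \<in> center G" "w \<in> center G" for z w
  proof -
    have z: "z \<in> carrier G" "\<And>x. x \<in> carrier G \<Longrightarrow> z \<otimes> x = x \<otimes> z" 
      and w: "w \<in> carrier G" "\<And>x. x \<in> carrier G \<Longrightarrow> w \<otimes> x = x \<otimes> w" using that by (auto simp: center_def)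
    have "z \<otimes> w \<otimes> x = x \<otimes> (z \<otimes> w)" if x: "x \<in> carrier G" for x
    proof -
      have "z \<otimes> w \<otimes> x = z \<otimes> (x \<otimes> w)" using z(1) w x by (simp add: m_assoc)
      also have "\<dots> = (z \<otimes> x) \<otimes> w" using z(1) w(1) x by (simp add: m_assoc)
      also have "\<dots> = x \<otimes> (z \<otimes> w)" using z w(1) x by (simp add: m_assoc)
      finally show ?thesis .
    qed
    then show ?thesis using z(1) w(1) by (simp add: center_def)
  qed
qed (auto simp: center_def)

section \<open>Consequences of the cyclic center and of \<open>Hom(H, \<Gamma>^) = 1\<close>\<close>

locale rigid_cocentral = cocentral G \<Gamma> i \<alpha>
  for G :: "('a, 'm) monoid_scheme" (structure) and \<Gamma> :: "('g, 'n) monoid_scheme"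
    and i :: "('g \<Rightarrow> 'k::{alg_closed_field, field_char_0}) \<Rightarrow> 'a" and \<alpha> :: "'g \<Rightarrow> 'a \<Rightarrow> 'a" +
  assumes center_cyclic: "cyclic_group (G\<lparr>carrier := center G\<rparr>)"
    and hom_trivial: "\<And>\<phi> h. \<phi> \<in> hom (G Mod (i ` carrier (char_group \<Gamma>))) (char_group \<Gamma> :: ('g \<Rightarrow> 'k) monoid) \<Longrightarrow>
      h \<in> carrier (G Mod (i ` carrier (char_group \<Gamma>))) \<Longrightarrow> \<phi> h = \<one>\<^bsub>char_group \<Gamma>\<^esub>"
begin

abbreviation "Z0 \<equiv> i ` carrier D"

lemma center_closed: "z \<in> center G \<Longrightarrow> z \<in> carrier G"
  and center_comm: "z \<in> center G \<Longrightarrow> x \<in> carrier G \<Longrightarrow> z \<otimes> x = x \<otimes> z"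
  by (auto simp: center_def)

sublocale Z: finite_cyclic_group "G\<lparr>carrier := center G\<rparr>"
  rewrites "carrier (G\<lparr>carrier := center G\<rparr>) = center G"
    and "monoid.mult (G\<lparr>carrier := center G\<rparr>) = monoid.mult G"
    and "one (G\<lparr>carrier := center G\<rparr>) = one G"
    and "\<And>x k. pow (G\<lparr>carrier := center G\<rparr>) x (k :: nat) = x [^] k"
proof -
  show "finite_cyclic_group (G\<lparr>carrier := center G\<rparr>)"
  proof (intro finite_cyclic_group.intro finite_cyclic_group_axioms.intro)
    show "group (G\<lparr>carrier := center G\<rparr>)"
      using subgroup.subgroup_is_group[OF subgroup_center is_group] .
    show "finite (carrier (G\<lparr>carrier := center G\<rparr>))"
      using finite_subset[OF subgroup.subset[OF subgroup_center] finite_G] by simp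
  qed (rule center_cyclic)
qed (simp_all add: nat_pow_def)

lemma i_hom_center: "group_hom D (G\<lparr>carrier := center G\<rparr>) i"
  by unfold_locales (auto simp: hom_def i_mult i_center)

lemma Z0_subgroup_center: "subgroup Z0 (G\<lparr>carrier := center G\<rparr>)"
  using group_hom.img_is_subgroup[OF i_hom_center] .

lemma card_Z0: "card Z0 = order \<Gamma>"
  using card_image[OF i_inj] card_D by simp

text \<open>The right-hand side does not mention \<open>i\<close>. Membership in
  \<open>i(\<Gamma>^)\<close> can thus be proved by bounding an exponent.\<close>

lemma Z0_eq: "Z0 = {z \<in> center G. z [^] order \<Gamma> = \<one>}"
  using Z.subgroup_eq_torsion[OF Z0_subgroup_center] card_Z0 by simp

lemma Z0_subgroup: "subgroup Z0 G"
  using group_hom.img_is_subgroup[OF i_group_hom] .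

lemma Z0_normal: "Z0 \<lhd> G"
proof (subst normal_inv_iff, intro conjI ballI)
  fix x h assume "x \<in> carrier G" "h \<in> Z0"
  then show "x \<otimes> h \<otimes> inv x \<in> Z0"
    by (auto simp: i_comm[symmetric] m_assoc)
qed (rule Z0_subgroup)

text \<open>\<open>D\<close> embeds through \<open>i\<close> in the cyclic center. With
  \<open>d\<close> the index of the image, the power \<open>z [^] d\<close> of a generator of the
  center generates the image.\<close>

lemma cyclic_D: "cyclic_group D"
proof -
  obtain z where z: "z \<in> center G" "center G = (\<lambda>k. z [^] k) ` {..<order (G\<lparr>carrier := center G\<rparr>)}"
    "\<And>k::nat. z [^] k = \<one> \<longleftrightarrow> order (G\<lparr>carrier := center G\<rparr>) dvd k"
    by (rule Z.generator) blast
  obtain d where d: "order (G\<lparr>carrier := center G\<rparr>) = order \<Gamma> * d"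
    using Z.lagrange[OF Z0_subgroup_center] card_Z0 by (metis dvd_triv_right dvdE)
  define w where "w = z [^] d"
  have "w \<in> Z0" unfolding Z0_eq w_def using z(1,3) d
    by (simp add: Z.nat_pow_closed center_closed nat_pow_pow mult.commute)
  then obtain \<chi> where \<chi>: "\<chi> \<in> carrier D" "w = i \<chi>" by blast
  have "carrier D \<subseteq> range (\<lambda>k::int. \<chi> [^]\<^bsub>D\<^esub> k)"
  proof
    fix \<psi> assume \<psi>: "\<psi> \<in> carrier D"
    then have "i \<psi> \<in> center G" "i \<psi> [^] order \<Gamma> = \<one>" using Z0_eq by auto
    then obtain k :: nat where k: "i \<psi> = z [^] k" using equalityD1[OF z(2)] by blast
    then have "z [^] (k * order \<Gamma>) = \<one>"
      using \<open>i \<psi> [^] order \<Gamma> = \<one>\<close> center_closed[OF z(1)] by (simp add: nat_pow_pow)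
    then have "d dvd k" using z(3) d by (simp add: mult.commute)
    then obtain l where "k = d * l" by (rule dvdE)
    then have "i \<psi> = i (\<chi> [^]\<^bsub>D\<^esub> l)" using k z(1) \<chi> by (simp add: i_pow w_def nat_pow_pow center_closed flip: \<chi>(2))
    then have "\<psi> = \<chi> [^]\<^bsub>D\<^esub> l" using i_inj \<psi> \<chi>(1) by (auto dest: inj_onD)
    then show "\<psi> \<in> range (\<lambda>k::int. \<chi> [^]\<^bsub>D\<^esub> k)" by (auto simp flip: int_pow_int)
  qed
  then have "carrier D = range (\<lambda>k::int. \<chi> [^]\<^bsub>D\<^esub> k)" using \<chi>(1) by auto
  then show ?thesis using \<chi>(1) D.cyclic_group by blast
qed

sublocale D: finite_cyclic_group D
  using cyclic_D finite_D D.is_group by (simp add: finite_cyclic_group_def finite_cyclic_group_axioms_def)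

lemma Z0_coset_eq_iff:
  assumes "x \<in> carrier G" "y \<in> carrier G"
  shows "Z0 #> x = Z0 #> y \<longleftrightarrow> x \<otimes> inv y \<in> Z0"
  using subgroup.rcos_module[OF Z0_subgroup is_group assms(2,1)] repr_independence[OF _ assms(2) Z0_subgroup, of x]
    rcos_self[OF assms(1) Z0_subgroup] by metis

text \<open>The form in which \<open>Hom(H, \<Gamma>^) = 1\<close> is applied: as \<open>c\<close>
  kills \<open>i(\<Gamma>^)\<close>, it descends to \<open>H\<close>, and as its values lie in
  \<open>i(\<Gamma>^)\<close>, it can be read as a map to \<open>D\<close>.\<close>

lemma central_hom_trivial_aux:
  assumes c: "\<And>x. x \<in> carrier G \<Longrightarrow> c x \<in> Z0"
    and mult: "\<And>x y. x \<in> carrier G \<Longrightarrow> y \<in> carrier G \<Longrightarrow> c (x \<otimes> y) = c x \<otimes> c y"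
    and i: "\<And>\<chi>. \<chi> \<in> carrier D \<Longrightarrow> c (i \<chi>) = \<one>" and x: "x \<in> carrier G"
  shows "c x = \<one>"
proof -
  define h where "h = (\<lambda>x. inv_into (carrier D) i (c x))"
  have h: "h x \<in> carrier D" "i (h x) = c x" if "x \<in> carrier G" for x
    using c[OF that] by (auto simp: h_def inv_into_into f_inv_into_f)
  have c_cl: "c x \<in> carrier G" if "x \<in> carrier G" for x using c[OF that] by auto
  have hom: "h \<in> hom G D"
  proof (rule homI)
    fix x y assume *: "x \<in> carrier G" "y \<in> carrier G"
    have "i (h (x \<otimes> y)) = i (h x \<otimes>\<^bsub>D\<^esub> h y)" using * h by (simp add: mult i_mult)
    then show "h (x \<otimes> y) = h x \<otimes>\<^bsub>D\<^esub> h y" by (rule inj_onD[OF i_inj]) (use * h in auto)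
  qed (use h in blast)
  have const: "h x = h y" if *: "x \<in> carrier G" "y \<in> carrier G" "Z0 #> x = Z0 #> y" for x y
  proof -
    have "x \<otimes> inv y \<in> Z0" using * Z0_coset_eq_iff by blast
    then obtain \<chi> where \<chi>: "\<chi> \<in> carrier D" "x \<otimes> inv y = i \<chi>" by blast
    then have "x = i \<chi> \<otimes> y" using * by (metis inv_solve_right i_closed)
    then have "c x = c y" using * \<chi> c_cl by (simp add: mult i)
    then show ?thesis by (simp add: h_def)
  qed
  obtain g where "g \<in> hom (G Mod Z0) D" "\<And>x. x \<in> carrier G \<Longrightarrow> g (Z0 #> x) = h x"
    using FactGroup_universal[OF hom Z0_normal const] by blast
  then have "h x = \<one>\<^bsub>D\<^esub>" using hom_trivial[of g "Z0 #> x"] x by (auto simp: carrier_FactGroup)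
  then show ?thesis using h(2)[OF x] i_one by simp
qed

text \<open>Raising \<open>c\<close> to the power \<open>|\<Gamma>|\<close> lands in the \<open>|\<Gamma>|\<close>-torsion of the center, which is \<open>i(\<Gamma>^)\<close>;
  so \<open>Hom(H, \<Gamma>^) = 1\<close> applies twice.\<close>

lemma central_hom_trivial:
  assumes c: "\<And>x. x \<in> carrier G \<Longrightarrow> c x \<in> center G"
    and mult: "\<And>x y. x \<in> carrier G \<Longrightarrow> y \<in> carrier G \<Longrightarrow> c (x \<otimes> y) = c x \<otimes> c y"
    and i: "\<And>\<chi>. \<chi> \<in> carrier D \<Longrightarrow> c (i \<chi>) = \<one>"
    and pow: "\<And>x. x \<in> carrier G \<Longrightarrow> c x [^] (order \<Gamma> * order \<Gamma>) = \<one>"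
    and x: "x \<in> carrier G"
  shows "c x = \<one>"
proof (rule central_hom_trivial_aux[of c])
  have c': "c y [^] order \<Gamma> = \<one>" if y: "y \<in> carrier G" for y
  proof (rule central_hom_trivial_aux[of "\<lambda>x. c x [^] order \<Gamma>"])
    show "c x [^] order \<Gamma> \<in> Z0" if "x \<in> carrier G" for x
      using c[OF that] pow[OF that] Z.nat_pow_closed by (simp add: Z0_eq center_closed nat_pow_pow)
    show "c (x \<otimes> y) [^] order \<Gamma> = c x [^] order \<Gamma> \<otimes> c y [^] order \<Gamma>" if "x \<in> carrier G" "y \<in> carrier G" for x y
      using c that by (simp add: mult pow_mult_distrib center_comm center_closed)
  qed (use y i in auto)
  show "c x \<in> Z0" if "x \<in> carrier G" for x
    using c[OF that] c'[OF that] by (simp add: Z0_eq)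
qed (use assms in auto)

section \<open>\<open>G\<close> as a central extension of \<open>H\<close>\<close>

abbreviation "H \<equiv> G Mod Z0"
abbreviation "\<pi> x \<equiv> Z0 #> x"

lemma group_H: "group H" using normal.factorgroup_is_group[OF Z0_normal] .

lemma \<pi>_mult: "x \<in> carrier G \<Longrightarrow> y \<in> carrier G \<Longrightarrow> \<pi> (x \<otimes> y) = \<pi> x \<otimes>\<^bsub>H\<^esub> \<pi> y"
  using normal.rcos_sum[OF Z0_normal] by simp

lemma \<pi>_mem [simp]: "x \<in> carrier G \<Longrightarrow> \<pi> x \<in> carrier H"
  by (auto simp: carrier_FactGroup)

lemma \<pi>_surj: "C \<in> carrier H \<Longrightarrow> \<exists>x\<in>carrier G. C = \<pi> x"
  by (auto simp: carrier_FactGroup)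

lemma \<pi>_i_mult: 
  assumes "\<chi> \<in> carrier D" "x \<in> carrier G" shows "\<pi> (i \<chi> \<otimes> x) = \<pi> x"
  using assms by (subst Z0_coset_eq_iff) (auto simp: m_assoc)

lemma \<pi>_eqD:
  assumes "x \<in> carrier G" "y \<in> carrier G" "\<pi> x = \<pi> y"
  shows "\<exists>\<chi>\<in>carrier D. x = i \<chi> \<otimes> y"
proof -
  have "x \<otimes> inv y \<in> Z0" using assms Z0_coset_eq_iff by blast
  then obtain \<chi> where \<chi>: "\<chi> \<in> carrier D" "x \<otimes> inv y = i \<chi>" by blast
  then have "x = i \<chi> \<otimes> y" using assms by (metis inv_solve_right i_closed)
  with \<chi> show ?thesis by blast
qed

lemma finite_H: "finite (carrier H)"
  using finite_G by (simp add: carrier_FactGroup)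

definition sect :: "'a set \<Rightarrow> 'a" where
  "sect C = (SOME x. x \<in> carrier G \<and> \<pi> x = C)"

text \<open>The coordinate of \<open>x\<close> along \<open>i(\<Gamma>^)\<close> relative to the
  set-theoretic section \<open>sect\<close>. Together with the coset of \<open>x\<close> it
  identifies \<open>G\<close> with pairs from \<open>D\<close> and \<open>H\<close>, multiplied with
  the factor set \<open>ext_cocycle\<close>.\<close>

definition resid :: "'a \<Rightarrow> ('g \<Rightarrow> 'k)" where
  "resid x = (SOME \<chi>. \<chi> \<in> carrier D \<and> x = i \<chi> \<otimes> sect (\<pi> x))"

definition ext_cocycle :: "'a set \<times> 'a set \<Rightarrow> ('g \<Rightarrow> 'k)" where
  "ext_cocycle = (\<lambda>(C, C') \<in> carrier H \<times> carrier H. resid (sect C \<otimes> sect C'))"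

lemma sect: assumes "C \<in> carrier H" shows "sect C \<in> carrier G" "\<pi> (sect C) = C"
  using someI_ex[of "\<lambda>x. x \<in> carrier G \<and> \<pi> x = C"] \<pi>_surj[OF assms] unfolding sect_def by auto

lemma resid: 
  assumes x: "x \<in> carrier G" shows "resid x \<in> carrier D" "x = i (resid x) \<otimes> sect (\<pi> x)"
proof -
  have "\<exists>\<chi>\<in>carrier D. x = i \<chi> \<otimes> sect (\<pi> x)"
    by (rule \<pi>_eqD) (use x sect[of "\<pi> x"] in auto)
  then have "resid x \<in> carrier D \<and> x = i (resid x) \<otimes> sect (\<pi> x)"
    unfolding resid_def by (intro someI_ex[of "\<lambda>\<chi>. \<chi> \<in> carrier D \<and> x = i \<chi> \<otimes> sect (\<pi> x)"]) blast
  then show "resid x \<in> carrier D" "x = i (resid x) \<otimes> sect (\<pi> x)" by blast+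
qed

lemma i_cancel:
  assumes "i \<chi> \<otimes> y = i \<psi> \<otimes> y" "\<chi> \<in> carrier D" "\<psi> \<in> carrier D" "y \<in> carrier G"
  shows "\<chi> = \<psi>"
  using assms i_inj by (auto dest: inj_onD)

lemma resid_unique:
  assumes "\<chi> \<in> carrier D" "C \<in> carrier H"
  shows "resid (i \<chi> \<otimes> sect C) = \<chi>"
proof (rule i_cancel[of _ "sect C"])
  have "i \<chi> \<otimes> sect C \<in> carrier G" "\<pi> (i \<chi> \<otimes> sect C) = C"
    using assms sect[OF assms(2)] by (auto simp: \<pi>_i_mult)
  then show "i (resid (i \<chi> \<otimes> sect C)) \<otimes> sect C = i \<chi> \<otimes> sect C" "resid (i \<chi> \<otimes> sect C) \<in> carrier D"
    using resid by metis+
qed (use assms sect in auto)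

lemma ext_cocycle:
  assumes "C \<in> carrier H" "C' \<in> carrier H"
  shows "ext_cocycle (C, C') \<in> carrier D"
    and "sect C \<otimes> sect C' = i (ext_cocycle (C, C')) \<otimes> sect (C \<otimes>\<^bsub>H\<^esub> C')"
proof -
  have "\<pi> (sect C \<otimes> sect C') = C \<otimes>\<^bsub>H\<^esub> C'"
    using sect[OF assms(1)] sect[OF assms(2)] by (simp only: \<pi>_mult)
  then show "ext_cocycle (C, C') \<in> carrier D"
    "sect C \<otimes> sect C' = i (ext_cocycle (C, C')) \<otimes> sect (C \<otimes>\<^bsub>H\<^esub> C')"
    using resid[of "sect C \<otimes> sect C'"] sect(1)[OF assms(1)] sect(1)[OF assms(2)] assms
    by (simp_all add: ext_cocycle_def)
qed

lemma i_swap: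
  assumes "\<chi> \<in> carrier D" "\<psi> \<in> carrier D" "x \<in> carrier G" "y \<in> carrier G"
  shows "(i \<chi> \<otimes> x) \<otimes> (i \<psi> \<otimes> y) = i (\<chi> \<otimes>\<^bsub>D\<^esub> \<psi>) \<otimes> (x \<otimes> y)"
proof -
  have "(i \<chi> \<otimes> x) \<otimes> (i \<psi> \<otimes> y) = i \<chi> \<otimes> (x \<otimes> i \<psi>) \<otimes> y" using assms by (simp add: m_assoc)
  also have "\<dots> = i \<chi> \<otimes> (i \<psi> \<otimes> x) \<otimes> y" using assms by (simp only: i_comm)
  also have "\<dots> = i (\<chi> \<otimes>\<^bsub>D\<^esub> \<psi>) \<otimes> (x \<otimes> y)" using assms by (simp add: m_assoc i_mult)
  finally show ?thesis .
qed

text \<open>The two bracketings of \<open>sect x \<otimes> sect y \<otimes> sect z\<close> are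
  compared over the same representative of the coset \<open>x y z\<close>.\<close>

lemma ext_cocycle_cocycle: "ext_cocycle \<in> cocycles2 H D"
proof -
  interpret cohomology H D using group_H D.comm_group_axioms by (simp add: cohomology_def)
  show ?thesis
  proof (rule cocycleI)
    fix x y z assume xyz: "x \<in> carrier H" "y \<in> carrier H" "z \<in> carrier H"
    let ?c = "ext_cocycle"
    have cl: "x \<otimes>\<^bsub>H\<^esub> y \<in> carrier H" "y \<otimes>\<^bsub>H\<^esub> z \<in> carrier H" "x \<otimes>\<^bsub>H\<^esub> y \<otimes>\<^bsub>H\<^esub> z \<in> carrier H"
      and assoc: "x \<otimes>\<^bsub>H\<^esub> (y \<otimes>\<^bsub>H\<^esub> z) = x \<otimes>\<^bsub>H\<^esub> y \<otimes>\<^bsub>H\<^esub> z"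
      using xyz by (simp_all only: H.m_closed H.m_assoc)
    note s = sect(1)[OF xyz(1)] sect(1)[OF xyz(2)] sect(1)[OF xyz(3)] sect(1)[OF cl(1)] sect(1)[OF cl(2)] sect(1)[OF cl(3)]
    note e = ext_cocycle(1)[OF xyz(1,2)] ext_cocycle(1)[OF xyz(2,3)] ext_cocycle(1)[OF xyz(1) cl(2)] ext_cocycle(1)[OF cl(1) xyz(3)]
    have "i (?c (y, z) \<otimes>\<^bsub>D\<^esub> ?c (x, y \<otimes>\<^bsub>H\<^esub> z)) \<otimes> sect (x \<otimes>\<^bsub>H\<^esub> y \<otimes>\<^bsub>H\<^esub> z)
        = i (?c (y, z)) \<otimes> (sect x \<otimes> sect (y \<otimes>\<^bsub>H\<^esub> z))"
      using e s ext_cocycle(2)[OF xyz(1) cl(2)] assoc by (simp add: i_mult m_assoc)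
    also have "\<dots> = sect x \<otimes> (i (?c (y, z)) \<otimes> sect (y \<otimes>\<^bsub>H\<^esub> z))"
      using e s i_comm[OF e(2) s(1)] by (simp only: m_assoc[symmetric] i_closed)
    also have "\<dots> = (sect x \<otimes> sect y) \<otimes> sect z"
      using s ext_cocycle(2)[OF xyz(2,3)] by (simp only: m_assoc)
    also have "\<dots> = i (?c (x, y)) \<otimes> (sect (x \<otimes>\<^bsub>H\<^esub> y) \<otimes> sect z)"
      using e s ext_cocycle(2)[OF xyz(1,2)] by (simp only: m_assoc i_closed)
    also have "\<dots> = i (?c (x \<otimes>\<^bsub>H\<^esub> y, z) \<otimes>\<^bsub>D\<^esub> ?c (x, y)) \<otimes> sect (x \<otimes>\<^bsub>H\<^esub> y \<otimes>\<^bsub>H\<^esub> z)"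
      using e s ext_cocycle(2)[OF cl(1) xyz(3)] by (subst D.m_comm) (simp_all add: i_mult m_assoc)
    finally show "?c (y, z) \<otimes>\<^bsub>D\<^esub> ?c (x, y \<otimes>\<^bsub>H\<^esub> z) = ?c (x \<otimes>\<^bsub>H\<^esub> y, z) \<otimes>\<^bsub>D\<^esub> ?c (x, y)"
      by (rule i_cancel) (use e s in auto)
  next
    show "ext_cocycle \<in> extensional (carrier H \<times> carrier H)" by (simp add: ext_cocycle_def)
  qed (rule ext_cocycle(1))
qed

lemma resid_mult:
  assumes x: "x \<in> carrier G" and y: "y \<in> carrier G"
  shows "resid (x \<otimes> y) = resid x \<otimes>\<^bsub>D\<^esub> resid y \<otimes>\<^bsub>D\<^esub> ext_cocycle (\<pi> x, \<pi> y)"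
proof (rule i_cancel[of _ "sect (\<pi> (x \<otimes> y))"])
  note e = ext_cocycle[OF \<pi>_mem[OF x] \<pi>_mem[OF y]]
  note s = sect(1)[OF \<pi>_mem[OF x]] sect(1)[OF \<pi>_mem[OF y]] sect(1)[OF \<pi>_mem[OF m_closed[OF x y]]]
  have "i (resid (x \<otimes> y)) \<otimes> sect (\<pi> (x \<otimes> y)) = x \<otimes> y" using resid[of "x \<otimes> y"] x y by simp
  also have "\<dots> = (i (resid x) \<otimes> sect (\<pi> x)) \<otimes> (i (resid y) \<otimes> sect (\<pi> y))"
    using resid(2)[OF x] resid(2)[OF y] by simp
  also have "\<dots> = i (resid x \<otimes>\<^bsub>D\<^esub> resid y) \<otimes> (sect (\<pi> x) \<otimes> sect (\<pi> y))"
    using s resid(1)[OF x] resid(1)[OF y] by (simp only: i_swap)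
  also have "\<dots> = i (resid x \<otimes>\<^bsub>D\<^esub> resid y \<otimes>\<^bsub>D\<^esub> ext_cocycle (\<pi> x, \<pi> y)) \<otimes> sect (\<pi> (x \<otimes> y))"
    using s e resid(1)[OF x] resid(1)[OF y] \<pi>_mult[OF x y] by (simp add: i_mult m_assoc)
  finally show "i (resid (x \<otimes> y)) \<otimes> sect (\<pi> (x \<otimes> y))
    = i (resid x \<otimes>\<^bsub>D\<^esub> resid y \<otimes>\<^bsub>D\<^esub> ext_cocycle (\<pi> x, \<pi> y)) \<otimes> sect (\<pi> (x \<otimes> y))" .
qed (use x y resid sect ext_cocycle in auto)

end

section \<open>Two actions on one group and lifts of automorphisms\<close>

locale rigid_pair = cocentral_pair G \<Gamma> i j \<alpha> \<beta>
  for G :: "('a, 'm) monoid_scheme" (structure) and \<Gamma> :: "('g, 'n) monoid_scheme"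
    and i j :: "('g \<Rightarrow> 'k::{alg_closed_field, field_char_0}) \<Rightarrow> 'a" and \<alpha> \<beta> :: "'g \<Rightarrow> 'a \<Rightarrow> 'a" +
  assumes center_cyclic: "cyclic_group (G\<lparr>carrier := center G\<rparr>)"
    and hom_trivial: "\<And>\<phi> h. \<phi> \<in> hom (G Mod (i ` carrier (char_group \<Gamma>))) (char_group \<Gamma> :: ('g \<Rightarrow> 'k) monoid) \<Longrightarrow>
      h \<in> carrier (G Mod (i ` carrier (char_group \<Gamma>))) \<Longrightarrow> \<phi> h = \<one>\<^bsub>char_group \<Gamma>\<^esub>"
begin

sublocale A: rigid_cocentral G \<Gamma> i \<alpha>
  using center_cyclic hom_trivial by unfold_locales

lemma images_eq: "j ` carrier A.D = i ` carrier A.D"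
proof -
  have "group_hom A.D (G\<lparr>carrier := center G\<rparr>) j"
    by unfold_locales (auto simp: hom_def B.i_mult B.i_center)
  then have "subgroup (j ` carrier A.D) (G\<lparr>carrier := center G\<rparr>)"
    by (rule group_hom.img_is_subgroup)
  then have "j ` carrier A.D = {z \<in> center G. z [^] card (j ` carrier A.D) = \<one>}"
    by (rule A.Z.subgroup_eq_torsion)
  also have "card (j ` carrier A.D) = order \<Gamma>"
    using card_image[OF B.i_inj] A.card_D by simp
  finally show ?thesis using A.Z0_eq by simp
qed

sublocale B: rigid_cocentral G \<Gamma> j \<beta>
  using center_cyclic hom_trivial by unfold_locales (auto simp: images_eq)

end

declare mult_FactGroup [simp del]

context rigid_pair
begin

abbreviation "H \<equiv> A.H"
abbreviation "\<pi> \<equiv> A.\<pi>"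

text \<open>In coordinates the lift sends \<open>i \<chi> \<otimes> sect C\<close> to
  \<open>i (\<tau> \<chi> \<otimes> b C) \<otimes> sect (\<sigma> C)\<close>. It is multiplicative
  exactly when \<open>b\<close> is a cochain whose coboundary relates the pushforward of the factor
  set along \<tau> to its pullback along \<sigma>.\<close>

lemma lift_automorphism:
  assumes small: "card (carrier (H2 H A.D)) \<le> 2 \<or> H2_actions_trivial H A.D"
    and v: "v \<in> auto A.D" and \<sigma>: "\<sigma> \<in> auto H"
  obtains f where "f \<in> auto G" "\<And>\<chi>. \<chi> \<in> carrier A.D \<Longrightarrow> f (j \<chi>) = i (v \<chi>)"
    "\<And>x. x \<in> carrier G \<Longrightarrow> \<pi> (f x) = \<sigma> (\<pi> x)"
proof -
  interpret C: cohomology H A.D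
    using A.group_H A.D.comm_group_axioms by (simp add: cohomology_def)
  \<comment> \<open>The coordinates are taken with respect to \<open>i\<close>, but the lift is
    prescribed on \<open>j(\<Gamma>^)\<close>. Writing \<open>i \<chi> = j (k \<chi>)\<close> shows
    that \<tau> has to be \<open>v\<close> after \<open>k\<close>.\<close>
  define k where "k = (\<lambda>\<chi>. inv_into (carrier A.D) j (i \<chi>))"
  have k: "k \<chi> \<in> carrier A.D" "j (k \<chi>) = i \<chi>" if "\<chi> \<in> carrier A.D" for \<chi>
  proof -
    have "i \<chi> \<in> j ` carrier A.D" using images_eq that by blast
    then show "k \<chi> \<in> carrier A.D" "j (k \<chi>) = i \<chi>" by (auto simp: k_def inv_into_into f_inv_into_f)
  qed
  have k_mult: "k (\<chi> \<otimes>\<^bsub>A.D\<^esub> \<psi>) = k \<chi> \<otimes>\<^bsub>A.D\<^esub> k \<psi>" if "\<chi> \<in> carrier A.D" "\<psi> \<in> carrier A.D" for \<chi> \<psi>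
    by (rule inj_onD[OF B.i_inj]) (use that k in \<open>auto simp: A.i_mult B.i_mult\<close>)
  have v_inj: "inj_on v (carrier A.D)" using v by (auto simp: auto_def Bij_def bij_betw_def)
  define \<tau> where "\<tau> = (\<lambda>\<chi>\<in>carrier A.D. v (k \<chi>))"
  have \<tau>_cl: "\<tau> \<chi> \<in> carrier A.D" if "\<chi> \<in> carrier A.D" for \<chi> using that k autoD[OF v] by (simp add: \<tau>_def)
  have \<tau>_mult: "\<tau> (\<chi> \<otimes>\<^bsub>A.D\<^esub> \<psi>) = \<tau> \<chi> \<otimes>\<^bsub>A.D\<^esub> \<tau> \<psi>" if "\<chi> \<in> carrier A.D" "\<psi> \<in> carrier A.D" for \<chi> \<psi>
    using that k autoD[OF v] k_mult by (simp add: \<tau>_def)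
  have \<tau>_inj: "inj_on \<tau> (carrier A.D)"
  proof (rule inj_onI)
    fix \<chi> \<psi> assume *: "\<chi> \<in> carrier A.D" "\<psi> \<in> carrier A.D" "\<tau> \<chi> = \<tau> \<psi>"
    then have "k \<chi> = k \<psi>" using v_inj k by (auto simp: \<tau>_def dest: inj_onD)
    then have "i \<chi> = i \<psi>" using k * by metis
    then show "\<chi> = \<psi>" using A.i_inj * by (auto dest: inj_onD)
  qed
  have \<tau>: "\<tau> \<in> auto A.D"
    using \<tau>_cl \<tau>_mult \<tau>_inj endo_inj_surj[OF A.finite_D _ \<tau>_inj]
    by (auto simp: auto_def hom_def Bij_def bij_betw_def) (auto simp: \<tau>_def)
  let ?c = A.ext_cocycle
  obtain b1 where b1: "b1 \<in> carrier H \<rightarrow> carrier A.D" and "\<forall>x \<in> carrier H. \<forall>y \<in> carrier H.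
      (\<lambda>(x, y) \<in> carrier H \<times> carrier H. ?c (\<sigma> x, \<sigma> y)) (x, y) =
        b1 y \<otimes>\<^bsub>A.D\<^esub> inv\<^bsub>A.D\<^esub> (b1 (x \<otimes>\<^bsub>H\<^esub> y)) \<otimes>\<^bsub>A.D\<^esub> b1 x \<otimes>\<^bsub>A.D\<^esub> ?c (x, y)"
    using C.cohomologousD[OF C.pullback_cohomologous[OF A.finite_H A.finite_D small \<sigma> A.ext_cocycle_cocycle]] by blast
  then have b1_eq: "?c (\<sigma> x, \<sigma> y) =
        b1 y \<otimes>\<^bsub>A.D\<^esub> inv\<^bsub>A.D\<^esub> (b1 (x \<otimes>\<^bsub>H\<^esub> y)) \<otimes>\<^bsub>A.D\<^esub> b1 x \<otimes>\<^bsub>A.D\<^esub> ?c (x, y)"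
    if "x \<in> carrier H" "y \<in> carrier H" for x y using that by simp
  obtain b2 where b2: "b2 \<in> carrier H \<rightarrow> carrier A.D" and "\<forall>x \<in> carrier H. \<forall>y \<in> carrier H.
      compose (carrier H \<times> carrier H) \<tau> ?c (x, y) =
        b2 y \<otimes>\<^bsub>A.D\<^esub> inv\<^bsub>A.D\<^esub> (b2 (x \<otimes>\<^bsub>H\<^esub> y)) \<otimes>\<^bsub>A.D\<^esub> b2 x \<otimes>\<^bsub>A.D\<^esub> ?c (x, y)"
    using C.cohomologousD[OF C.pushforward_cohomologous[OF A.finite_H A.finite_D small \<tau> A.ext_cocycle_cocycle]] by blast
  then have b2_eq: "\<tau> (?c (x, y)) =
        b2 y \<otimes>\<^bsub>A.D\<^esub> inv\<^bsub>A.D\<^esub> (b2 (x \<otimes>\<^bsub>H\<^esub> y)) \<otimes>\<^bsub>A.D\<^esub> b2 x \<otimes>\<^bsub>A.D\<^esub> ?c (x, y)"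
    if "x \<in> carrier H" "y \<in> carrier H" for x y using that by (simp add: compose_def)
  \<comment> \<open>Pullback and pushforward are each cohomologous to the factor set itself, through
    \<open>b1\<close> and \<open>b2\<close>; the quotient of the cochains relates them to one
    another.\<close>
  define b where "b x = b2 x \<otimes>\<^bsub>A.D\<^esub> inv\<^bsub>A.D\<^esub> (b1 x)" for x
  have b: "b x \<in> carrier A.D" if "x \<in> carrier H" for x using that b1 b2 by (simp add: b_def Pi_iff)
  have b_eq: "\<tau> (?c (x, y)) \<otimes>\<^bsub>A.D\<^esub> b (x \<otimes>\<^bsub>H\<^esub> y) = b x \<otimes>\<^bsub>A.D\<^esub> b y \<otimes>\<^bsub>A.D\<^esub> ?c (\<sigma> x, \<sigma> y)"
    if x: "x \<in> carrier H" and y: "y \<in> carrier H" for x y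
  proof -
    have xy: "x \<otimes>\<^bsub>H\<^esub> y \<in> carrier H" using x y C.H.m_closed by blast
    have rearr: "(q2 \<otimes>\<^bsub>A.D\<^esub> r' \<otimes>\<^bsub>A.D\<^esub> p2 \<otimes>\<^bsub>A.D\<^esub> c) \<otimes>\<^bsub>A.D\<^esub> (r \<otimes>\<^bsub>A.D\<^esub> s) = (r \<otimes>\<^bsub>A.D\<^esub> r') \<otimes>\<^bsub>A.D\<^esub> (q2 \<otimes>\<^bsub>A.D\<^esub> p2 \<otimes>\<^bsub>A.D\<^esub> c \<otimes>\<^bsub>A.D\<^esub> s)"
      if "p2 \<in> carrier A.D" "q2 \<in> carrier A.D" "r \<in> carrier A.D" "r' \<in> carrier A.D" "s \<in> carrier A.D" "c \<in> carrier A.D"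
      for p2 q2 r r' s c
      using that by (simp add: A.D.m_ac)
    have rearr': "(p2 \<otimes>\<^bsub>A.D\<^esub> p1') \<otimes>\<^bsub>A.D\<^esub> (q2 \<otimes>\<^bsub>A.D\<^esub> q1') \<otimes>\<^bsub>A.D\<^esub> (q1 \<otimes>\<^bsub>A.D\<^esub> s \<otimes>\<^bsub>A.D\<^esub> p1 \<otimes>\<^bsub>A.D\<^esub> c)
        = (p1 \<otimes>\<^bsub>A.D\<^esub> p1') \<otimes>\<^bsub>A.D\<^esub> ((q1 \<otimes>\<^bsub>A.D\<^esub> q1') \<otimes>\<^bsub>A.D\<^esub> (q2 \<otimes>\<^bsub>A.D\<^esub> p2 \<otimes>\<^bsub>A.D\<^esub> c \<otimes>\<^bsub>A.D\<^esub> s))"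
      if "p1 \<in> carrier A.D" "p1' \<in> carrier A.D" "q1 \<in> carrier A.D" "q1' \<in> carrier A.D" "p2 \<in> carrier A.D"
        "q2 \<in> carrier A.D" "s \<in> carrier A.D" "c \<in> carrier A.D"
      for p1 p1' q1 q1' p2 q2 s c
      using that by (simp add: A.D.m_ac)
    have cl: "b1 x \<in> carrier A.D" "b1 y \<in> carrier A.D" "b1 (x \<otimes>\<^bsub>H\<^esub> y) \<in> carrier A.D"
      "b2 x \<in> carrier A.D" "b2 y \<in> carrier A.D" "b2 (x \<otimes>\<^bsub>H\<^esub> y) \<in> carrier A.D" "?c (x, y) \<in> carrier A.D"
      using b1 b2 x y xy A.ext_cocycle(1) by auto
    let ?I = "\<lambda>\<chi>. inv\<^bsub>A.D\<^esub> \<chi>" and ?r = "b2 (x \<otimes>\<^bsub>H\<^esub> y)" and ?s = "inv\<^bsub>A.D\<^esub> (b1 (x \<otimes>\<^bsub>H\<^esub> y))"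
    have "\<tau> (?c (x, y)) \<otimes>\<^bsub>A.D\<^esub> b (x \<otimes>\<^bsub>H\<^esub> y)
        = (?r \<otimes>\<^bsub>A.D\<^esub> ?I ?r) \<otimes>\<^bsub>A.D\<^esub> (b2 y \<otimes>\<^bsub>A.D\<^esub> b2 x \<otimes>\<^bsub>A.D\<^esub> ?c (x, y) \<otimes>\<^bsub>A.D\<^esub> ?s)"
      unfolding b2_eq[OF x y] b_def by (rule rearr) (use cl in auto)
    also have "\<dots> = b2 y \<otimes>\<^bsub>A.D\<^esub> b2 x \<otimes>\<^bsub>A.D\<^esub> ?c (x, y) \<otimes>\<^bsub>A.D\<^esub> ?s" using cl by simp
    also have "\<dots> = (b1 x \<otimes>\<^bsub>A.D\<^esub> ?I (b1 x)) \<otimes>\<^bsub>A.D\<^esub> ((b1 y \<otimes>\<^bsub>A.D\<^esub> ?I (b1 y)) \<otimes>\<^bsub>A.D\<^esub> (b2 y \<otimes>\<^bsub>A.D\<^esub> b2 x \<otimes>\<^bsub>A.D\<^esub> ?c (x, y) \<otimes>\<^bsub>A.D\<^esub> ?s))"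
      using cl by simp
    also have "\<dots> = b x \<otimes>\<^bsub>A.D\<^esub> b y \<otimes>\<^bsub>A.D\<^esub> ?c (\<sigma> x, \<sigma> y)"
      unfolding b1_eq[OF x y] b_def by (rule rearr'[symmetric]) (use cl in auto)
    finally show ?thesis .
  qed
  define f where "f = (\<lambda>x\<in>carrier G. i (\<tau> (A.resid x) \<otimes>\<^bsub>A.D\<^esub> b (\<pi> x)) \<otimes> A.sect (\<sigma> (\<pi> x)))"
  have e_cl: "\<tau> (A.resid x) \<otimes>\<^bsub>A.D\<^esub> b (\<pi> x) \<in> carrier A.D" if "x \<in> carrier G" for x
    using that A.resid(1) \<tau>_cl b A.\<pi>_mem by simp
  have s_cl: "\<sigma> (\<pi> x) \<in> carrier H" "A.sect (\<sigma> (\<pi> x)) \<in> carrier G" if "x \<in> carrier G" for x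
    using autoD(1)[OF \<sigma> A.\<pi>_mem[OF that]] A.sect(1) by auto
  have f_cl: "f x \<in> carrier G" if "x \<in> carrier G" for x
    using that e_cl s_cl by (simp add: f_def)
  have f_\<pi>: "\<pi> (f x) = \<sigma> (\<pi> x)" if "x \<in> carrier G" for x
    using that e_cl[OF that] s_cl[OF that] A.\<pi>_i_mult A.sect(2) by (simp add: f_def)
  have f_mult: "f (x \<otimes> y) = f x \<otimes> f y" if x: "x \<in> carrier G" and y: "y \<in> carrier G" for x y
  proof -
    let ?X = "\<pi> x" and ?Y = "\<pi> y"
    note X = A.\<pi>_mem[OF x] and Y = A.\<pi>_mem[OF y]
    have XY: "?X \<otimes>\<^bsub>H\<^esub> ?Y \<in> carrier H" using X Y C.H.m_closed by blast
    note cl = A.ext_cocycle(1)[OF X Y] A.resid(1)[OF x] A.resid(1)[OF y] b[OF X] b[OF Y] b[OF XY]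
      A.ext_cocycle(1)[OF s_cl(1)[OF x] s_cl(1)[OF y]]
    have "\<tau> (A.resid (x \<otimes> y)) \<otimes>\<^bsub>A.D\<^esub> b (?X \<otimes>\<^bsub>H\<^esub> ?Y)
        = (\<tau> (A.resid x) \<otimes>\<^bsub>A.D\<^esub> \<tau> (A.resid y)) \<otimes>\<^bsub>A.D\<^esub> (\<tau> (?c (?X, ?Y)) \<otimes>\<^bsub>A.D\<^esub> b (?X \<otimes>\<^bsub>H\<^esub> ?Y))"
      using cl \<tau>_cl A.resid_mult[OF x y] by (simp add: \<tau>_mult A.D.m_assoc)
    also have "\<dots> = (\<tau> (A.resid x) \<otimes>\<^bsub>A.D\<^esub> b ?X) \<otimes>\<^bsub>A.D\<^esub> (\<tau> (A.resid y) \<otimes>\<^bsub>A.D\<^esub> b ?Y) \<otimes>\<^bsub>A.D\<^esub> ?c (\<sigma> ?X, \<sigma> ?Y)"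
      unfolding b_eq[OF X Y] using cl \<tau>_cl by (simp add: A.D.m_ac)
    finally have e: "\<tau> (A.resid (x \<otimes> y)) \<otimes>\<^bsub>A.D\<^esub> b (?X \<otimes>\<^bsub>H\<^esub> ?Y) = \<dots>" .
    have "f (x \<otimes> y) = i (\<tau> (A.resid (x \<otimes> y)) \<otimes>\<^bsub>A.D\<^esub> b (?X \<otimes>\<^bsub>H\<^esub> ?Y)) \<otimes> A.sect (\<sigma> ?X \<otimes>\<^bsub>H\<^esub> \<sigma> ?Y)"
      using A.\<pi>_mult[OF x y] autoD(2)[OF \<sigma> X Y] A.m_closed[OF x y] unfolding f_def by (simp only: restrict_apply if_True)
    also have "\<dots> = i ((\<tau> (A.resid x) \<otimes>\<^bsub>A.D\<^esub> b ?X) \<otimes>\<^bsub>A.D\<^esub> (\<tau> (A.resid y) \<otimes>\<^bsub>A.D\<^esub> b ?Y)) \<otimes>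
        (A.sect (\<sigma> ?X) \<otimes> A.sect (\<sigma> ?Y))"
      unfolding e A.ext_cocycle(2)[OF s_cl(1)[OF x] s_cl(1)[OF y]]
      using cl e_cl[OF x] e_cl[OF y] A.sect(1)[OF C.H.m_closed[OF s_cl(1)[OF x] s_cl(1)[OF y]]]
      by (simp only: A.i_mult A.m_assoc A.i_closed A.D.m_closed A.m_closed)
    also have "\<dots> = f x \<otimes> f y"
      using x y e_cl[OF x] e_cl[OF y] s_cl[OF x] s_cl[OF y] by (simp add: f_def A.i_swap)
    finally show ?thesis .
  qed
  have \<sigma>_inj: "inj_on \<sigma> (carrier H)" using \<sigma> by (auto simp: auto_def Bij_def bij_betw_def)
  have f_inj: "inj_on f (carrier G)"
  proof (rule inj_onI)
    fix x y assume x: "x \<in> carrier G" and y: "y \<in> carrier G" and eq: "f x = f y"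
    have "\<sigma> (\<pi> x) = \<sigma> (\<pi> y)" using f_\<pi>[OF x] f_\<pi>[OF y] eq by metis
    then have \<pi>_eq: "\<pi> x = \<pi> y"
      by (rule inj_onD[OF \<sigma>_inj _ A.\<pi>_mem[OF x] A.\<pi>_mem[OF y]])
    then have "\<tau> (A.resid x) \<otimes>\<^bsub>A.D\<^esub> b (\<pi> x) = \<tau> (A.resid y) \<otimes>\<^bsub>A.D\<^esub> b (\<pi> x)"
      using eq x y e_cl[OF x] e_cl[OF y] s_cl[OF x]
      by (intro A.i_cancel[of _ "A.sect (\<sigma> (\<pi> x))"]) (auto simp: f_def)
    then have "\<tau> (A.resid x) = \<tau> (A.resid y)"
      by (simp only: A.D.right_cancel b[OF A.\<pi>_mem[OF x]] \<tau>_cl A.resid(1)[OF x] A.resid(1)[OF y])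
    then have "A.resid x = A.resid y"
      by (rule inj_onD[OF \<tau>_inj]) (use A.resid(1) x y in auto)
    then show "x = y" using A.resid(2)[OF x] A.resid(2)[OF y] \<pi>_eq by simp
  qed
  have f: "f \<in> auto G"
    using f_cl f_mult f_inj endo_inj_surj[OF A.finite_G _ f_inj]
    by (auto simp: auto_def hom_def Bij_def bij_betw_def) (auto simp: f_def)
  have f_one: "f \<one> = \<one>"
    using f_mult[of "\<one>" "\<one>"] f_cl[of "\<one>"] by (simp add: A.l_cancel_one')
  have "f (j \<psi>) = i (v \<psi>)" if \<psi>: "\<psi> \<in> carrier A.D" for \<psi>
  proof -
    have "j \<psi> \<in> i ` carrier A.D" using images_eq \<psi> by blast
    then obtain \<chi> where \<chi>: "\<chi> \<in> carrier A.D" "j \<psi> = i \<chi>" by blast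
    have "k \<chi> = \<psi>" by (rule inj_onD[OF B.i_inj]) (use k \<chi> \<psi> in auto)
    then have \<tau>\<chi>: "\<tau> \<chi> = v \<psi>" using \<chi>(1) by (simp add: \<tau>_def)
    note o = A.one_closed and s1 = A.sect[OF A.\<pi>_mem[OF A.one_closed]]
    \<comment> \<open>The section is not normalized, so \<open>A.resid \<one>\<close> may be
      nontrivial. It is carried along and absorbed in \<open>f \<one> = \<one>\<close>.\<close>
    have res: "A.resid (i \<chi>) = \<chi> \<otimes>\<^bsub>A.D\<^esub> A.resid \<one>"
    proof -
      have "i \<chi> = i (\<chi> \<otimes>\<^bsub>A.D\<^esub> A.resid \<one>) \<otimes> A.sect (\<pi> \<one>)"
        using \<chi>(1) A.resid[OF o] s1(1) by (simp add: A.i_mult A.m_assoc) 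
      then show ?thesis using A.resid_unique[of "\<chi> \<otimes>\<^bsub>A.D\<^esub> A.resid \<one>" "\<pi> \<one>"] \<chi>(1) A.resid(1)[OF o] A.\<pi>_mem[OF o]
        by simp
    qed
    have \<pi>1: "\<pi> (i \<chi>) = \<pi> \<one>" using A.\<pi>_i_mult[OF \<chi>(1) o] \<chi>(1) by simp
    have "f (i \<chi>) = i (\<tau> \<chi>) \<otimes> f \<one>"
      using \<chi>(1) A.resid(1)[OF o] \<tau>_cl b[OF A.\<pi>_mem[OF o]] s_cl[OF o]
      by (simp add: f_def res \<pi>1 \<tau>_mult A.i_mult A.m_assoc)
    then show ?thesis using f_one \<chi> \<tau>_cl[OF \<chi>(1)] \<tau>\<chi> by simp
  qed
  with f f_\<pi> that show thesis by blast
qed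

lemma char_pullback_auto:
  assumes u: "u \<in> auto \<Gamma>"
  shows "restrict (char_pullback \<Gamma> u) (carrier A.D) \<in> auto A.D"
proof -
  have "char_pullback \<Gamma> u (\<chi> \<otimes>\<^bsub>A.D\<^esub> \<psi>) = char_pullback \<Gamma> u \<chi> \<otimes>\<^bsub>A.D\<^esub> char_pullback \<Gamma> u \<psi>" for \<chi> \<psi>
    using autoD(1)[OF u] by (auto simp: char_pullback_def compose_def mult_char_group fun_eq_iff)
  then show ?thesis
    using bij_char_pullback[OF u] char_pullback_closed[OF u]
    by (auto simp: auto_def hom_def Bij_def)
qed

lemma image_\<pi>:
  assumes "\<And>x y. x \<in> carrier G \<Longrightarrow> y \<in> carrier G \<Longrightarrow> f (x \<otimes> y) = f x \<otimes> f y"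
    and "f ` A.Z0 = A.Z0" and x: "x \<in> carrier G"
  shows "f ` \<pi> x = \<pi> (f x)"
proof -
  have coset: "\<pi> y = (\<lambda>z. z \<otimes> y) ` A.Z0" for y by (auto simp: r_coset_def)
  have "f ` \<pi> x = (\<lambda>z. f z \<otimes> f x) ` A.Z0"
    unfolding coset image_image by (rule image_cong) (use x assms(1) in auto)
  also have "\<dots> = (\<lambda>z. z \<otimes> f x) ` (f ` A.Z0)" by (simp only: image_image)
  also have "\<dots> = \<pi> (f x)" unfolding assms(2) coset ..
  finally show ?thesis .
qed

lemma \<alpha>_\<pi>: "g \<in> carrier \<Gamma> \<Longrightarrow> x \<in> carrier G \<Longrightarrow> \<alpha> g ` \<pi> x = \<pi> (\<alpha> g x)"
  by (rule image_\<pi>) (auto simp: A.\<alpha>_mult image_image)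

lemma \<beta>_\<pi>: "g \<in> carrier \<Gamma> \<Longrightarrow> x \<in> carrier G \<Longrightarrow> \<beta> g ` \<pi> x = \<pi> (\<beta> g x)"
  by (rule image_\<pi>) (auto simp: B.\<alpha>_mult image_image simp flip: images_eq)

lemma weakly_equivalent_imp_equivalent:
  assumes small: "card (carrier (H2 H A.D)) \<le> 2 \<or> H2_actions_trivial H A.D"
    and weak: "weakly_equivalent_actions \<Gamma> G i \<alpha> j \<beta>"
  shows "equivalent_actions \<Gamma> G i \<alpha> j \<beta>"
proof -
  have "\<exists>u\<in>auto \<Gamma>. \<exists>f\<in>iso H H. \<forall>g\<in>carrier \<Gamma>. \<forall>C\<in>carrier H.
      inv_into (carrier H) f (\<alpha> g ` f C) = \<beta> (u g) ` C"
    using weak by (simp only: weakly_equivalent_actions_def Let_def images_eq)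
  then obtain u where u: "u \<in> auto \<Gamma>" and "\<exists>f\<in>iso H H. \<forall>g\<in>carrier \<Gamma>. \<forall>C\<in>carrier H.
      inv_into (carrier H) f (\<alpha> g ` f C) = \<beta> (u g) ` C"
    by (rule bexE)
  from this(2) obtain f0 where f0: "f0 \<in> iso H H" and eq: "\<forall>g\<in>carrier \<Gamma>. \<forall>C\<in>carrier H.
      inv_into (carrier H) f0 (\<alpha> g ` f0 C) = \<beta> (u g) ` C"
    by (rule bexE)
  \<comment> \<open>Elements of \<open>auto H\<close> are extensional, whereas \<open>f0\<close> is
    arbitrary outside the carrier.\<close>
  define \<sigma> where "\<sigma> = restrict f0 (carrier H)"
  have bij0: "bij_betw f0 (carrier H) (carrier H)" and hom0: "f0 \<in> hom H H" using f0 by (auto simp: iso_def)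
  have \<sigma>: "\<sigma> \<in> auto H"
  proof -
    have "\<sigma> \<in> hom H H" using hom0 group.subgroup_self[OF A.group_H] subgroup.m_closed
      by (fastforce simp: hom_def \<sigma>_def)
    moreover have "\<sigma> \<in> Bij (carrier H)" using bij0 by (simp add: Bij_def \<sigma>_def)
    ultimately show ?thesis by (simp add: auto_def)
  qed
  obtain f where f: "f \<in> auto G" and fj: "\<And>\<chi>. \<chi> \<in> carrier A.D \<Longrightarrow> f (j \<chi>) = i (restrict (char_pullback \<Gamma> u) (carrier A.D) \<chi>)"
    and f\<pi>: "\<And>x. x \<in> carrier G \<Longrightarrow> \<pi> (f x) = \<sigma> (\<pi> x)"
    using lift_automorphism[OF small char_pullback_auto[OF u] \<sigma>] by blast
  have f_cl: "f x \<in> carrier G" and f_mult: "y \<in> carrier G \<Longrightarrow> f (x \<otimes> y) = f x \<otimes> f y" if "x \<in> carrier G" for x y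
    using autoD[OF f that] by auto
  have ug: "u g \<in> carrier \<Gamma>" if "g \<in> carrier \<Gamma>" for g using autoD(1)[OF u that] .
  have main: "\<alpha> g (f x) = f (\<beta> (u g) x)" if g: "g \<in> carrier \<Gamma>" and x: "x \<in> carrier G" for g x
  proof -
    \<comment> \<open>Weak equivalence says that both factors have the same image in
      \<open>H\<close> up to inversion, so \<open>d\<close> has values in
      \<open>i(\<Gamma>^)\<close>. These are central, whence \<open>d\<close> is multiplicative; on
      \<open>i(\<Gamma>^)\<close> it is trivial because \<alpha> and \<beta> fix that
      subgroup.\<close>
    define d where "d = (\<lambda>x. \<alpha> g (f x) \<otimes> inv f (\<beta> (u g) x))"
    have cl: "\<alpha> g (f x) \<in> carrier G" "f (\<beta> (u g) x) \<in> carrier G" "\<beta> (u g) x \<in> carrier G" if "x \<in> carrier G" for x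
      using that g ug f_cl by auto
    have dZ: "d x \<in> A.Z0" if x: "x \<in> carrier G" for x
    proof -
      have "\<alpha> g ` f0 (\<pi> x) = \<pi> (\<alpha> g (f x))"
        using f\<pi>[OF x] \<alpha>_\<pi>[OF g f_cl[OF x]] A.\<pi>_mem[OF x] by (simp add: \<sigma>_def)
      then have "inv_into (carrier H) f0 (\<pi> (\<alpha> g (f x))) = \<pi> (\<beta> (u g) x)"
        using bspec[OF bspec[OF eq g] A.\<pi>_mem[OF x]] \<beta>_\<pi>[OF ug[OF g] x] by simp
      then have "\<pi> (\<alpha> g (f x)) = f0 (\<pi> (\<beta> (u g) x))"
        using f_inv_into_f[of "\<pi> (\<alpha> g (f x))" f0 "carrier H"] bij0 A.\<pi>_mem[OF cl(1)[OF x]]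
        by (metis bij_betw_imp_surj_on)
      also have "\<dots> = \<pi> (f (\<beta> (u g) x))"
        using f\<pi>[OF cl(3)[OF x]] A.\<pi>_mem[OF cl(3)[OF x]] by (simp add: \<sigma>_def)
      finally show ?thesis
        unfolding d_def using A.Z0_coset_eq_iff[OF cl(1,2)[OF x]] by blast
    qed
    have "d x = \<one>"
    proof (rule A.central_hom_trivial_aux[OF dZ _ _ x])
      fix x y assume x: "x \<in> carrier G" and y: "y \<in> carrier G"
      have dy: "d y \<in> carrier G" "d y \<otimes> inv f (\<beta> (u g) x) = inv f (\<beta> (u g) x) \<otimes> d y"
        using dZ[OF y] cl[OF x] A.i_comm by auto
      have "d (x \<otimes> y) = \<alpha> g (f x) \<otimes> (d y \<otimes> inv f (\<beta> (u g) x))"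
        using cl[OF x] cl[OF y] x y g ug[OF g] f_cl f_mult
        by (simp add: d_def A.\<alpha>_mult B.\<alpha>_mult A.inv_mult_group A.m_assoc)
      also have "\<dots> = d x \<otimes> d y"
        unfolding dy(2) using cl[OF x] dy(1) by (simp add: d_def A.m_assoc)
      finally show "d (x \<otimes> y) = d x \<otimes> d y" .
    next
      fix \<chi> assume "\<chi> \<in> carrier A.D"
      then obtain \<psi> where \<psi>: "\<psi> \<in> carrier A.D" "i \<chi> = j \<psi>" using images_eq by blast
      then show "d (i \<chi>) = \<one>"
        using fj[OF \<psi>(1)] g ug[OF g] char_pullback_closed[OF u \<psi>(1)] by (simp add: d_def)
    qed
    then show ?thesis unfolding d_def using cl[OF x] by (simp add: A.inv_solve_right')
  qed
  have f_inj: "inj_on f (carrier G)" using f by (auto simp: auto_def Bij_def bij_betw_def)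
  show ?thesis
    unfolding equivalent_actions_def
  proof (intro bexI[OF _ u] bexI[OF _ f] conjI ballI)
    show "i (char_pullback \<Gamma> u \<chi>) = f (j \<chi>)" if "\<chi> \<in> carrier A.D" for \<chi> using fj[OF that] that by simp
    show "inv_into (carrier G) f (\<alpha> g (f x)) = \<beta> (u g) x" if "g \<in> carrier \<Gamma>" "x \<in> carrier G" for g x
      using main[OF that] that ug f_inj by (simp add: inv_into_f_f)
  qed
qed

lemma equivalent_imp_weakly_equivalent:
  assumes "equivalent_actions \<Gamma> G i \<alpha> j \<beta>"
  shows "weakly_equivalent_actions \<Gamma> G i \<alpha> j \<beta>"
proof -
  obtain u f where u: "u \<in> auto \<Gamma>" and f: "f \<in> auto G"
    and fj: "\<And>\<chi>. \<chi> \<in> carrier A.D \<Longrightarrow> f (j \<chi>) = i (char_pullback \<Gamma> u \<chi>)"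
    and conj: "\<And>g x. g \<in> carrier \<Gamma> \<Longrightarrow> x \<in> carrier G \<Longrightarrow> inv_into (carrier G) f (\<alpha> g (f x)) = \<beta> (u g) x"
    using assms unfolding equivalent_actions_def by metis
  have f_cl: "f x \<in> carrier G" and f_mult: "y \<in> carrier G \<Longrightarrow> f (x \<otimes> y) = f x \<otimes> f y" if "x \<in> carrier G" for x y
    using autoD[OF f that] by auto
  have ug: "u g \<in> carrier \<Gamma>" if "g \<in> carrier \<Gamma>" for g using autoD(1)[OF u that] .
  have f_bij: "bij_betw f (carrier G) (carrier G)" using f by (simp add: auto_def Bij_def)
  have act: "\<alpha> g (f x) = f (\<beta> (u g) x)" if "g \<in> carrier \<Gamma>" "x \<in> carrier G" for g x
    using conj[OF that] f_inv_into_f[of "\<alpha> g (f x)" f "carrier G"] that f_bij f_cl by (simp add: bij_betw_def)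
  \<comment> \<open>\<open>f\<close> carries \<open>j(\<Gamma>^)\<close> onto
    \<open>i(\<Gamma>^)\<close>, and these are the same subgroup; hence \<open>f\<close> acts on
    \<open>H\<close> by taking images of cosets.\<close>
  have fZ: "f ` A.Z0 = A.Z0"
  proof -
    have "f ` A.Z0 = (\<lambda>\<chi>. f (j \<chi>)) ` carrier A.D" by (simp only: images_eq[symmetric] image_image)
    also have "\<dots> = (\<lambda>\<chi>. i (char_pullback \<Gamma> u \<chi>)) ` carrier A.D" using fj by (intro image_cong) auto
    also have "\<dots> = i ` (char_pullback \<Gamma> u ` carrier A.D)" by (simp only: image_image)
    finally show ?thesis using bij_char_pullback[OF u] by (simp add: bij_betw_def)
  qed
  have f\<pi>: "f ` \<pi> x = \<pi> (f x)" if "x \<in> carrier G" for x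
    by (rule image_\<pi>[OF f_mult fZ that])
  have hom: "(`) f \<in> hom H H"
  proof (rule homI)
    fix C C' assume "C \<in> carrier H" "C' \<in> carrier H"
    then obtain x y where x: "x \<in> carrier G" "C = \<pi> x" and y: "y \<in> carrier G" "C' = \<pi> y"
      using A.\<pi>_surj by blast
    have "f ` (C \<otimes>\<^bsub>H\<^esub> C') = \<pi> (f x \<otimes> f y)"
      using x y f\<pi>[of "x \<otimes> y"] f_mult by (simp flip: A.\<pi>_mult)
    then show "f ` (C \<otimes>\<^bsub>H\<^esub> C') = f ` C \<otimes>\<^bsub>H\<^esub> f ` C'"
      using A.\<pi>_mult[OF f_cl[OF x(1)] f_cl[OF y(1)]] f\<pi>[OF x(1)] f\<pi>[OF y(1)] x(2) y(2) by simp
  next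
    fix C assume "C \<in> carrier H"
    then show "f ` C \<in> carrier H" using A.\<pi>_surj f\<pi> f_cl A.\<pi>_mem by metis
  qed
  have surj: "(`) f ` carrier H = carrier H"
  proof
    show "carrier H \<subseteq> (`) f ` carrier H"
    proof
      fix C assume "C \<in> carrier H"
      then obtain y where y: "y \<in> carrier G" "C = \<pi> y" using A.\<pi>_surj by blast
      then obtain x where "x \<in> carrier G" "y = f x" using f_bij by (auto simp: bij_betw_def)
      then show "C \<in> (`) f ` carrier H" using y f\<pi> A.\<pi>_mem by (metis imageI)
    qed
  qed (use hom in \<open>auto simp: hom_def\<close>)
  then have bij: "bij_betw ((`) f) (carrier H) (carrier H)"
    using eq_card_imp_inj_on[OF A.finite_H, of "(`) f"] by (simp add: bij_betw_def)
  show ?thesis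
    unfolding weakly_equivalent_actions_def Let_def images_eq
  proof (intro bexI[OF _ u] bexI[of _ "(`) f"] ballI)
    fix g C assume g: "g \<in> carrier \<Gamma>" and "C \<in> carrier H"
    then obtain x where x: "x \<in> carrier G" "C = \<pi> x" using A.\<pi>_surj by blast
    have bx: "\<beta> (u g) x \<in> carrier G" using ug[OF g] x(1) by simp
    have "\<alpha> g ` f ` C = f ` \<pi> (\<beta> (u g) x)"
      using f\<pi>[OF x(1)] f\<pi>[OF bx] x(2) \<alpha>_\<pi>[OF g f_cl[OF x(1)]] act[OF g x(1)] by simp
    then show "inv_into (carrier H) ((`) f) (\<alpha> g ` f ` C) = \<beta> (u g) ` C"
      using inv_into_f_f[of "(`) f" "carrier H" "\<pi> (\<beta> (u g) x)"] bij A.\<pi>_mem[OF bx] \<beta>_\<pi>[OF ug[OF g] x(1)] x(2)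
      by (simp add: bij_betw_def)
  qed (use hom bij in \<open>simp add: iso_def\<close>)
qed

end

section \<open>Isomorphic twistings come from weakly equivalent actions\<close>

context cocentral
begin

lemma dgr_oneI:
  assumes "\<phi> \<in> extensional (carrier G)"
    and "\<And>x \<chi>. x \<in> carrier G \<Longrightarrow> \<chi> \<in> carrier D \<Longrightarrow> \<phi> (x \<otimes> i \<chi>) = \<phi> x"
  shows "\<phi> \<in> dgr \<one>\<^bsub>\<Gamma>\<^esub>"
  using assms by (intro degI) (simp_all add: \<Gamma>.char_one)

lemma dgr_oneD: "\<phi> \<in> dgr \<one>\<^bsub>\<Gamma>\<^esub> \<Longrightarrow> x \<in> carrier G \<Longrightarrow> \<chi> \<in> carrier D \<Longrightarrow> \<phi> (x \<otimes> i \<chi>) = \<phi> x"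
  by (simp add: degD \<Gamma>.char_one)

lemma twist_mult_one:
  assumes "\<phi> \<in> dgr \<one>\<^bsub>\<Gamma>\<^esub>"
  shows "\<phi> \<star> \<psi> = (\<lambda>x\<in>carrier G. \<phi> x * \<psi> x)"
  using twist_mult_deg[OF assms \<Gamma>.one_closed, of \<psi>] by (auto simp: fun_eq_iff)

text \<open>Since \<alpha> fixes \<open>i \<chi>\<close>, the twist disappears there and the
  homogeneous components add up again. Evaluation at \<open>i \<chi>\<close> is thus a character of
  the twisted algebra, that is, a grouplike element of its dual.\<close>

lemma twist_mult_at_i:
  assumes "\<phi> \<in> extensional (carrier G)" "\<chi> \<in> carrier D"
  shows "(\<phi> \<star> \<psi>) (i \<chi>) = \<phi> (i \<chi>) * \<psi> (i \<chi>)"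
  using assms by (simp add: twist_mult_eq sum_distrib_right[symmetric] sum_avg)

end

context rigid_cocentral
begin

definition ind :: "'a set \<Rightarrow> 'a \<Rightarrow> 'k" where
  "ind C = (\<lambda>s\<in>carrier G. if \<pi> s = C then 1 else 0)"

lemma ind_ext [simp]: "ind C \<in> extensional (carrier G)"
  and ind_apply: "s \<in> carrier G \<Longrightarrow> ind C s = (if \<pi> s = C then 1 else 0)"
  by (simp_all add: ind_def)

lemma \<pi>_mult_i: "\<chi> \<in> carrier D \<Longrightarrow> x \<in> carrier G \<Longrightarrow> \<pi> (x \<otimes> i \<chi>) = \<pi> x"
  using \<pi>_i_mult i_comm by metis

lemma ind_dgr: "ind C \<in> dgr \<one>\<^bsub>\<Gamma>\<^esub>"
  by (rule dgr_oneI) (simp_all add: ind_apply \<pi>_mult_i)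

lemma dgr_one_const:
  assumes "\<phi> \<in> dgr \<one>\<^bsub>\<Gamma>\<^esub>" "x \<in> carrier G" "y \<in> carrier G" "\<pi> x = \<pi> y"
  shows "\<phi> x = \<phi> y"
proof -
  obtain \<chi> where "\<chi> \<in> carrier D" "x = i \<chi> \<otimes> y" using \<pi>_eqD[OF assms(2-4)] by blast
  then show ?thesis using dgr_oneD[OF assms(1,3)] i_comm assms(3) by simp
qed

lemma separate_cosets:
  assumes "x \<in> carrier G" "y \<in> carrier G" "\<And>\<phi>. \<phi> \<in> dgr \<one>\<^bsub>\<Gamma>\<^esub> \<Longrightarrow> \<phi> x = \<phi> y"
  shows "\<pi> x = \<pi> y"
  using assms(3)[OF ind_dgr[of "\<pi> y"]] assms(1,2) by (simp add: ind_apply split: if_splits)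

text \<open>The degree one part is the algebra of functions on \<open>H\<close>, whose characters are the points of \<open>H\<close>.\<close>

lemma dgr_one_character:
  fixes l :: "'a \<Rightarrow> 'k"
  assumes mult: "\<And>\<phi> \<psi>. \<phi> \<in> dgr \<one>\<^bsub>\<Gamma>\<^esub> \<Longrightarrow> \<psi> \<in> dgr \<one>\<^bsub>\<Gamma>\<^esub> \<Longrightarrow>
      (\<Sum>r\<in>carrier G. \<phi> r * \<psi> r * l r) = (\<Sum>r\<in>carrier G. \<phi> r * l r) * (\<Sum>r\<in>carrier G. \<psi> r * l r)"
    and one: "(\<Sum>r\<in>carrier G. l r) = 1"
  shows "\<exists>x\<in>carrier G. \<forall>\<phi>\<in>dgr \<one>\<^bsub>\<Gamma>\<^esub>. (\<Sum>r\<in>carrier G. \<phi> r * l r) = \<phi> x"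
proof -
  \<comment> \<open>The functional takes the orthogonal idempotents \<open>ind C\<close> to
    orthogonal idempotents of the field with sum 1, so exactly one of the scalars \<open>L C\<close>
    is 1 and the others vanish.\<close>
  define L where "L C = (\<Sum>r\<in>carrier G. ind C r * l r)" for C
  have L_mult: "L C * L C' = (if C = C' then L C else 0)" for C C'
  proof -
    have "L C * L C' = (\<Sum>r\<in>carrier G. ind C r * ind C' r * l r)"
      using mult[OF ind_dgr ind_dgr] by (simp add: L_def)
    also have "\<dots> = (\<Sum>r\<in>carrier G. (if C = C' then ind C r * l r else 0))"
      by (intro sum.cong) (auto simp: ind_apply)
    finally show ?thesis by (simp add: L_def)
  qed
  have decomp: "(\<Sum>r\<in>carrier G. \<phi> r * l r) = (\<Sum>C\<in>carrier H. \<phi> (sect C) * L C)" if \<phi>: "\<phi> \<in> dgr \<one>\<^bsub>\<Gamma>\<^esub>" for \<phi>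
  proof -
    have "(\<Sum>C\<in>carrier H. \<phi> (sect C) * L C) = (\<Sum>r\<in>carrier G. \<Sum>C\<in>carrier H. \<phi> (sect C) * ind C r * l r)"
      by (simp add: L_def sum_distrib_left mult.assoc sum.swap[of _ "carrier H"])
    also have "\<dots> = (\<Sum>r\<in>carrier G. \<phi> r * l r)"
    proof (rule sum.cong[OF refl])
      fix r assume r: "r \<in> carrier G"
      have "(\<Sum>C\<in>carrier H. \<phi> (sect C) * ind C r * l r) = (\<Sum>C\<in>carrier H. if C = \<pi> r then \<phi> (sect C) * l r else 0)"
        using r by (intro sum.cong) (auto simp: ind_apply)
      also have "\<dots> = \<phi> (sect (\<pi> r)) * l r" using finite_H \<pi>_mem[OF r] by simp
      also have "\<phi> (sect (\<pi> r)) = \<phi> r"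
        using dgr_one_const[OF \<phi> _ r] sect[OF \<pi>_mem[OF r]] by simp
      finally show "(\<Sum>C\<in>carrier H. \<phi> (sect C) * ind C r * l r) = \<phi> r * l r" .
    qed
    finally show ?thesis by simp
  qed
  have "(\<lambda>r\<in>carrier G. 1) \<in> dgr \<one>\<^bsub>\<Gamma>\<^esub>" by (rule dgr_oneI) auto
  from decomp[OF this] one sect have "(\<Sum>C\<in>carrier H. L C) = 1" by simp
  then obtain C where C: "C \<in> carrier H" "L C \<noteq> 0" by (metis sum.neutral zero_neq_one)
  then have LC: "L C = 1" using L_mult[of C C] by simp
  have LC': "L C' = (if C' = C then 1 else 0)" for C' using L_mult[of C C'] LC by auto
  have "(\<Sum>r\<in>carrier G. \<phi> r * l r) = \<phi> (sect C)" if "\<phi> \<in> dgr \<one>\<^bsub>\<Gamma>\<^esub>" for \<phi>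
    unfolding decomp[OF that] LC' using C(1) finite_H by (simp add: if_distrib cong: if_cong)
  then show ?thesis using sect[OF C(1)] by blast
qed

end

section \<open>The grouplike element \<open>F^*(y0)\<close> and its support\<close>

locale hopf_pair = rigid_pair G \<Gamma> i j \<alpha> \<beta>
  for G :: "('a, 'm) monoid_scheme" (structure) and \<Gamma> :: "('g, 'n) monoid_scheme"
    and i j :: "('g \<Rightarrow> 'k::{alg_closed_field, field_char_0}) \<Rightarrow> 'a" and \<alpha> \<beta> :: "'g \<Rightarrow> 'a \<Rightarrow> 'a" +
  fixes F :: "('a \<Rightarrow> 'k) \<Rightarrow> 'a \<Rightarrow> 'k" and \<chi>0 :: "'g \<Rightarrow> 'k"
  assumes F: "F \<in> hopf_iso (graded_twist \<Gamma> G i \<alpha>) (graded_twist \<Gamma> G j \<beta>)"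
    and \<chi>0: "\<chi>0 \<in> carrier (char_group \<Gamma>)"
    and \<chi>0_gen: "carrier (char_group \<Gamma>) = (\<lambda>k::nat. \<chi>0 [^]\<^bsub>char_group \<Gamma>\<^esub> k) ` {..<order \<Gamma>}"
    and \<chi>0_ord: "\<And>k::nat. \<chi>0 [^]\<^bsub>char_group \<Gamma>\<^esub> k = \<one>\<^bsub>char_group \<Gamma>\<^esub> \<longleftrightarrow> order \<Gamma> dvd k"
begin

lemmas F_facts = hopf_iso_graded_twistD[OF F A.finite_G]

abbreviation "E \<equiv> extensional (carrier G) :: ('a \<Rightarrow> 'k) set"
abbreviation "y0 \<equiv> j \<chi>0"

text \<open>\<open>w\<close> lists the coefficients of \<open>F\<^sup>*(y0)\<close>, an element of the dual of the twisting; as an algebra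
  this dual is the group algebra \<open>k[G]\<close>.\<close>

definition w :: "'a \<Rightarrow> 'k" where "w r = F (delta_fun G r) y0"

lemma F_lin: "\<phi> \<in> E \<Longrightarrow> s \<in> carrier G \<Longrightarrow> F \<phi> s = (\<Sum>x\<in>carrier G. \<phi> x * F (delta_fun G x) s)"
  by (rule F_facts(4))

lemma F_ext [simp]: "\<phi> \<in> E \<Longrightarrow> F \<phi> \<in> E"
  using F_facts(1) by (auto simp: bij_betw_def)

lemma F_scale: "\<phi> \<in> E \<Longrightarrow> F (\<lambda>s\<in>carrier G. c * \<phi> s) = (\<lambda>s\<in>carrier G. c * F \<phi> s)"
  by (rule extensionalityI[of _ "carrier G"]) (auto simp: F_lin sum_distrib_left mult.assoc)

lemma F_eqD: "\<phi> \<in> E \<Longrightarrow> \<psi> \<in> E \<Longrightarrow> (\<And>s. s \<in> carrier G \<Longrightarrow> F \<phi> s = F \<psi> s) \<Longrightarrow> \<phi> = \<psi>"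
  using F_facts(1) extensionalityI[of "F \<phi>" "carrier G" "F \<psi>"] F_ext
  by (auto simp: bij_betw_def dest: inj_onD)

lemma y0: "y0 \<in> carrier G" using \<chi>0 by simp

lemma F_y0: "\<phi> \<in> E \<Longrightarrow> F \<phi> y0 = (\<Sum>r\<in>carrier G. \<phi> r * w r)"
  using F_lin y0 by (simp add: w_def)

lemma F_comult: "\<phi> \<in> E \<Longrightarrow> s \<in> carrier G \<Longrightarrow> t \<in> carrier G \<Longrightarrow>
    F \<phi> (s \<otimes> t) = (\<Sum>x\<in>carrier G. \<Sum>y\<in>carrier G. \<phi> (x \<otimes> y) * F (delta_fun G x) s * F (delta_fun G y) t)"
  by (rule F_facts(5)) (auto intro: A.m_closed)

text \<open>Compatibility with the comultiplication, read as a statement about translations: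
  translating \<open>F \<phi>\<close> by \<open>y0\<close> corresponds to convolving \<phi> with
  \<open>w\<close>.\<close>

lemma F_shift:
  assumes "\<phi> \<in> E" "t \<in> carrier G"
  shows "F \<phi> (t \<otimes> y0) = F (\<lambda>s\<in>carrier G. \<Sum>r\<in>carrier G. w r * \<phi> (s \<otimes> r)) t"
proof -
  have "F \<phi> (t \<otimes> y0) = (\<Sum>s\<in>carrier G. (\<Sum>r\<in>carrier G. w r * \<phi> (s \<otimes> r)) * F (delta_fun G s) t)"
    using F_comult[OF assms y0] by (simp add: w_def sum_distrib_left sum_distrib_right mult_ac)
  then show ?thesis using F_lin[OF restrict_extensional assms(2)] by simp
qed

lemma F_shift':
  assumes "\<phi> \<in> E" "t \<in> carrier G"
  shows "F \<phi> (y0 \<otimes> t) = F (\<lambda>s\<in>carrier G. \<Sum>r\<in>carrier G. w r * \<phi> (r \<otimes> s)) t"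
proof -
  have "F \<phi> (y0 \<otimes> t) = (\<Sum>r\<in>carrier G. \<Sum>s\<in>carrier G. w r * \<phi> (r \<otimes> s) * F (delta_fun G s) t)"
    using F_comult[OF assms(1) y0 assms(2)] by (simp add: w_def mult_ac)
  also have "\<dots> = (\<Sum>s\<in>carrier G. (\<Sum>r\<in>carrier G. w r * \<phi> (r \<otimes> s)) * F (delta_fun G s) t)"
    by (subst sum.swap) (simp add: sum_distrib_right)
  finally show ?thesis using F_lin[OF restrict_extensional assms(2)] by simp
qed

lemma sum_w: "(\<Sum>r\<in>carrier G. w r) = 1"
  using F_y0[of "\<lambda>x\<in>carrier G. 1"] F_facts(3) y0 by simp

text \<open>The functional with coefficients \<open>w\<close> is evaluation at \<open>y0\<close>
  after \<open>F\<close>, and evaluation at a point of \<open>j(\<Gamma>^)\<close> is a character of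
  the second twisting.\<close>

lemma \<theta>_mult:
  assumes "\<phi> \<in> E" "\<psi> \<in> E"
  shows "(\<Sum>r\<in>carrier G. A.twist_mult \<phi> \<psi> r * w r) = (\<Sum>r\<in>carrier G. \<phi> r * w r) * (\<Sum>r\<in>carrier G. \<psi> r * w r)"
proof -
  have "A.twist_mult \<phi> \<psi> \<in> E" using assms by (simp add: A.twist_mult_eq)
  then have "(\<Sum>r\<in>carrier G. A.twist_mult \<phi> \<psi> r * w r) = F (A.twist_mult \<phi> \<psi>) y0"
    by (simp add: F_y0)
  also have "\<dots> = F \<phi> y0 * F \<psi> y0"
    using F_facts(2)[OF assms] B.twist_mult_at_i[OF F_ext[OF assms(1)] \<chi>0] by simp
  finally show ?thesis using assms by (simp add: F_y0)
qed

lemma \<theta>_coset: "\<exists>x\<in>carrier G. \<forall>\<phi>\<in>A.dgr \<one>\<^bsub>\<Gamma>\<^esub>. (\<Sum>r\<in>carrier G. \<phi> r * w r) = \<phi> x"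
proof (rule A.dgr_one_character)
    fix \<phi> \<psi> assume *: "\<phi> \<in> A.dgr \<one>\<^bsub>\<Gamma>\<^esub>" "\<psi> \<in> A.dgr \<one>\<^bsub>\<Gamma>\<^esub>"
    show "(\<Sum>r\<in>carrier G. \<phi> r * \<psi> r * w r) = (\<Sum>r\<in>carrier G. \<phi> r * w r) * (\<Sum>r\<in>carrier G. \<psi> r * w r)"
      using \<theta>_mult[OF A.deg_ext[OF *(1)] A.deg_ext[OF *(2)]] by (simp add: A.twist_mult_one[OF *(1)])
qed (rule sum_w)

lemma w_support: "\<exists>x\<in>carrier G. w x \<noteq> 0 \<and> (\<forall>r\<in>carrier G. w r \<noteq> 0 \<longrightarrow> \<pi> r = \<pi> x)"
proof -
  obtain x0 where x0: "x0 \<in> carrier G" and ev: "\<forall>\<phi>\<in>A.dgr \<one>\<^bsub>\<Gamma>\<^esub>. (\<Sum>r\<in>carrier G. \<phi> r * w r) = \<phi> x0"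
    using \<theta>_coset by (rule bexE)
  have sup: "\<pi> r = \<pi> x0" if r: "r \<in> carrier G" and wr: "w r \<noteq> 0" for r
  proof (rule ccontr)
    assume neq: "\<pi> r \<noteq> \<pi> x0"
    \<comment> \<open>The product of this idempotent with \<open>delta_fun G r\<close> is zero,
      while multiplicativity of the functional gives it the value \<open>w r\<close>.\<close>
    let ?p = "A.ind (\<pi> x0)"
    have "(\<Sum>q\<in>carrier G. A.twist_mult ?p (delta_fun G r) q * w q) = (\<Sum>q\<in>carrier G. 0)"
      using neq by (intro sum.cong) (auto simp: A.twist_mult_one[OF A.ind_dgr] A.ind_apply delta_fun_apply)
    moreover have "(\<Sum>q\<in>carrier G. delta_fun G r q * w q) = w r"
      using r F_y0[of "delta_fun G r"] by (simp add: w_def)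
    ultimately have "?p x0 * w r = 0"
      using \<theta>_mult[of ?p "delta_fun G r"] bspec[OF ev A.ind_dgr[of "\<pi> x0"]] by simp
    then show False using wr by (simp add: A.ind_apply[OF x0])
  qed
  obtain x where x: "x \<in> carrier G" "w x \<noteq> 0" using sum_w by (metis sum.neutral zero_neq_one)
  show ?thesis by (intro bexI[OF _ x(1)] conjI ballI impI) (simp_all add: sup x)
qed

text \<open>As \<open>y0\<close> is central, left and right convolution with \<open>w\<close> agree
  after the injective map \<open>F\<close>. Testing on \<open>delta_fun G q\<close> at the point
  \<open>inv s\<close> isolates the two coefficients.\<close>

lemma w_comm:
  assumes s: "s \<in> carrier G" and q: "q \<in> carrier G"
  shows "w (s \<otimes> q) = w (q \<otimes> s)"
proof -
  let ?d = "delta_fun G q :: 'a \<Rightarrow> 'k"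
  have cl: "inv s \<in> carrier G" "s \<otimes> q \<in> carrier G" "q \<otimes> s \<in> carrier G"
    using s q A.inv_closed A.m_closed by auto
  have "(\<lambda>s\<in>carrier G. \<Sum>r\<in>carrier G. w r * ?d (s \<otimes> r)) = (\<lambda>s\<in>carrier G. \<Sum>r\<in>carrier G. w r * ?d (r \<otimes> s))"
  proof (rule F_eqD)
    fix t assume t: "t \<in> carrier G"
    show "F (\<lambda>s\<in>carrier G. \<Sum>r\<in>carrier G. w r * ?d (s \<otimes> r)) t = F (\<lambda>s\<in>carrier G. \<Sum>r\<in>carrier G. w r * ?d (r \<otimes> s)) t"
      using F_shift[OF _ t, of ?d] F_shift'[OF _ t, of ?d] B.i_comm[OF \<chi>0 t] by simp
  qed auto
  from fun_cong[OF this, of "inv s"] have eq: "(\<Sum>r\<in>carrier G. w r * ?d (inv s \<otimes> r)) = (\<Sum>r\<in>carrier G. w r * ?d (r \<otimes> inv s))"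
    using cl(1) by simp
  have "(\<Sum>r\<in>carrier G. w r * ?d (inv s \<otimes> r)) = (\<Sum>r\<in>carrier G. if r = s \<otimes> q then w r else 0)"
  proof (rule sum.cong[OF refl])
    fix r assume r: "r \<in> carrier G"
    have "inv s \<otimes> r = q \<longleftrightarrow> r = s \<otimes> q" using r s q by (auto simp: A.m_assoc[symmetric])
    then show "w r * ?d (inv s \<otimes> r) = (if r = s \<otimes> q then w r else 0)"
      using r cl(1) A.m_closed by (simp add: delta_fun_apply)
  qed
  moreover have "(\<Sum>r\<in>carrier G. w r * ?d (r \<otimes> inv s)) = (\<Sum>r\<in>carrier G. if r = q \<otimes> s then w r else 0)"
  proof (rule sum.cong[OF refl])
    fix r assume r: "r \<in> carrier G"
    have "r \<otimes> inv s = q \<longleftrightarrow> r = q \<otimes> s" using r s q by (auto simp: A.m_assoc)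
    then show "w r * ?d (r \<otimes> inv s) = (if r = q \<otimes> s then w r else 0)"
      using r cl(1) A.m_closed by (simp add: delta_fun_apply)
  qed
  ultimately show ?thesis using eq cl A.finite_G by simp
qed

text \<open>By \<open>w_comm\<close> all conjugates of \<open>x\<close> lie in the support, hence in
  one coset of \<open>i(\<Gamma>^)\<close>. The commutators of \<open>x\<close> with elements of
  \<open>G\<close> are therefore central and depend multiplicatively on these elements, so
  \<open>Hom(H, \<Gamma>^) = 1\<close> makes them trivial.\<close>

lemma w_support_central: "\<exists>x\<in>center G. w x \<noteq> 0 \<and> (\<forall>r\<in>carrier G. w r \<noteq> 0 \<longrightarrow> \<pi> r = \<pi> x)"
proof -
  obtain x where x: "x \<in> carrier G" "w x \<noteq> 0" and sup: "\<forall>r\<in>carrier G. w r \<noteq> 0 \<longrightarrow> \<pi> r = \<pi> x"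
    using w_support by blast
  define c where "c t = t \<otimes> x \<otimes> inv t \<otimes> inv x" for t
  have cl: "t \<otimes> x \<otimes> inv t \<in> carrier G" if "t \<in> carrier G" for t using that x A.m_closed A.inv_closed by simp
  have c_Z: "c t \<in> A.Z0" if t: "t \<in> carrier G" for t
  proof -
    have "w (t \<otimes> (x \<otimes> inv t)) = w (x \<otimes> inv t \<otimes> t)" using t x by (intro w_comm) auto
    then have "w (t \<otimes> x \<otimes> inv t) = w x" using t x by (simp add: A.m_assoc)
    then have "\<pi> (t \<otimes> x \<otimes> inv t) = \<pi> x" using bspec[OF sup cl[OF t]] x(2) by simp
    then show ?thesis using A.Z0_coset_eq_iff[OF cl[OF t] x(1)] by (simp add: c_def)
  qed
  have c_one: "c t = \<one>" if t: "t \<in> carrier G" for t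
  proof (rule A.central_hom_trivial_aux[OF c_Z _ _ t])
    fix s t assume s: "s \<in> carrier G" and t: "t \<in> carrier G"
    have ct: "c t \<in> carrier G" "\<And>u. u \<in> carrier G \<Longrightarrow> c t \<otimes> u = u \<otimes> c t" using c_Z[OF t] A.i_comm by auto
    have tx: "t \<otimes> x \<otimes> inv t = c t \<otimes> x" using t x by (simp add: c_def A.m_assoc)
    have "c (s \<otimes> t) = s \<otimes> (t \<otimes> x \<otimes> inv t) \<otimes> inv s \<otimes> inv x"
      using s t x by (simp add: c_def A.inv_mult_group A.m_assoc)
    also have "\<dots> = (s \<otimes> c t) \<otimes> x \<otimes> inv s \<otimes> inv x"
      unfolding tx using s x ct(1) by (simp add: A.m_assoc)
    also have "\<dots> = (c t \<otimes> s) \<otimes> x \<otimes> inv s \<otimes> inv x" by (simp only: ct(2)[OF s])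
    also have "\<dots> = c t \<otimes> c s" using s t x ct(1) by (simp add: A.m_assoc c_def[of s])
    also have "\<dots> = c s \<otimes> c t" by (rule ct(2)) (use c_Z[OF s] in auto)
    finally show "c (s \<otimes> t) = c s \<otimes> c t" .
  next
    fix \<chi> assume \<chi>: "\<chi> \<in> carrier A.D"
    then show "c (i \<chi>) = \<one>" using x A.i_comm[OF \<chi> x(1)] by (simp add: c_def A.m_assoc)
  qed
  have "x \<otimes> t = t \<otimes> x" if t: "t \<in> carrier G" for t
  proof -
    have "t \<otimes> x \<otimes> inv t = x" using c_one[OF t] cl[OF t] x t by (simp add: c_def A.inv_solve_right')
    then have "t \<otimes> x \<otimes> inv t \<otimes> t = x \<otimes> t" by (simp only:)
    then show ?thesis using t x(1) by (simp add: A.m_assoc)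
  qed
  then have "x \<in> center G" using x by (simp add: center_def)
  then show ?thesis using x(2) sup by blast
qed

end

lemma (in comm_group) pow_index_mem:
  assumes S: "subgroup S G" and fin: "finite (carrier G)" and x: "x \<in> carrier G" and card: "m * card S = order G"
  shows "x [^] m \<in> S"
proof -
  have normal: "S \<lhd> G" using subgroup_imp_normal[OF S] .
  interpret Q: group "G Mod S" using normal.factorgroup_is_group[OF normal] .
  have "finite S" using subgroup.subset[OF S] fin finite_subset by blast
  then have "card S > 0" using subgroup.one_closed[OF S] by (auto simp: card_gt_0_iff)
  then have m: "card (rcosets S) = m" using lagrange[OF S] card by (metis mult_cancel2 not_gr_zero)
  have "S #> x \<in> carrier (G Mod S)" using x by (auto simp: carrier_FactGroup)
  then have "(S #> x) [^]\<^bsub>G Mod S\<^esub> m = S"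
    using Q.pow_order_eq_1[of "S #> x"] m by (simp add: Coset.order_def FactGroup_def)
  then have "S #> (x [^] m) = S" using normal.FactGroup_pow[OF normal x] by simp
  then show ?thesis using coset_join1[OF _ _ S] subgroup.subset[OF S] x by auto
qed

lemma (in cocentral) \<alpha>_center:
  assumes g: "g \<in> carrier \<Gamma>" and z: "z \<in> center G"
  shows "\<alpha> g z \<in> center G"
proof -
  have zc: "z \<in> carrier G" "\<And>x. x \<in> carrier G \<Longrightarrow> z \<otimes> x = x \<otimes> z" using z by (auto simp: center_def)
  have "\<alpha> g z \<otimes> x = x \<otimes> \<alpha> g z" if x: "x \<in> carrier G" for x
  proof -
    define y where "y = \<alpha> (inv\<^bsub>\<Gamma>\<^esub> g) x"
    have y: "y \<in> carrier G" "x = \<alpha> g y" using g x by (simp_all add: y_def)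
    show ?thesis unfolding y(2) using zc(2)[OF y(1)] \<alpha>_mult[OF g zc(1) y(1)] \<alpha>_mult[OF g y(1) zc(1)] by simp
  qed
  then show ?thesis using g zc(1) by (simp add: center_def)
qed

lemma (in rigid_cocentral) \<alpha>_center_iff:
  assumes g: "g \<in> carrier \<Gamma>" and x: "x \<in> carrier G"
  shows "\<alpha> g x \<in> center G \<longleftrightarrow> x \<in> center G"
  using \<alpha>_center[OF g, of x] \<alpha>_center[OF \<Gamma>.inv_closed[OF g], of "\<alpha> g x"] g x by auto

lemma (in rigid_cocentral) center_mult_iff:
  assumes "x \<in> carrier G" "z \<in> center G"
  shows "x \<otimes> z \<in> center G \<longleftrightarrow> x \<in> center G"
proof
  assume "x \<otimes> z \<in> center G"
  then have "x \<otimes> z \<otimes> inv z \<in> center G"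
    using assms subgroup.m_closed[OF subgroup_center] subgroup.m_inv_closed[OF subgroup_center] by blast
  then show "x \<in> center G" using assms center_closed by (simp add: m_assoc)
qed (use assms subgroup.m_closed[OF subgroup_center] in blast)

context hopf_pair
begin

definition base :: 'a where
  "base = (SOME x. x \<in> center G \<and> w x \<noteq> 0 \<and> (\<forall>r\<in>carrier G. w r \<noteq> 0 \<longrightarrow> \<pi> r = \<pi> x))"

lemma base_center: "base \<in> center G" and base_nonzero: "w base \<noteq> 0"
  and w_supp: "r \<in> carrier G \<Longrightarrow> w r \<noteq> 0 \<Longrightarrow> \<pi> r = \<pi> base"
  using someI_ex[of "\<lambda>x. x \<in> center G \<and> w x \<noteq> 0 \<and> (\<forall>r\<in>carrier G. w r \<noteq> 0 \<longrightarrow> \<pi> r = \<pi> x)"] w_support_central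
  unfolding base_def by blast+

lemma base_closed: "base \<in> carrier G" using base_center A.center_closed by blast

lemma w_suppE:
  assumes "r \<in> carrier G" "w r \<noteq> 0"
  obtains \<chi> where "\<chi> \<in> carrier A.D" "r = i \<chi> \<otimes> base"
  using A.\<pi>_eqD[OF assms(1) base_closed w_supp[OF assms]] by blast

lemma w_supp_center: "r \<in> carrier G \<Longrightarrow> w r \<noteq> 0 \<Longrightarrow> r \<in> center G"
  using subgroup.m_closed[OF A.subgroup_center A.i_center base_center] by (metis w_suppE)

lemma y0_pow: "y0 [^] (k::nat) = j (\<chi>0 [^]\<^bsub>A.D\<^esub> k)"
  using \<chi>0 by (simp add: B.i_pow)

lemma y0_order: "y0 [^] order \<Gamma> = \<one>"
  using \<chi>0_ord[of "order \<Gamma>"] by (simp add: y0_pow B.i_one)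

text \<open>Invariance under \<open>y0\<close> suffices because \<open>y0\<close> generates
  \<open>j(\<Gamma>^)\<close>.\<close>

lemma B_dgr_oneI:
  assumes \<phi>: "\<phi> \<in> E" and inv: "\<And>t. t \<in> carrier G \<Longrightarrow> \<phi> (t \<otimes> y0) = \<phi> t"
  shows "\<phi> \<in> B.dgr \<one>\<^bsub>\<Gamma>\<^esub>"
proof (rule B.dgr_oneI[OF \<phi>])
  have pow: "\<phi> (t \<otimes> y0 [^] k) = \<phi> t" if t: "t \<in> carrier G" for t and k :: nat
  proof (induction k)
    case (Suc k)
    have "t \<otimes> y0 [^] Suc k = (t \<otimes> y0 [^] k) \<otimes> y0" using t y0 by (simp add: A.m_assoc)
    then show ?case using Suc inv[of "t \<otimes> y0 [^] k"] t y0 by simp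
  qed (use t in simp)
  fix t \<chi> assume t: "t \<in> carrier G" and "\<chi> \<in> carrier A.D"
  then obtain k :: nat where "\<chi> = \<chi>0 [^]\<^bsub>A.D\<^esub> k" using \<chi>0_gen by blast
  then show "\<phi> (t \<otimes> j \<chi>) = \<phi> t" using pow[OF t, of k] by (simp add: y0_pow)
qed

text \<open>A function constant on cosets sees only the coset supporting \<open>w\<close> and the
  total mass 1, so convolution with \<open>w\<close> acts on it as translation by
  \<open>base\<close>.\<close>

lemma F_shift_dgr_one:
  assumes \<psi>: "\<psi> \<in> A.dgr \<one>\<^bsub>\<Gamma>\<^esub>" and t: "t \<in> carrier G"
  shows "F \<psi> (t \<otimes> y0) = F (\<lambda>s\<in>carrier G. \<psi> (s \<otimes> base)) t"
proof -
  have "(\<Sum>r\<in>carrier G. w r * \<psi> (s \<otimes> r)) = \<psi> (s \<otimes> base)" if s: "s \<in> carrier G" for s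
  proof -
    have "(\<Sum>r\<in>carrier G. w r * \<psi> (s \<otimes> r)) = (\<Sum>r\<in>carrier G. w r * \<psi> (s \<otimes> base))"
    proof (rule sum.cong[OF refl])
      fix r assume r: "r \<in> carrier G"
      show "w r * \<psi> (s \<otimes> r) = w r * \<psi> (s \<otimes> base)"
      proof (cases "w r = 0")
        case False
        have "\<pi> (s \<otimes> r) = \<pi> (s \<otimes> base)"
          using A.\<pi>_mult[OF s r] A.\<pi>_mult[OF s base_closed] w_supp[OF r False] by simp
        then show ?thesis using A.dgr_one_const[OF \<psi>] s r base_closed A.m_closed by simp
      qed simp
    qed
    then show ?thesis using sum_w by (simp flip: sum_distrib_right)
  qed
  then have "(\<lambda>s\<in>carrier G. \<Sum>r\<in>carrier G. w r * \<psi> (s \<otimes> r)) = (\<lambda>s\<in>carrier G. \<psi> (s \<otimes> base))"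
    by (intro restrict_ext)
  then show ?thesis using F_shift[OF A.deg_ext[OF \<psi>] t] by simp
qed

text \<open>Iteration produces the translation by \<open>base [^] order \<Gamma>\<close> on
  functions on \<open>H\<close>; it is trivial because
  \<open>y0 [^] order \<Gamma> = \<one>\<close>. The indicator of \<open>i(\<Gamma>^)\<close>
  detects this, and functions on \<open>H\<close> cannot give more than membership in
  \<open>i(\<Gamma>^)\<close>.\<close>

lemma base_order: "base [^] order \<Gamma> \<in> A.Z0"
proof -
  have shift: "(\<lambda>s\<in>carrier G. \<psi> (s \<otimes> base [^] k)) \<in> A.dgr \<one>\<^bsub>\<Gamma>\<^esub>" if \<psi>: "\<psi> \<in> A.dgr \<one>\<^bsub>\<Gamma>\<^esub>" for \<psi> and k :: nat
  proof (rule A.dgr_oneI)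
    fix x \<chi> assume x: "x \<in> carrier G" and \<chi>: "\<chi> \<in> carrier A.D"
    have "x \<otimes> i \<chi> \<otimes> base [^] k = x \<otimes> base [^] k \<otimes> i \<chi>"
      using x \<chi> base_closed A.i_comm[OF \<chi>, of "base [^] k"] by (simp add: A.m_assoc)
    then show "(\<lambda>s\<in>carrier G. \<psi> (s \<otimes> base [^] k)) (x \<otimes> i \<chi>) = (\<lambda>s\<in>carrier G. \<psi> (s \<otimes> base [^] k)) x"
      using x \<chi> base_closed A.dgr_oneD[OF \<psi>, of "x \<otimes> base [^] k"] by simp
  qed simp
  have iter: "F \<psi> (t \<otimes> y0 [^] k) = F (\<lambda>s\<in>carrier G. \<psi> (s \<otimes> base [^] k)) t"
    if \<psi>: "\<psi> \<in> A.dgr \<one>\<^bsub>\<Gamma>\<^esub>" and t: "t \<in> carrier G" for \<psi> t and k :: nat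
    using t
  proof (induction k arbitrary: t)
    case 0
    have "(\<lambda>s\<in>carrier G. \<psi> (s \<otimes> base [^] (0::nat))) = \<psi>"
      using A.deg_ext[OF \<psi>] by (intro extensionalityI[of _ "carrier G"]) auto
    then show ?case using 0 by (simp only: A.nat_pow_0 A.r_one)
  next
    case (Suc k)
    have "t \<otimes> y0 [^] Suc k = (t \<otimes> y0) \<otimes> y0 [^] k"
      unfolding A.nat_pow_Suc2[OF y0] using Suc(2) y0 by (simp add: A.m_assoc)
    then have "F \<psi> (t \<otimes> y0 [^] Suc k) = F (\<lambda>s\<in>carrier G. \<psi> (s \<otimes> base [^] k)) (t \<otimes> y0)"
      using Suc.IH[OF A.m_closed[OF Suc(2) y0]] by (simp only:)
    also have "\<dots> = F (\<lambda>s\<in>carrier G. (\<lambda>s\<in>carrier G. \<psi> (s \<otimes> base [^] k)) (s \<otimes> base)) t"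
      by (rule F_shift_dgr_one[OF shift[OF \<psi>] Suc(2)])
    also have "(\<lambda>s\<in>carrier G. (\<lambda>s\<in>carrier G. \<psi> (s \<otimes> base [^] k)) (s \<otimes> base)) = (\<lambda>s\<in>carrier G. \<psi> (s \<otimes> base [^] Suc k))"
      unfolding A.nat_pow_Suc2[OF base_closed] using base_closed by (intro restrict_ext) (simp add: A.m_assoc)
    finally show ?case .
  qed
  let ?p = "A.ind (\<pi> \<one>)" and ?b = "base [^] order \<Gamma>"
  have "(\<lambda>s\<in>carrier G. ?p (s \<otimes> ?b)) = ?p"
  proof (rule F_eqD)
    fix t assume t: "t \<in> carrier G"
    show "F (\<lambda>s\<in>carrier G. ?p (s \<otimes> ?b)) t = F ?p t"
      using iter[OF A.ind_dgr t, of "\<pi> \<one>" "order \<Gamma>"] t by (simp add: y0_order)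
  qed auto
  from fun_cong[OF this, of \<one>] have "\<pi> ?b = \<pi> \<one>"
    using base_closed by (simp add: A.ind_apply split: if_splits)
  then show ?thesis using A.Z0_coset_eq_iff[of ?b \<one>] base_closed by simp
qed

section \<open>Central characters and the scalars \<open>v \<omega>\<close>\<close>

abbreviation "Zh \<equiv> char_group (G\<lparr>carrier := center G\<rparr>) :: ('a \<Rightarrow> 'k) monoid"

text \<open>By duality the restriction of \<open>\<omega>\<close> to \<open>i(\<Gamma>^)\<close> is evaluation at an element of \<open>\<Gamma>\<close>: the degree of the
  functions with central character \<open>\<omega>\<close>.\<close>

definition dg :: "('a \<Rightarrow> 'k) \<Rightarrow> 'g" where
  "dg \<omega> = (SOME g. g \<in> carrier \<Gamma> \<and> (\<forall>\<chi>\<in>carrier A.D. \<omega> (i \<chi>) = \<chi> g))"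

lemma dg: 
  assumes \<omega>: "\<omega> \<in> carrier Zh"
  shows "dg \<omega> \<in> carrier \<Gamma>" "\<And>\<chi>. \<chi> \<in> carrier A.D \<Longrightarrow> \<omega> (i \<chi>) = \<chi> (dg \<omega>)"
proof -
  have "(\<lambda>\<chi>\<in>carrier A.D. \<omega> (i \<chi>)) \<in> carrier (char_group A.D)"
    by (rule char_group_memI)
      (use A.Z.char_nonzero[OF \<omega>] A.Z.char_mult[OF \<omega>] A.i_center in \<open>auto simp: A.i_mult\<close>)
  from A.\<Gamma>.bidual_surj[OF A.cyclic_D this]
  obtain g where "g \<in> carrier \<Gamma>" "\<forall>\<chi>\<in>carrier A.D. \<omega> (i \<chi>) = \<chi> g" by (metis restrict_apply')
  then have "dg \<omega> \<in> carrier \<Gamma> \<and> (\<forall>\<chi>\<in>carrier A.D. \<omega> (i \<chi>) = \<chi> (dg \<omega>))"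
    unfolding dg_def by (intro someI_ex[of "\<lambda>g. g \<in> carrier \<Gamma> \<and> (\<forall>\<chi>\<in>carrier A.D. \<omega> (i \<chi>) = \<chi> g)"]) blast
  then show "dg \<omega> \<in> carrier \<Gamma>" "\<And>\<chi>. \<chi> \<in> carrier A.D \<Longrightarrow> \<omega> (i \<chi>) = \<chi> (dg \<omega>)" by blast+
qed

text \<open>\<open>v \<omega>\<close> is the scalar by which \<open>F\<^sup>*(y0)\<close> acts on functions with central character \<open>\<omega>\<close>.\<close>

definition v :: "('a \<Rightarrow> 'k) \<Rightarrow> 'k" where "v \<omega> = (\<Sum>z\<in>center G. \<omega> z * w z)"

lemma sum_center: "(\<Sum>r\<in>carrier G. f r * w r) = (\<Sum>r\<in>center G. f r * w r)"
  by (rule sum.mono_neutral_right) (use A.finite_G A.center_closed w_supp_center in auto)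

lemma F_eigen:
  assumes \<phi>: "\<phi> \<in> E" and eig: "\<And>s z. s \<in> carrier G \<Longrightarrow> z \<in> center G \<Longrightarrow> \<phi> (s \<otimes> z) = \<omega> z * \<phi> s" and t: "t \<in> carrier G"
  shows "F \<phi> (t \<otimes> y0) = v \<omega> * F \<phi> t"
proof -
  have "(\<Sum>r\<in>carrier G. w r * \<phi> (s \<otimes> r)) = v \<omega> * \<phi> s" if s: "s \<in> carrier G" for s
    using sum_center[of "\<lambda>r. \<phi> (s \<otimes> r)"] eig[OF s] by (simp add: v_def sum_distrib_left mult_ac)
  then have "(\<lambda>s\<in>carrier G. \<Sum>r\<in>carrier G. w r * \<phi> (s \<otimes> r)) = (\<lambda>s\<in>carrier G. v \<omega> * \<phi> s)"
    by (intro restrict_ext)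
  then show ?thesis using F_shift[OF \<phi> t] F_scale[OF \<phi>, of "v \<omega>"] t by simp
qed

text \<open>For a character \<omega> of the center this is the test function with central character
  \<omega> that is supported on the coset of \<open>t\<close> modulo the center and has the value 1
  at \<open>t\<close>.\<close>

definition ext :: "'a \<Rightarrow> ('a \<Rightarrow> 'k) \<Rightarrow> 'a \<Rightarrow> 'k" where
  "ext t \<omega> = (\<lambda>s\<in>carrier G. if inv t \<otimes> s \<in> center G then \<omega> (inv t \<otimes> s) else 0)"

lemma ext_E [simp]: "ext t \<omega> \<in> E" by (simp add: ext_def)

lemma ext_one_apply: "s \<in> carrier G \<Longrightarrow> ext \<one> \<omega> s = (if s \<in> center G then \<omega> s else 0)"
  by (simp add: ext_def)

lemma ext_eigen:
  assumes \<omega>: "\<omega> \<in> carrier Zh" and t: "t \<in> carrier G" and s: "s \<in> carrier G" and z: "z \<in> center G"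
  shows "ext t \<omega> (s \<otimes> z) = \<omega> z * ext t \<omega> s"
proof -
  have "inv t \<otimes> (s \<otimes> z) = (inv t \<otimes> s) \<otimes> z" using t s A.center_closed[OF z] by (simp add: A.m_assoc)
  moreover have "(inv t \<otimes> s) \<otimes> z \<in> center G \<longleftrightarrow> inv t \<otimes> s \<in> center G"
    using A.center_mult_iff[OF _ z] t s by simp
  ultimately show ?thesis
    using A.Z.char_mult[OF \<omega>, of "inv t \<otimes> s" z] z s A.center_closed[OF z] by (simp add: ext_def)
qed

lemma ext_dgr:
  assumes \<omega>: "\<omega> \<in> carrier Zh" and t: "t \<in> carrier G"
  shows "ext t \<omega> \<in> A.dgr (dg \<omega>)"
  by (rule A.degI) (use ext_eigen[OF \<omega> t _ A.i_center] dg(2)[OF \<omega>] in auto)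

lemma sum_ext: "(\<Sum>r\<in>carrier G. ext \<one> \<omega> r * w r) = v \<omega>"
  unfolding sum_center v_def using A.center_closed by (intro sum.cong) (auto simp: ext_def)

definition tw :: "'g \<Rightarrow> ('a \<Rightarrow> 'k) \<Rightarrow> 'a \<Rightarrow> 'k" where
  "tw g \<omega> = (\<lambda>z\<in>center G. \<omega> (\<alpha> (inv\<^bsub>\<Gamma>\<^esub> g) z))"

text \<open>This is \<open>\<theta>_mult\<close> for functions supported on the center. As \<alpha>
  may move central elements, the product of characters has to be twisted by
  \<open>tw\<close>.\<close>

lemma v_mult:
  assumes \<omega>: "\<omega> \<in> carrier Zh" and \<omega>': "\<omega>' \<in> carrier Zh"
  shows "v \<omega> * v \<omega>' = v (\<omega> \<otimes>\<^bsub>Zh\<^esub> tw (dg \<omega>) \<omega>')"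
proof -
  let ?g = "dg \<omega>"
  have g: "inv\<^bsub>\<Gamma>\<^esub> ?g \<in> carrier \<Gamma>" using dg(1)[OF \<omega>] by simp
  have "A.twist_mult (ext \<one> \<omega>) (ext \<one> \<omega>') = ext \<one> (\<omega> \<otimes>\<^bsub>Zh\<^esub> tw ?g \<omega>')"
  proof (rule extensionalityI[of _ "carrier G"])
    fix s assume s: "s \<in> carrier G"
    show "A.twist_mult (ext \<one> \<omega>) (ext \<one> \<omega>') s = ext \<one> (\<omega> \<otimes>\<^bsub>Zh\<^esub> tw ?g \<omega>') s"
      using s g A.\<alpha>_center_iff[OF g s]
      by (simp add: A.twist_mult_deg[OF ext_dgr[OF \<omega> A.one_closed] dg(1)[OF \<omega>]] ext_one_apply tw_def mult_char_group)
  qed (auto simp: A.twist_mult_eq)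
  then show ?thesis using \<theta>_mult[of "ext \<one> \<omega>" "ext \<one> \<omega>'"] by (simp add: sum_ext)
qed

text \<open>Translation by \<open>y0\<close> multiplies the nonzero function
  \<open>F (ext \<one> \<omega>)\<close> by \<open>v \<omega>\<close>, and its iterate of order
  \<open>order \<Gamma>\<close> is the identity.\<close>

lemma v_pow_order:
  assumes \<omega>: "\<omega> \<in> carrier Zh"
  shows "v \<omega> ^ order \<Gamma> = 1"
proof -
  let ?\<phi> = "ext \<one> \<omega>"
  have iter: "F ?\<phi> (t \<otimes> y0 [^] k) = v \<omega> ^ k * F ?\<phi> t" if t: "t \<in> carrier G" for t and k :: nat
  proof (induction k)
    case (Suc k)
    have "t \<otimes> y0 [^] Suc k = (t \<otimes> y0 [^] k) \<otimes> y0" using t y0 by (simp add: A.m_assoc)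
    then show ?case using Suc F_eigen[OF ext_E ext_eigen[OF \<omega> A.one_closed], of "t \<otimes> y0 [^] k"] t y0 by simp
  qed (use t in simp)
  have "\<exists>t\<in>carrier G. F ?\<phi> t \<noteq> 0"
  proof (rule ccontr)
    assume neg: "\<not> ?thesis"
    have "?\<phi> = (\<lambda>s\<in>carrier G. 0)"
      by (rule F_eqD) (use neg in \<open>auto simp: F_lin[of "\<lambda>s\<in>carrier G. 0"]\<close>)
    from fun_cong[OF this, of \<one>] show False
      using A.Z.char_one[OF \<omega>] subgroup.one_closed[OF A.subgroup_center] by (simp add: ext_def)
  qed
  then obtain t where "t \<in> carrier G" "F ?\<phi> t \<noteq> 0" by blast
  then show ?thesis using iter[of t "order \<Gamma>"] y0_order by simp
qed

end

section \<open>Characters with \<open>v \<omega> = 1\<close> and the exponent of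
  \<open>base\<close>\<close>

context hopf_pair
begin

text \<open>The exponent is the one known for \<open>base\<close> so far: its power
  \<open>order \<Gamma>\<close> lies in \<open>i(\<Gamma>^)\<close>, which is killed by
  \<open>order \<Gamma>\<close>.\<close>

abbreviation "Tor \<equiv> {z \<in> center G. z [^] (order \<Gamma> * order \<Gamma>) = \<one>}"

lemma X_subgroup: "subgroup Tor G"
proof (rule A.subgroupI)
  show "Tor \<noteq> {}" using subgroup.one_closed[OF A.subgroup_center] by auto
  fix a assume a: "a \<in> Tor"
  then show "inv a \<in> Tor"
    using subgroup.m_inv_closed[OF A.subgroup_center] A.center_closed by (simp add: A.nat_pow_inv)
  fix b assume b: "b \<in> Tor"
  have "(a \<otimes> b) [^] (order \<Gamma> * order \<Gamma>) = \<one>"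
    using a b A.center_closed A.center_comm by (subst A.pow_mult_distrib) auto
  then show "a \<otimes> b \<in> Tor" using a b subgroup.m_closed[OF A.subgroup_center] by blast
qed (use A.center_closed in auto)

lemma Z0_X: "z \<in> A.Z0 \<Longrightarrow> z \<in> Tor"
  unfolding A.Z0_eq using A.center_closed by (auto simp flip: A.nat_pow_pow)

lemma base_X: "base \<in> Tor"
  using base_order base_center base_closed unfolding A.Z0_eq by (simp add: A.nat_pow_pow)

text \<open>For \<open>v \<omega> = 1\<close> the map \<open>F\<close> sends
  \<open>ext t \<omega>\<close> to a function on \<open>H\<close>, and likewise the indicator of the
  coset of \<open>t\<close> modulo \<open>Tor\<close>. The images commute, hence so do the two
  functions for the first twisted product; evaluated at \<open>t\<close>, this says that
  \<open>t\<close> and its image under the automorphism differ by an element of \<open>Tor\<close>.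
  Then \<open>central_hom_trivial\<close> applies.\<close>

lemma v_one_imp_trivial:
  assumes \<omega>: "\<omega> \<in> carrier Zh" and v: "v \<omega> = 1" and t: "t \<in> carrier G"
  shows "\<alpha> (inv\<^bsub>\<Gamma>\<^esub> (dg \<omega>)) t = t"
proof -
  let ?a = "\<alpha> (inv\<^bsub>\<Gamma>\<^esub> (dg \<omega>))"
  have g: "inv\<^bsub>\<Gamma>\<^esub> (dg \<omega>) \<in> carrier \<Gamma>" using dg(1)[OF \<omega>] by simp
  define c where "c s = inv s \<otimes> ?a s" for s
  have c_X: "c t \<in> Tor" if t: "t \<in> carrier G" for t
  proof -
    define \<phi> where "\<phi> = ext t \<omega>"
    \<comment> \<open>The coset is taken modulo \<open>Tor\<close> and not modulo
      \<open>i(\<Gamma>^)\<close>: \<psi> has to be invariant under \<open>base\<close>, which is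
      not yet known to lie in \<open>i(\<Gamma>^)\<close>.\<close>
    define \<psi> :: "'a \<Rightarrow> 'k" where "\<psi> = (\<lambda>s\<in>carrier G. if inv t \<otimes> s \<in> Tor then 1 else 0)"
    have \<phi>E: "\<phi> \<in> E" and \<psi>E: "\<psi> \<in> E" by (simp_all add: \<phi>_def \<psi>_def)
    have \<psi>_shift: "\<psi> (s \<otimes> z) = \<psi> s" if s: "s \<in> carrier G" and z: "z \<in> Tor" for s z
    proof -
      have zc: "z \<in> carrier G" using z A.center_closed by blast
      have "(inv t \<otimes> s) \<otimes> z \<in> Tor \<longleftrightarrow> inv t \<otimes> s \<in> Tor"
      proof
        assume "(inv t \<otimes> s) \<otimes> z \<in> Tor"
        then have "(inv t \<otimes> s) \<otimes> z \<otimes> inv z \<in> Tor"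
          using subgroup.m_closed[OF X_subgroup] subgroup.m_inv_closed[OF X_subgroup z] by blast
        then show "inv t \<otimes> s \<in> Tor" using s t zc by (simp add: A.m_assoc)
      next
        assume "inv t \<otimes> s \<in> Tor"
        then show "(inv t \<otimes> s) \<otimes> z \<in> Tor" using subgroup.m_closed[OF X_subgroup _ z] by blast
      qed
      then show ?thesis using s t zc by (simp add: \<psi>_def A.m_assoc)
    qed
    have \<psi>1: "\<psi> \<in> A.dgr \<one>\<^bsub>\<Gamma>\<^esub>"
      by (rule A.dgr_oneI[OF \<psi>E]) (rule \<psi>_shift, assumption, rule Z0_X, rule imageI)
    have F\<psi>: "F \<psi> \<in> B.dgr \<one>\<^bsub>\<Gamma>\<^esub>"
    proof (rule B_dgr_oneI)
      fix s assume s: "s \<in> carrier G"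
      have "(\<lambda>s\<in>carrier G. \<psi> (s \<otimes> base)) = \<psi>"
        using \<psi>_shift[OF _ base_X] \<psi>E by (intro extensionalityI[of _ "carrier G"]) auto
      then show "F \<psi> (s \<otimes> y0) = F \<psi> s" using F_shift_dgr_one[OF \<psi>1 s] by simp
    qed (use \<psi>E in simp)
    have F\<phi>: "F \<phi> \<in> B.dgr \<one>\<^bsub>\<Gamma>\<^esub>"
    proof (rule B_dgr_oneI)
      fix s assume s: "s \<in> carrier G"
      show "F \<phi> (s \<otimes> y0) = F \<phi> s"
        using F_eigen[OF \<phi>E ext_eigen[OF \<omega> t, folded \<phi>_def] s] v by simp
    qed (use \<phi>E in simp)
    \<comment> \<open>In degree one the second twisted product is pointwise, hence commutative here;
      injectivity of \<open>F\<close> carries the equation back.\<close>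
    have "F (A.twist_mult \<phi> \<psi>) = F (A.twist_mult \<psi> \<phi>)"
      unfolding F_facts(2)[OF \<phi>E \<psi>E] F_facts(2)[OF \<psi>E \<phi>E] B.twist_mult_one[OF F\<phi>] B.twist_mult_one[OF F\<psi>]
      by (simp add: mult.commute)
    then have "A.twist_mult \<phi> \<psi> = A.twist_mult \<psi> \<phi>"
      using F_facts(1) \<phi>E \<psi>E by (auto simp: bij_betw_def A.twist_mult_eq dest!: inj_onD)
    from fun_cong[OF this, of t] have "\<phi> t * \<psi> (?a t) = \<psi> t * \<phi> t"
      using t by (simp add: A.twist_mult_deg[OF ext_dgr[OF \<omega> t] dg(1)[OF \<omega>], folded \<phi>_def] A.twist_mult_one[OF \<psi>1])
    moreover have "\<phi> t = 1"
      using t A.Z.char_one[OF \<omega>] subgroup.one_closed[OF A.subgroup_center] by (simp add: \<phi>_def ext_def)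
    moreover have "\<psi> t = 1"
      using t subgroup.one_closed[OF X_subgroup] by (simp add: \<psi>_def)
    ultimately have "\<psi> (?a t) = 1" by simp
    then show ?thesis using g t by (simp add: \<psi>_def c_def split: if_splits)
  qed
  have "c t = \<one>"
  proof (rule A.central_hom_trivial[OF _ _ _ _ t])
    fix s t assume s: "s \<in> carrier G" and t: "t \<in> carrier G"
    have cs: "c s \<in> carrier G" "\<And>u. u \<in> carrier G \<Longrightarrow> c s \<otimes> u = u \<otimes> c s"
      using c_X[OF s] A.center_closed A.center_comm by auto
    have "c (s \<otimes> t) = inv t \<otimes> (c s \<otimes> ?a t)"
      using s t g by (simp add: c_def A.inv_mult_group A.\<alpha>_mult A.m_assoc)
    also have "\<dots> = inv t \<otimes> (?a t \<otimes> c s)" using cs(2)[of "?a t"] t g by simp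
    also have "\<dots> = c t \<otimes> c s" using s t g cs(1) by (simp add: c_def[of t] A.m_assoc)
    also have "\<dots> = c s \<otimes> c t" using cs(2)[of "c t"] c_X[OF t] A.center_closed by simp
    finally show "c (s \<otimes> t) = c s \<otimes> c t" .
  next
    fix \<chi> assume "\<chi> \<in> carrier A.D"
    then show "c (i \<chi>) = \<one>" using g by (simp add: c_def)
  qed (use c_X in auto)
  then have "t \<otimes> c t = t" using t by simp
  then show ?thesis using t g by (simp add: c_def A.m_assoc[symmetric])
qed

lemma tw_closed:
  assumes g: "g \<in> carrier \<Gamma>" and \<omega>: "\<omega> \<in> carrier Zh" shows "tw g \<omega> \<in> carrier Zh"
proof (rule char_group_memI)
  have a: "\<alpha> (inv\<^bsub>\<Gamma>\<^esub> g) x \<in> center G" if "x \<in> center G" for x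
    using A.\<alpha>_center g that by simp
  show "tw g \<omega> x \<noteq> 0" if "x \<in> carrier (G\<lparr>carrier := center G\<rparr>)" for x
    using that a A.Z.char_nonzero[OF \<omega>] by (simp add: tw_def)
  show "tw g \<omega> (x \<otimes>\<^bsub>G\<lparr>carrier := center G\<rparr>\<^esub> y) = tw g \<omega> x * tw g \<omega> y"
    if "x \<in> carrier (G\<lparr>carrier := center G\<rparr>)" "y \<in> carrier (G\<lparr>carrier := center G\<rparr>)" for x y
    using that a A.Z.char_mult[OF \<omega>] g A.center_closed subgroup.m_closed[OF A.subgroup_center]
    by (simp add: tw_def A.\<alpha>_mult)
qed (simp add: tw_def)

lemma tw_inverse:
  assumes g: "g \<in> carrier \<Gamma>" and \<omega>: "\<omega> \<in> carrier Zh"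
  shows "tw g (tw (inv\<^bsub>\<Gamma>\<^esub> g) \<omega>) = \<omega>" "tw (inv\<^bsub>\<Gamma>\<^esub> g) (tw g \<omega>) = \<omega>"
proof -
  have "tw h (tw (inv\<^bsub>\<Gamma>\<^esub> h) \<omega>) = \<omega>" if h: "h \<in> carrier \<Gamma>" for h
  proof (rule char_eqI[OF tw_closed[OF h tw_closed[OF _ \<omega>]] \<omega>])
    fix x assume "x \<in> carrier (G\<lparr>carrier := center G\<rparr>)"
    then show "tw h (tw (inv\<^bsub>\<Gamma>\<^esub> h) \<omega>) x = \<omega> x"
      using h A.center_closed A.\<alpha>_center by (simp add: tw_def)
  qed (use h in simp)
  from this[OF g] this[OF A.\<Gamma>.inv_closed[OF g]] g
  show "tw g (tw (inv\<^bsub>\<Gamma>\<^esub> g) \<omega>) = \<omega>" "tw (inv\<^bsub>\<Gamma>\<^esub> g) (tw g \<omega>) = \<omega>" by simp_all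
qed

text \<open>Under the twisted product \<open>\<omega> \<cdot> \<omega>' = \<omega> \<alpha>\<^sub>g(\<omega>')\<close> on the characters of the center, \<open>v\<close> is a
  homomorphism to the \<open>n\<close>-th roots of unity.  Its fibres are in bijection with \<open>v = 1\<close>, and
  the latter is also a subgroup for the ordinary product since \<open>\<alpha>\<^sub>g\<close> is trivial there.  Hence the
  index of that subgroup divides \<open>n\<close>, and \<open>v(\<omega>\<^sup>n) = 1\<close> for every \<open>\<omega>\<close>.\<close>

lemma v_pow: 
  assumes \<omega>: "\<omega> \<in> carrier Zh"
  shows "v (\<omega> [^]\<^bsub>Zh\<^esub> order \<Gamma>) = 1"
proof -
  interpret Zh: comm_group Zh by (rule A.Z.comm_group_char_group)
  have fin: "finite (carrier Zh)" by (rule A.Z.card_char_group(1))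
  define L where "L = {\<omega> \<in> carrier Zh. v \<omega> = 1}"
  have v1: "v \<one>\<^bsub>Zh\<^esub> = 1"
    using sum_center[of "\<lambda>_. 1"] sum_w by (simp add: v_def)
  have v0: "v \<omega> \<noteq> 0" if "\<omega> \<in> carrier Zh" for \<omega>
    using v_pow_order[OF that] by (auto simp: power_0_left)
  have L_mult: "v (\<omega> \<otimes>\<^bsub>Zh\<^esub> \<omega>') = v \<omega>'" if \<omega>: "\<omega> \<in> L" and \<omega>': "\<omega>' \<in> carrier Zh" for \<omega> \<omega>'
  proof -
    have \<omega>1: "\<omega> \<in> carrier Zh" "v \<omega> = 1" using \<omega> by (auto simp: L_def)
    have "tw (dg \<omega>) \<omega>' = \<omega>'"
      by (rule char_eqI[OF tw_closed[OF dg(1)[OF \<omega>1(1)] \<omega>'] \<omega>'])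
        (use v_one_imp_trivial[OF \<omega>1] A.center_closed in \<open>auto simp: tw_def\<close>)
    then show ?thesis using v_mult[OF \<omega>1(1) \<omega>'] \<omega>1(2) by simp
  qed
  have L_sub: "subgroup L Zh"
  proof (rule Zh.subgroupI)
    show "L \<noteq> {}" using v1 by (auto simp: L_def)
    fix a assume a: "a \<in> L"
    then have ac: "a \<in> carrier Zh" by (simp add: L_def)
    then show "inv\<^bsub>Zh\<^esub> a \<in> L" using L_mult[OF a Zh.inv_closed[OF ac]] v1 by (simp add: L_def)
    fix b assume "b \<in> L"
    then show "a \<otimes>\<^bsub>Zh\<^esub> b \<in> L" using L_mult[OF a] ac by (simp add: L_def)
  qed (auto simp: L_def)
  have fibre: "card {\<omega>' \<in> carrier Zh. v \<omega>' = v \<omega>} = card L" if \<omega>: "\<omega> \<in> carrier Zh" for \<omega>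
  proof -
    let ?g = "dg \<omega>"
    note g = dg(1)[OF \<omega>] and g' = A.\<Gamma>.inv_closed[OF dg(1)[OF \<omega>]]
    \<comment> \<open>This is left translation by \<omega> for the twisted product; the inverse map
      solves the equation for \<eta>.\<close>
    have "bij_betw (\<lambda>\<eta>. \<omega> \<otimes>\<^bsub>Zh\<^esub> tw ?g \<eta>) L {\<omega>' \<in> carrier Zh. v \<omega>' = v \<omega>}"
    proof (rule bij_betw_byWitness[where f' = "\<lambda>\<omega>'. tw (inv\<^bsub>\<Gamma>\<^esub> ?g) (inv\<^bsub>Zh\<^esub> \<omega> \<otimes>\<^bsub>Zh\<^esub> \<omega>')"])
      have undo: "\<omega> \<otimes>\<^bsub>Zh\<^esub> tw ?g (tw (inv\<^bsub>\<Gamma>\<^esub> ?g) (inv\<^bsub>Zh\<^esub> \<omega> \<otimes>\<^bsub>Zh\<^esub> \<omega>')) = \<omega>'" if \<omega>': "\<omega>' \<in> carrier Zh" for \<omega>'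
        using tw_inverse(1)[OF g, of "inv\<^bsub>Zh\<^esub> \<omega> \<otimes>\<^bsub>Zh\<^esub> \<omega>'"] \<omega> \<omega>' by (simp add: Zh.m_assoc[symmetric])
      then show "\<forall>\<omega>'\<in>{\<omega>' \<in> carrier Zh. v \<omega>' = v \<omega>}. \<omega> \<otimes>\<^bsub>Zh\<^esub> tw ?g (tw (inv\<^bsub>\<Gamma>\<^esub> ?g) (inv\<^bsub>Zh\<^esub> \<omega> \<otimes>\<^bsub>Zh\<^esub> \<omega>')) = \<omega>'"
        by blast
      show "\<forall>\<eta>\<in>L. tw (inv\<^bsub>\<Gamma>\<^esub> ?g) (inv\<^bsub>Zh\<^esub> \<omega> \<otimes>\<^bsub>Zh\<^esub> (\<omega> \<otimes>\<^bsub>Zh\<^esub> tw ?g \<eta>)) = \<eta>"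
        using tw_inverse(2)[OF g] tw_closed[OF g] \<omega> by (auto simp: Zh.m_assoc[symmetric] L_def)
      show "(\<lambda>\<eta>. \<omega> \<otimes>\<^bsub>Zh\<^esub> tw ?g \<eta>) ` L \<subseteq> {\<omega>' \<in> carrier Zh. v \<omega>' = v \<omega>}"
      proof (rule image_subsetI)
        fix \<eta> assume "\<eta> \<in> L"
        then have \<eta>: "\<eta> \<in> carrier Zh" "v \<eta> = 1" by (simp_all add: L_def)
        then show "\<omega> \<otimes>\<^bsub>Zh\<^esub> tw ?g \<eta> \<in> {\<omega>' \<in> carrier Zh. v \<omega>' = v \<omega>}"
          using v_mult[OF \<omega> \<eta>(1)] Zh.m_closed[OF \<omega> tw_closed[OF g \<eta>(1)]] by simp
      qed
      show "(\<lambda>\<omega>'. tw (inv\<^bsub>\<Gamma>\<^esub> ?g) (inv\<^bsub>Zh\<^esub> \<omega> \<otimes>\<^bsub>Zh\<^esub> \<omega>')) ` {\<omega>' \<in> carrier Zh. v \<omega>' = v \<omega>} \<subseteq> L"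
      proof (rule image_subsetI)
        fix \<omega>' assume "\<omega>' \<in> {\<omega>' \<in> carrier Zh. v \<omega>' = v \<omega>}"
        then have \<omega>': "\<omega>' \<in> carrier Zh" "v \<omega>' = v \<omega>" by simp_all
        have cl: "tw (inv\<^bsub>\<Gamma>\<^esub> ?g) (inv\<^bsub>Zh\<^esub> \<omega> \<otimes>\<^bsub>Zh\<^esub> \<omega>') \<in> carrier Zh"
          by (rule tw_closed[OF g' Zh.m_closed[OF Zh.inv_closed[OF \<omega>] \<omega>'(1)]])
        have "v \<omega> * v (tw (inv\<^bsub>\<Gamma>\<^esub> ?g) (inv\<^bsub>Zh\<^esub> \<omega> \<otimes>\<^bsub>Zh\<^esub> \<omega>')) = v \<omega>"
          using v_mult[OF \<omega> cl] undo[OF \<omega>'(1)] \<omega>'(2) by (simp only:)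
        then show "tw (inv\<^bsub>\<Gamma>\<^esub> ?g) (inv\<^bsub>Zh\<^esub> \<omega> \<otimes>\<^bsub>Zh\<^esub> \<omega>') \<in> L" using cl v0[OF \<omega>] by (simp add: L_def)
      qed
    qed
    from bij_betw_same_card[OF this] show ?thesis by (rule sym)
  qed
  let ?S = "v ` carrier Zh"
  have "Coset.order Zh = (\<Sum>s\<in>?S. card {\<omega> \<in> carrier Zh. v \<omega> = s})"
    using sum.image_gen[OF fin, of "\<lambda>_. 1 :: nat" v] by (simp add: Coset.order_def)
  also have "\<dots> = (\<Sum>s\<in>?S. card L)" using fibre by (intro sum.cong) auto
  finally have card: "card ?S * card L = Coset.order Zh" by simp
  have "card ?S dvd order \<Gamma>"
  proof -
    let ?M = "mult_group_of_field :: 'k monoid"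
    interpret M: comm_group ?M by (rule comm_group_mult_group_of_field)
    have mu: "subgroup {x. x ^ order \<Gamma> = 1} ?M"
    proof (rule M.subgroupI)
      show "inv\<^bsub>?M\<^esub> x \<in> {x. x ^ order \<Gamma> = 1}" if "x \<in> {x. x ^ order \<Gamma> = 1}" for x
      proof -
        have "x \<noteq> 0" using that by (auto simp: power_0_left)
        then have "inv\<^bsub>?M\<^esub> x = inverse x" by (intro M.inv_equality) auto
        then show ?thesis using that by (simp add: power_inverse)
      qed
      show "{x :: 'k. x ^ order \<Gamma> = 1} \<noteq> {}" by (auto intro: exI[of _ 1])
    qed (auto simp: power_0_left power_mult_distrib)
    interpret Mu: group "?M\<lparr>carrier := {x. x ^ order \<Gamma> = 1}\<rparr>"
      using subgroup.subgroup_is_group[OF mu M.is_group] .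
    \<comment> \<open>Products and inverses of values are obtained from the twisted product of
      characters. Its inverse of \<omega> is the inverse character with the twist by
      \<open>dg \<omega>\<close> undone.\<close>
    have "subgroup ?S (?M\<lparr>carrier := {x. x ^ order \<Gamma> = 1}\<rparr>)"
    proof (rule Mu.subgroupI)
      show "?S \<subseteq> carrier (?M\<lparr>carrier := {x. x ^ order \<Gamma> = 1}\<rparr>)" using v_pow_order by auto
      show "?S \<noteq> {}" using Zh.one_closed by blast
      show "a \<otimes>\<^bsub>?M\<lparr>carrier := {x. x ^ order \<Gamma> = 1}\<rparr>\<^esub> b \<in> ?S" if "a \<in> ?S" "b \<in> ?S" for a b
      proof -
        obtain \<omega> \<omega>' where \<omega>: "\<omega> \<in> carrier Zh" "a = v \<omega>" and \<omega>': "\<omega>' \<in> carrier Zh" "b = v \<omega>'"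
          using \<open>a \<in> ?S\<close> \<open>b \<in> ?S\<close> by blast
        have "a * b = v (\<omega> \<otimes>\<^bsub>Zh\<^esub> tw (dg \<omega>) \<omega>')" using v_mult[OF \<omega>(1) \<omega>'(1)] \<omega>(2) \<omega>'(2) by simp
        then show ?thesis using Zh.m_closed[OF \<omega>(1) tw_closed[OF dg(1)[OF \<omega>(1)] \<omega>'(1)]] by simp
      qed
      fix a assume "a \<in> ?S"
      then obtain \<omega> where \<omega>: "\<omega> \<in> carrier Zh" "a = v \<omega>" by blast
      let ?\<eta> = "tw (inv\<^bsub>\<Gamma>\<^esub> (dg \<omega>)) (inv\<^bsub>Zh\<^esub> \<omega>)"
      have \<eta>: "?\<eta> \<in> carrier Zh" using tw_closed dg(1)[OF \<omega>(1)] \<omega>(1) by simp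
      have "v \<omega> * v ?\<eta> = 1"
        using v_mult[OF \<omega>(1) \<eta>] tw_inverse(1)[OF dg(1)[OF \<omega>(1)] Zh.inv_closed[OF \<omega>(1)]] \<omega>(1) v1 by simp
      then have "inv\<^bsub>?M\<lparr>carrier := {x. x ^ order \<Gamma> = 1}\<rparr>\<^esub> a = v ?\<eta>"
        using v_pow_order[OF \<eta>] v_pow_order[OF \<omega>(1)] \<omega>(2) by (intro Mu.inv_equality) (auto simp: mult.commute)
      then show "inv\<^bsub>?M\<lparr>carrier := {x. x ^ order \<Gamma> = 1}\<rparr>\<^esub> a \<in> ?S" using \<eta> by blast
    qed
    from Mu.lagrange[OF this] show ?thesis
      using card_roots_of_unity(2)[OF A.\<Gamma>.order_pos, where 'k = 'k]
      by (simp add: Coset.order_def) (metis dvd_triv_right)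
  qed
  then obtain q where q: "order \<Gamma> = card ?S * q" by (rule dvdE)
  \<comment> \<open>By the fibre count \<open>card ?S\<close> is the index of \<open>L\<close> for
    the ordinary product, and \<open>order \<Gamma>\<close> is a multiple of it.\<close>
  have "\<omega> [^]\<^bsub>Zh\<^esub> card ?S \<in> L" by (rule Zh.pow_index_mem[OF L_sub fin \<omega> card])
  then have "(\<omega> [^]\<^bsub>Zh\<^esub> card ?S) [^]\<^bsub>Zh\<^esub> q \<in> L"
    by (induction q) (simp_all add: subgroup.one_closed[OF L_sub] subgroup.m_closed[OF L_sub])
  then show ?thesis using \<omega> by (simp add: L_def q Zh.nat_pow_pow)
qed

text \<open>All points of the support have the same power of exponent \<open>order \<Gamma>\<close>,
  since they differ by elements of \<open>i(\<Gamma>^)\<close>. So \<open>v\<close> of the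
  corresponding power of \<omega> is the value of \<omega> at
  \<open>base [^] order \<Gamma>\<close>. This value is 1 by \<open>v_pow\<close>, and characters
  separate the points of the center.\<close>

lemma base_Z0: "base \<in> A.Z0"
proof -
  have "base [^] order \<Gamma> = \<one>"
  proof (rule A.Z.chars_separate)
    show "base [^] order \<Gamma> \<in> center G" using base_center by (rule A.Z.nat_pow_closed)
    fix \<omega> :: "'a \<Rightarrow> 'k" assume \<omega>: "\<omega> \<in> carrier Zh"
    have "v (\<omega> [^]\<^bsub>Zh\<^esub> order \<Gamma>) = (\<Sum>z\<in>center G. \<omega> (base [^] order \<Gamma>) * w z)"
      unfolding v_def
    proof (rule sum.cong[OF refl])
      fix z assume z: "z \<in> center G"
      show "(\<omega> [^]\<^bsub>Zh\<^esub> order \<Gamma>) z * w z = \<omega> (base [^] order \<Gamma>) * w z"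
      proof (cases "w z = 0")
        case False
        then obtain \<chi> where \<chi>: "\<chi> \<in> carrier A.D" "z = i \<chi> \<otimes> base"
          using w_suppE[of z] A.center_closed[OF z] by blast
        have "i \<chi> [^] order \<Gamma> = \<one>" using A.Z0_eq \<chi>(1) by blast
        then have "z [^] order \<Gamma> = base [^] order \<Gamma>"
          unfolding \<chi>(2) using \<chi>(1) base_closed A.i_comm[OF \<chi>(1) base_closed]
          by (simp add: A.pow_mult_distrib)
        then show ?thesis using A.Z.char_pow[OF \<omega> z, of "order \<Gamma>"] z by simp
      qed simp
    qed
    also have "\<dots> = \<omega> (base [^] order \<Gamma>)"
      using sum_center[of "\<lambda>_. 1"] sum_w by (simp flip: sum_distrib_left)
    finally show "\<omega> (base [^] order \<Gamma>) = 1" using v_pow[OF \<omega>] by simp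
  qed
  then show ?thesis using base_center by (simp add: A.Z0_eq)
qed

end

text \<open>In every degree there is thus a function that does not vanish at a prescribed point, as
  needed for cancelling. Only the trivial character contributes because translation by
  \<open>i \<chi>\<close> has no fixed points otherwise.\<close>

lemma (in cocentral) avg_delta:
  assumes t: "t \<in> carrier G" and g: "g \<in> carrier \<Gamma>"
  shows "avg (delta_fun G t) g t \<noteq> 0"
proof -
  have "(\<Sum>\<chi>\<in>carrier D. inverse (\<chi> g) * delta_fun G t (t \<otimes> i \<chi>)) = (\<Sum>\<chi>\<in>carrier D. if \<chi> = \<one>\<^bsub>D\<^esub> then 1 else 0)"
  proof (rule sum.cong[OF refl])
    fix \<chi> assume \<chi>: "\<chi> \<in> carrier D"
    have "t \<otimes> i \<chi> = t \<longleftrightarrow> i \<chi> = i \<one>\<^bsub>D\<^esub>" using t \<chi> by (simp add: i_one)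
    also have "\<dots> \<longleftrightarrow> \<chi> = \<one>\<^bsub>D\<^esub>" using i_inj \<chi> by (auto dest: inj_onD)
    finally show "inverse (\<chi> g) * delta_fun G t (t \<otimes> i \<chi>) = (if \<chi> = \<one>\<^bsub>D\<^esub> then 1 else 0)"
      using t \<chi> g by (simp add: delta_fun_apply)
  qed
  then show ?thesis using t finite_D by (simp add: avg_def)
qed

section \<open>\<open>F^*(y0)\<close> is a point of \<open>i(\<Gamma>^)\<close>\<close>

context hopf_pair
begin

text \<open>The support now lies in \<open>i(\<Gamma>^)\<close>. Multiplicativity, tested in every
  degree, shows that two characters in the support agree at all \<open>g\<close>; the single
  remaining coefficient is 1 because the total mass is 1.\<close>

lemma w_delta: "\<exists>\<chi>\<in>carrier A.D. \<forall>r\<in>carrier G. w r = (if r = i \<chi> then 1 else 0)"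
proof -
  obtain \<psi> where \<psi>: "\<psi> \<in> carrier A.D" "base = i \<psi>" using base_Z0 by blast
  \<comment> \<open>The right-hand side does not involve \<chi>. As \<alpha> fixes
    \<open>i \<chi>\<close>, the twisted product of a degree \<open>g\<close> function with
    \<open>delta_fun G (i \<chi>)\<close> is a multiple of that delta function, and the nonzero
    factor \<open>w (i \<chi>)\<close> cancels.\<close>
  have key: "\<chi> g * A.avg (delta_fun G \<one>) g \<one> = (\<Sum>r\<in>carrier G. A.avg (delta_fun G \<one>) g r * w r)"
    if \<chi>: "\<chi> \<in> carrier A.D" and nz: "w (i \<chi>) \<noteq> 0" and g: "g \<in> carrier \<Gamma>" for \<chi> g
  proof -
    let ?\<phi> = "A.avg (delta_fun G \<one>) g" and ?d = "delta_fun G (i \<chi>) :: 'a \<Rightarrow> 'k"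
    note \<phi> = A.avg_deg[OF g, of "delta_fun G \<one>"]
    have tm: "A.twist_mult ?\<phi> ?d = (\<lambda>s\<in>carrier G. ?\<phi> (i \<chi>) * ?d s)"
      unfolding A.twist_mult_deg[OF \<phi> g]
    proof (rule restrict_ext)
      fix s assume s: "s \<in> carrier G"
      have "\<alpha> (inv\<^bsub>\<Gamma>\<^esub> g) s = i \<chi> \<longleftrightarrow> s = i \<chi>"
      proof
        assume "\<alpha> (inv\<^bsub>\<Gamma>\<^esub> g) s = i \<chi>"
        then have "\<alpha> g (\<alpha> (inv\<^bsub>\<Gamma>\<^esub> g) s) = i \<chi>" using g \<chi> by simp
        then show "s = i \<chi>" using g s by simp
      qed (use g \<chi> in simp)
      then show "?\<phi> s * ?d (\<alpha> (inv\<^bsub>\<Gamma>\<^esub> g) s) = ?\<phi> (i \<chi>) * ?d s"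
        using s g by (auto simp: delta_fun_apply)
    qed
    have d: "(\<Sum>r\<in>carrier G. ?d r * w r) = w (i \<chi>)"
      using F_y0[of ?d] \<chi> by (simp add: w_def)
    have "(\<Sum>r\<in>carrier G. ?\<phi> r * w r) * w (i \<chi>) = (\<Sum>r\<in>carrier G. A.twist_mult ?\<phi> ?d r * w r)"
      unfolding \<theta>_mult[OF A.deg_ext[OF \<phi>] delta_fun_ext] d ..
    also have "\<dots> = ?\<phi> (i \<chi>) * (\<Sum>r\<in>carrier G. ?d r * w r)"
      unfolding tm sum_distrib_left by (rule sum.cong) (simp_all add: mult.assoc)
    finally have "(\<Sum>r\<in>carrier G. ?\<phi> r * w r) * w (i \<chi>) = ?\<phi> (i \<chi>) * w (i \<chi>)"
      unfolding d .
    then have "(\<Sum>r\<in>carrier G. ?\<phi> r * w r) = ?\<phi> (\<one> \<otimes> i \<chi>)" using nz \<chi> by simp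
    then show ?thesis using A.degD[OF \<phi> A.one_closed \<chi>] by simp
  qed
  have unique: "\<chi> = \<psi>'" if \<chi>: "\<chi> \<in> carrier A.D" "w (i \<chi>) \<noteq> 0" and \<psi>': "\<psi>' \<in> carrier A.D" "w (i \<psi>') \<noteq> 0" for \<chi> \<psi>'
  proof (rule char_eqI[OF \<chi>(1) \<psi>'(1)])
    fix g assume g: "g \<in> carrier \<Gamma>"
    have "\<chi> g * A.avg (delta_fun G \<one>) g \<one> = \<psi>' g * A.avg (delta_fun G \<one>) g \<one>"
      using key[OF \<chi> g] key[OF \<psi>' g] by simp
    then show "\<chi> g = \<psi>' g" using A.avg_delta[OF A.one_closed g] by simp
  qed
  have zero: "w r = 0" if r: "r \<in> carrier G" "r \<noteq> i \<psi>" for r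
  proof (rule ccontr)
    assume nz: "w r \<noteq> 0"
    obtain \<chi> where \<chi>: "\<chi> \<in> carrier A.D" "r = i \<chi> \<otimes> base" using w_suppE[OF r(1) nz] by blast
    then have eq: "r = i (\<chi> \<otimes>\<^bsub>A.D\<^esub> \<psi>)" using \<psi> by (simp add: A.i_mult)
    have "w (i (\<chi> \<otimes>\<^bsub>A.D\<^esub> \<psi>)) \<noteq> 0" "w (i \<psi>) \<noteq> 0"
      using nz base_nonzero by (simp_all only: eq[symmetric] \<psi>(2)[symmetric] not_False_eq_True)
    then have "\<chi> \<otimes>\<^bsub>A.D\<^esub> \<psi> = \<psi>"
      by (intro unique[OF A.D.m_closed[OF \<chi>(1) \<psi>(1)] _ \<psi>(1)])
    then show False using r(2) eq by simp
  qed
  have "(\<Sum>r\<in>carrier G. w r) = (\<Sum>r\<in>carrier G. if r = i \<psi> then w (i \<psi>) else 0)"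
    using zero by (intro sum.cong) auto
  then have "w (i \<psi>) = 1" using sum_w \<psi>(1) A.finite_G by simp
  with zero \<psi>(1) show ?thesis by (intro bexI[of _ \<psi>]) auto
qed

definition \<chi>1 :: "'g \<Rightarrow> 'k" where
  "\<chi>1 = (SOME \<chi>. \<chi> \<in> carrier A.D \<and> (\<forall>r\<in>carrier G. w r = (if r = i \<chi> then 1 else 0)))"

lemma \<chi>1: "\<chi>1 \<in> carrier A.D" and w_eq: "r \<in> carrier G \<Longrightarrow> w r = (if r = i \<chi>1 then 1 else 0)"
  using someI_ex[of "\<lambda>\<chi>. \<chi> \<in> carrier A.D \<and> (\<forall>r\<in>carrier G. w r = (if r = i \<chi> then 1 else 0))"] w_delta
  unfolding \<chi>1_def by blast+

text \<open>With \<open>w\<close> concentrated at \<open>i \<chi>1\<close>, convolution becomes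
  translation, so \<open>F\<close> intertwines the translations by powers of
  \<open>i \<chi>1\<close> and of \<open>j \<chi>0\<close>.\<close>

lemma F_shift_pow:
  assumes \<phi>: "\<phi> \<in> E" and t: "t \<in> carrier G"
  shows "F \<phi> (t \<otimes> j (\<chi>0 [^]\<^bsub>A.D\<^esub> k)) = F (\<lambda>s\<in>carrier G. \<phi> (s \<otimes> i (\<chi>1 [^]\<^bsub>A.D\<^esub> (k::nat)))) t"
  using t
proof (induction k arbitrary: t)
  case 0
  have "(\<lambda>s\<in>carrier G. \<phi> (s \<otimes> i \<one>\<^bsub>A.D\<^esub>)) = \<phi>"
    using \<phi> by (intro extensionalityI[of _ "carrier G"]) (auto simp: A.i_one)
  then show ?case using 0 by (simp only: A.D.nat_pow_0 B.i_one A.r_one)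
next
  case (Suc k)
  let ?f = "\<lambda>s\<in>carrier G. \<phi> (s \<otimes> i (\<chi>1 [^]\<^bsub>A.D\<^esub> k))"
  have p: "\<chi>0 [^]\<^bsub>A.D\<^esub> k \<in> carrier A.D" "\<chi>1 [^]\<^bsub>A.D\<^esub> k \<in> carrier A.D"
    by (rule A.D.nat_pow_closed[OF \<chi>0], rule A.D.nat_pow_closed[OF \<chi>1])
  have "t \<otimes> j (\<chi>0 [^]\<^bsub>A.D\<^esub> Suc k) = (t \<otimes> y0) \<otimes> j (\<chi>0 [^]\<^bsub>A.D\<^esub> k)"
    unfolding A.D.nat_pow_Suc2[OF \<chi>0] B.i_mult[OF \<chi>0 p(1)] using Suc(2) y0 p by (simp add: A.m_assoc)
  then have "F \<phi> (t \<otimes> j (\<chi>0 [^]\<^bsub>A.D\<^esub> Suc k)) = F ?f (t \<otimes> y0)"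
    using Suc.IH[OF A.m_closed[OF Suc(2) y0]] by (simp only:)
  also have "\<dots> = F (\<lambda>s\<in>carrier G. \<Sum>r\<in>carrier G. w r * ?f (s \<otimes> r)) t"
    by (rule F_shift) (use Suc(2) in auto)
  also have "(\<lambda>s\<in>carrier G. \<Sum>r\<in>carrier G. w r * ?f (s \<otimes> r)) = (\<lambda>s\<in>carrier G. \<phi> (s \<otimes> i (\<chi>1 [^]\<^bsub>A.D\<^esub> Suc k)))"
  proof (rule restrict_ext)
    fix s assume s: "s \<in> carrier G"
    have "(\<Sum>r\<in>carrier G. w r * ?f (s \<otimes> r)) = (\<Sum>r\<in>carrier G. if r = i \<chi>1 then ?f (s \<otimes> i \<chi>1) else 0)"
      by (rule sum.cong[OF refl]) (simp add: w_eq)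
    also have "\<dots> = \<phi> (s \<otimes> i \<chi>1 \<otimes> i (\<chi>1 [^]\<^bsub>A.D\<^esub> k))" using s \<chi>1 A.finite_G by simp
    also have "s \<otimes> i \<chi>1 \<otimes> i (\<chi>1 [^]\<^bsub>A.D\<^esub> k) = s \<otimes> i (\<chi>1 [^]\<^bsub>A.D\<^esub> Suc k)"
      unfolding A.D.nat_pow_Suc2[OF \<chi>1] A.i_mult[OF \<chi>1 p(2)] using s \<chi>1 p by (simp add: A.m_assoc)
    finally show "(\<Sum>r\<in>carrier G. w r * ?f (s \<otimes> r)) = \<phi> (s \<otimes> i (\<chi>1 [^]\<^bsub>A.D\<^esub> Suc k))" .
  qed
  finally show ?case .
qed

lemma F_surj: "\<psi> \<in> E \<Longrightarrow> \<exists>\<phi>\<in>E. F \<phi> = \<psi>"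
  using bij_betw_imp_surj_on[OF F_facts(1)] by (metis imageE)

text \<open>If a power of \<chi>1 is trivial, so is translation by the corresponding power of
  \<open>j \<chi>0\<close> on the range of \<open>F\<close>, which is everything;
  \<open>delta_fun G \<one>\<close> detects that this power is trivial.\<close>

lemma \<chi>1_ord: "\<chi>1 [^]\<^bsub>A.D\<^esub> (k::nat) = \<one>\<^bsub>A.D\<^esub> \<longleftrightarrow> order \<Gamma> dvd k"
proof
  assume *: "\<chi>1 [^]\<^bsub>A.D\<^esub> k = \<one>\<^bsub>A.D\<^esub>"
  obtain \<phi> where \<phi>: "\<phi> \<in> E" "F \<phi> = delta_fun G \<one>" using F_surj[OF delta_fun_ext] by blast
  have "(\<lambda>s\<in>carrier G. \<phi> (s \<otimes> i \<one>\<^bsub>A.D\<^esub>)) = \<phi>"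
    using \<phi>(1) by (intro extensionalityI[of _ "carrier G"]) (auto simp: A.i_one)
  then have "F \<phi> (\<one> \<otimes> j (\<chi>0 [^]\<^bsub>A.D\<^esub> k)) = F \<phi> \<one>"
    using F_shift_pow[OF \<phi>(1) A.one_closed, of k] by (simp only: *)
  then have "delta_fun G \<one> (j (\<chi>0 [^]\<^bsub>A.D\<^esub> k)) = (1::'k)" using \<chi>0 by (simp add: \<phi>(2) delta_fun_apply)
  then have "j (\<chi>0 [^]\<^bsub>A.D\<^esub> k) = j \<one>\<^bsub>A.D\<^esub>" using \<chi>0 by (simp add: delta_fun_apply B.i_one split: if_splits)
  then have "\<chi>0 [^]\<^bsub>A.D\<^esub> k = \<one>\<^bsub>A.D\<^esub>"
    by (rule inj_onD[OF B.i_inj]) (use \<chi>0 in auto)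
  then show "order \<Gamma> dvd k" using \<chi>0_ord by blast
next
  assume "order \<Gamma> dvd k"
  then obtain l where "k = order \<Gamma> * l" by (rule dvdE)
  moreover have "\<chi>1 [^]\<^bsub>A.D\<^esub> order \<Gamma> = \<one>\<^bsub>A.D\<^esub>"
    using A.D.pow_order_eq_1[OF \<chi>1] A.card_D by (simp add: Coset.order_def)
  ultimately show "\<chi>1 [^]\<^bsub>A.D\<^esub> k = \<one>\<^bsub>A.D\<^esub>" using \<chi>1 by (simp flip: A.D.nat_pow_pow)
qed

lemma \<chi>1_gen: "carrier A.D = (\<lambda>k::nat. \<chi>1 [^]\<^bsub>A.D\<^esub> k) ` {..<order \<Gamma>}"
proof -
  have ord: "Coset.order A.D = order \<Gamma>" using A.card_D by (simp add: Coset.order_def)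
  have inj: "inj_on (\<lambda>k::nat. \<chi>1 [^]\<^bsub>A.D\<^esub> k) {..<order \<Gamma>}"
  proof (rule inj_onI)
    fix k l :: nat assume *: "k \<in> {..<order \<Gamma>}" "l \<in> {..<order \<Gamma>}" "\<chi>1 [^]\<^bsub>A.D\<^esub> k = \<chi>1 [^]\<^bsub>A.D\<^esub> l"
    have "k mod order \<Gamma> = l mod order \<Gamma>"
      using A.D.exponent_eq[OF \<chi>1, unfolded ord, OF \<chi>1_ord] *(3) by blast
    then show "k = l" using *(1,2) by simp
  qed
  have "(\<lambda>k::nat. \<chi>1 [^]\<^bsub>A.D\<^esub> k) ` {..<order \<Gamma>} = carrier A.D"
    by (rule card_subset_eq[OF A.finite_D]) (use \<chi>1 inj A.card_D in \<open>auto simp: card_image\<close>)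
  then show ?thesis by (rule sym)
qed

lemma \<chi>1_separates:
  assumes g: "g \<in> carrier \<Gamma>" and "\<chi>1 g = 1"
  shows "g = \<one>\<^bsub>\<Gamma>\<^esub>"
proof (rule A.\<Gamma>.chars_separate[OF g])
  fix \<chi> :: "'g \<Rightarrow> 'k" assume "\<chi> \<in> carrier A.D"
  then obtain k :: nat where "\<chi> = \<chi>1 [^]\<^bsub>A.D\<^esub> k" using \<chi>1_gen by blast
  then show "\<chi> g = 1" using assms by simp
qed

section \<open>The automorphism of \<Gamma> relating the gradings\<close>

lemma exists_exponent: "\<exists>a::nat. \<chi>1 = \<chi>0 [^]\<^bsub>A.D\<^esub> a"
  using \<chi>1 \<chi>0_gen by blast

text \<open>The dual of the automorphism of the character group that sends \<open>\<chi>0\<close> to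
  \<open>\<chi>1\<close>. Both are power maps with the same exponent.\<close>

definition u :: "'g \<Rightarrow> 'g" where
  "u = (\<lambda>g\<in>carrier \<Gamma>. g [^]\<^bsub>\<Gamma>\<^esub> (SOME a::nat. \<chi>1 = \<chi>0 [^]\<^bsub>A.D\<^esub> a))"

lemma u_closed [simp]: "g \<in> carrier \<Gamma> \<Longrightarrow> u g \<in> carrier \<Gamma>"
  by (simp add: u_def)

lemma \<chi>0_u: assumes g: "g \<in> carrier \<Gamma>" shows "\<chi>0 (u g) = \<chi>1 g"
proof -
  let ?a = "SOME a::nat. \<chi>1 = \<chi>0 [^]\<^bsub>A.D\<^esub> a"
  have "\<chi>1 = \<chi>0 [^]\<^bsub>A.D\<^esub> ?a" using exists_exponent by (rule someI_ex)
  then have "\<chi>1 g = (\<chi>0 [^]\<^bsub>A.D\<^esub> ?a) g" by (rule arg_cong)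
  then show ?thesis using g A.\<Gamma>.char_pow[OF \<chi>0 g] by (simp add: u_def)
qed

lemma u_mult:
  assumes "g \<in> carrier \<Gamma>" "h \<in> carrier \<Gamma>"
  shows "u (g \<otimes>\<^bsub>\<Gamma>\<^esub> h) = u g \<otimes>\<^bsub>\<Gamma>\<^esub> u h"
proof -
  interpret C: comm_group \<Gamma> using A.\<Gamma>.cyclic_imp_abelian_group[OF A.\<Gamma>.cyclic] .
  show ?thesis using assms by (simp add: u_def C.nat_pow_distrib)
qed

lemma u_auto: "u \<in> auto \<Gamma>"
proof -
  have hom: "group_hom \<Gamma> \<Gamma> u" using u_mult by unfold_locales (auto simp: hom_def)
  have inj: "inj_on u (carrier \<Gamma>)"
  proof -
    have "g = \<one>\<^bsub>\<Gamma>\<^esub>" if g: "g \<in> carrier \<Gamma>" "u g = \<one>\<^bsub>\<Gamma>\<^esub>" for g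
      using \<chi>1_separates[OF g(1)] \<chi>0_u[OF g(1)] A.\<Gamma>.char_one[OF \<chi>0] g(2) by simp
    then show ?thesis using group_hom.inj_on_one_iff[OF hom] by blast
  qed
  have "u ` carrier \<Gamma> = carrier \<Gamma>" by (rule endo_inj_surj[OF A.\<Gamma>.finite_carrier _ inj]) auto
  then show ?thesis using inj u_mult by (auto simp: auto_def hom_def Bij_def bij_betw_def) (auto simp: u_def)
qed

lemma u_one: "u \<one>\<^bsub>\<Gamma>\<^esub> = \<one>\<^bsub>\<Gamma>\<^esub>"
  by (simp add: u_def)

lemma u_inv: "g \<in> carrier \<Gamma> \<Longrightarrow> u (inv\<^bsub>\<Gamma>\<^esub> g) = inv\<^bsub>\<Gamma>\<^esub> (u g)"
  using u_mult[of "inv\<^bsub>\<Gamma>\<^esub> g" g] u_one by (intro A.\<Gamma>.inv_equality[symmetric]) auto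

text \<open>Degrees are eigenvalues of translations. \<open>F\<close> intertwines the translations
  attached to \<open>\<chi>1\<close> and \<open>\<chi>0\<close>, and the eigenvalues match by
  \<open>\<chi>0_u\<close>.\<close>

lemma dgr_iff:
  assumes \<phi>: "\<phi> \<in> E" and g: "g \<in> carrier \<Gamma>"
  shows "\<phi> \<in> A.dgr g \<longleftrightarrow> F \<phi> \<in> B.dgr (u g)"
proof -
  have val: "(\<chi>0 [^]\<^bsub>A.D\<^esub> k) (u g) = (\<chi>1 [^]\<^bsub>A.D\<^esub> k) g" for k :: nat
    using g by (simp add: \<chi>0_u)
  have scaled: "F (\<lambda>s\<in>carrier G. (\<chi>1 [^]\<^bsub>A.D\<^esub> k) g * \<phi> s) t = (\<chi>1 [^]\<^bsub>A.D\<^esub> k) g * F \<phi> t" if "t \<in> carrier G" for t and k :: nat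
    using F_scale[OF \<phi>, of "(\<chi>1 [^]\<^bsub>A.D\<^esub> k) g"] that by simp
  show ?thesis
  proof
    assume d: "\<phi> \<in> A.dgr g"
    show "F \<phi> \<in> B.dgr (u g)"
    proof (rule B.degI)
      fix t \<chi> assume t: "t \<in> carrier G" and "\<chi> \<in> carrier A.D"
      then obtain k :: nat where k: "\<chi> = \<chi>0 [^]\<^bsub>A.D\<^esub> k" using \<chi>0_gen by blast
      have "(\<lambda>s\<in>carrier G. \<phi> (s \<otimes> i (\<chi>1 [^]\<^bsub>A.D\<^esub> k))) = (\<lambda>s\<in>carrier G. (\<chi>1 [^]\<^bsub>A.D\<^esub> k) g * \<phi> s)"
        using A.degD[OF d _ A.D.nat_pow_closed[OF \<chi>1]] by (intro restrict_ext)
      then show "F \<phi> (t \<otimes> j \<chi>) = \<chi> (u g) * F \<phi> t"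
        unfolding k val using F_shift_pow[OF \<phi> t, of k] scaled[OF t, of k] by (simp only:)
    qed (use \<phi> in simp)
  next
    assume d: "F \<phi> \<in> B.dgr (u g)"
    show "\<phi> \<in> A.dgr g"
    proof (rule A.degI[OF \<phi>])
      fix s \<chi> assume s: "s \<in> carrier G" and "\<chi> \<in> carrier A.D"
      then obtain k :: nat where k: "\<chi> = \<chi>1 [^]\<^bsub>A.D\<^esub> k" using \<chi>1_gen by blast
      have "(\<lambda>s\<in>carrier G. \<phi> (s \<otimes> i \<chi>)) = (\<lambda>s\<in>carrier G. \<chi> g * \<phi> s)"
      proof (rule F_eqD)
        fix t assume t: "t \<in> carrier G"
        show "F (\<lambda>s\<in>carrier G. \<phi> (s \<otimes> i \<chi>)) t = F (\<lambda>s\<in>carrier G. \<chi> g * \<phi> s) t"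
          unfolding k using F_shift_pow[OF \<phi> t, of k] scaled[OF t, of k] val[of k]
            B.degD[OF d t A.D.nat_pow_closed[OF \<chi>0, of k]] by (simp only:)
      qed auto
      from fun_cong[OF this, of s] show "\<phi> (s \<otimes> i \<chi>) = \<chi> g * \<phi> s" using s by simp
    qed
  qed
qed

section \<open>The automorphism of \<open>H\<close> induced by \<open>F\<close>\<close>

lemma F_dgr_one: assumes "\<phi> \<in> A.dgr \<one>\<^bsub>\<Gamma>\<^esub>" shows "F \<phi> \<in> B.dgr \<one>\<^bsub>\<Gamma>\<^esub>"
  using dgr_iff[OF A.deg_ext[OF assms] A.\<Gamma>.one_closed] u_one assms by simp

text \<open>In degree one both twisted products are pointwise, so evaluation at \<open>t\<close>
  after \<open>F\<close> is a character of the functions on \<open>H\<close>, hence a point of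
  \<open>H\<close>.\<close>

lemma point_map_exists:
  assumes t: "t \<in> carrier G"
  shows "\<exists>y\<in>carrier G. \<forall>\<phi>\<in>A.dgr \<one>\<^bsub>\<Gamma>\<^esub>. F \<phi> t = \<phi> y"
proof -
  have "\<exists>y\<in>carrier G. \<forall>\<phi>\<in>A.dgr \<one>\<^bsub>\<Gamma>\<^esub>. (\<Sum>r\<in>carrier G. \<phi> r * F (delta_fun G r) t) = \<phi> y"
  proof (rule A.dgr_one_character)
    fix \<phi> \<psi> assume *: "\<phi> \<in> A.dgr \<one>\<^bsub>\<Gamma>\<^esub>" "\<psi> \<in> A.dgr \<one>\<^bsub>\<Gamma>\<^esub>"
    note E = A.deg_ext[OF *(1)] A.deg_ext[OF *(2)]
    have "(\<Sum>r\<in>carrier G. \<phi> r * \<psi> r * F (delta_fun G r) t) = F (A.twist_mult \<phi> \<psi>) t"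
      using t by (simp add: A.twist_mult_one[OF *(1)] F_lin)
    also have "\<dots> = F \<phi> t * F \<psi> t"
      using t by (simp add: F_facts(2)[OF E] B.twist_mult_one[OF F_dgr_one[OF *(1)]])
    finally show "(\<Sum>r\<in>carrier G. \<phi> r * \<psi> r * F (delta_fun G r) t)
        = (\<Sum>r\<in>carrier G. \<phi> r * F (delta_fun G r) t) * (\<Sum>r\<in>carrier G. \<psi> r * F (delta_fun G r) t)"
      using F_lin[OF E(1) t] F_lin[OF E(2) t] by simp
  next
    show "(\<Sum>r\<in>carrier G. F (delta_fun G r) t) = 1"
      using F_lin[of "\<lambda>x\<in>carrier G. 1" t] F_facts(3) t by simp
  qed
  then show ?thesis using F_lin[OF A.deg_ext t] by simp
qed

text \<open>Only the coset of \<open>p t\<close> is determined by this choice, which is why the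
  properties of \<open>p\<close> are stated after applying \<pi>.\<close>

definition p :: "'a \<Rightarrow> 'a" where
  "p t = (SOME y. y \<in> carrier G \<and> (\<forall>\<phi>\<in>A.dgr \<one>\<^bsub>\<Gamma>\<^esub>. F \<phi> t = \<phi> y))"

lemma p: 
  assumes "t \<in> carrier G" shows "p t \<in> carrier G" "\<And>\<phi>. \<phi> \<in> A.dgr \<one>\<^bsub>\<Gamma>\<^esub> \<Longrightarrow> F \<phi> t = \<phi> (p t)"
  using someI_ex[of "\<lambda>y. y \<in> carrier G \<and> (\<forall>\<phi>\<in>A.dgr \<one>\<^bsub>\<Gamma>\<^esub>. F \<phi> t = \<phi> y)"] point_map_exists[OF assms]
  unfolding p_def by blast+

text \<open>Compatibility with the comultiplication is used in one variable at a time; left and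
  right translates of a function on \<open>H\<close> are again functions on
  \<open>H\<close>.\<close>

lemma p_mult:
  assumes s: "s \<in> carrier G" and t: "t \<in> carrier G"
  shows "\<pi> (p (s \<otimes> t)) = \<pi> (p s \<otimes> p t)"
proof (rule A.separate_cosets)
  show "p (s \<otimes> t) \<in> carrier G" "p s \<otimes> p t \<in> carrier G" using p(1) s t A.m_closed by auto
  fix \<phi> assume \<phi>: "\<phi> \<in> A.dgr \<one>\<^bsub>\<Gamma>\<^esub>"
  have right: "(\<lambda>x\<in>carrier G. \<phi> (x \<otimes> y)) \<in> A.dgr \<one>\<^bsub>\<Gamma>\<^esub>" if y: "y \<in> carrier G" for y
  proof (rule A.dgr_oneI)
    fix x \<chi> assume x: "x \<in> carrier G" and \<chi>: "\<chi> \<in> carrier A.D"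
    have "x \<otimes> i \<chi> \<otimes> y = x \<otimes> y \<otimes> i \<chi>" using x y \<chi> A.i_comm[OF \<chi> y] by (simp add: A.m_assoc)
    then show "(\<lambda>x\<in>carrier G. \<phi> (x \<otimes> y)) (x \<otimes> i \<chi>) = (\<lambda>x\<in>carrier G. \<phi> (x \<otimes> y)) x"
      using x y \<chi> A.dgr_oneD[OF \<phi>, of "x \<otimes> y"] by simp
  qed simp
  have left: "(\<lambda>x\<in>carrier G. \<phi> (y \<otimes> x)) \<in> A.dgr \<one>\<^bsub>\<Gamma>\<^esub>" if y: "y \<in> carrier G" for y
    by (rule A.dgr_oneI) (use y A.dgr_oneD[OF \<phi>] in \<open>auto simp: A.m_assoc[symmetric]\<close>)
  have "\<phi> (p (s \<otimes> t)) = F \<phi> (s \<otimes> t)" using p(2)[OF A.m_closed[OF s t] \<phi>] by simp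
  also have "\<dots> = (\<Sum>y\<in>carrier G. (\<Sum>x\<in>carrier G. \<phi> (x \<otimes> y) * F (delta_fun G x) s) * F (delta_fun G y) t)"
    unfolding F_comult[OF A.deg_ext[OF \<phi>] s t] sum_distrib_right by (rule sum.swap)
  also have "\<dots> = (\<Sum>y\<in>carrier G. \<phi> (p s \<otimes> y) * F (delta_fun G y) t)"
  proof (rule sum.cong[OF refl])
    fix y assume y: "y \<in> carrier G"
    have "(\<Sum>x\<in>carrier G. \<phi> (x \<otimes> y) * F (delta_fun G x) s) = \<phi> (p s \<otimes> y)"
      using p(2)[OF s right[OF y]] F_lin[OF restrict_extensional s, of "\<lambda>x. \<phi> (x \<otimes> y)"] p(1)[OF s] by simp
    then show "(\<Sum>x\<in>carrier G. \<phi> (x \<otimes> y) * F (delta_fun G x) s) * F (delta_fun G y) t = \<phi> (p s \<otimes> y) * F (delta_fun G y) t"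
      by simp
  qed
  also have "\<dots> = \<phi> (p s \<otimes> p t)"
    using p(2)[OF t left[OF p(1)[OF s]]] F_lin[OF restrict_extensional t, of "\<lambda>y. \<phi> (p s \<otimes> y)"] p(1)[OF t] by simp
  finally show "\<phi> (p (s \<otimes> t)) = \<phi> (p s \<otimes> p t)" .
qed

lemma p_const:
  assumes "s \<in> carrier G" "t \<in> carrier G" "\<pi> s = \<pi> t" shows "\<pi> (p s) = \<pi> (p t)"
proof (rule A.separate_cosets[OF p(1)[OF assms(1)] p(1)[OF assms(2)]])
  fix \<phi> assume \<phi>: "\<phi> \<in> A.dgr \<one>\<^bsub>\<Gamma>\<^esub>"
  have "F \<phi> s = F \<phi> t"
    using B.dgr_one_const[OF F_dgr_one[OF \<phi>] assms(1,2)] assms(3) by (simp add: images_eq)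
  then show "\<phi> (p s) = \<phi> (p t)" using p(2)[OF assms(1) \<phi>] p(2)[OF assms(2) \<phi>] by simp
qed

text \<open>The commutation rule for a factor of degree \<open>g\<close> is transported by
  \<open>F\<close> and evaluated at \<open>t\<close>. A factor with
  \<open>F \<phi> t \<noteq> 0\<close> is needed for cancelling; \<open>avg_delta\<close> supplies
  its image and surjectivity of \<open>F\<close> the factor itself.\<close>

lemma p_equivariant:
  assumes g: "g \<in> carrier \<Gamma>" and t: "t \<in> carrier G"
  shows "\<pi> (p (\<beta> (inv\<^bsub>\<Gamma>\<^esub> (u g)) t)) = \<pi> (\<alpha> (inv\<^bsub>\<Gamma>\<^esub> g) (p t))"
proof (rule A.separate_cosets)
  have bt: "\<beta> (inv\<^bsub>\<Gamma>\<^esub> (u g)) t \<in> carrier G" using g t by simp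
  show "p (\<beta> (inv\<^bsub>\<Gamma>\<^esub> (u g)) t) \<in> carrier G" "\<alpha> (inv\<^bsub>\<Gamma>\<^esub> g) (p t) \<in> carrier G"
    using p(1)[OF bt] p(1)[OF t] g by auto
  fix \<psi> assume \<psi>: "\<psi> \<in> A.dgr \<one>\<^bsub>\<Gamma>\<^esub>"
  note \<psi>E = A.deg_ext[OF \<psi>]
  obtain \<phi> where \<phi>E: "\<phi> \<in> E" and F\<phi>: "F \<phi> = B.avg (delta_fun G t) (u g)"
    using F_surj[OF B.deg_ext[OF B.avg_deg[OF u_closed[OF g]]]] by blast
  have \<phi>: "\<phi> \<in> A.dgr g" using dgr_iff[OF \<phi>E g] B.avg_deg[OF u_closed[OF g]] F\<phi> by simp
  have nz: "F \<phi> t \<noteq> 0" unfolding F\<phi> by (rule B.avg_delta[OF t u_closed[OF g]])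
  define \<psi>' where "\<psi>' = (\<lambda>x\<in>carrier G. \<psi> (\<alpha> (inv\<^bsub>\<Gamma>\<^esub> g) x))"
  have \<psi>': "\<psi>' \<in> A.dgr \<one>\<^bsub>\<Gamma>\<^esub>"
    by (rule A.dgr_oneI) (use g A.dgr_oneD[OF \<psi>] in \<open>auto simp: \<psi>'_def A.\<alpha>_mult\<close>)
  have "A.twist_mult \<phi> \<psi> = A.twist_mult \<psi>' \<phi>"
    unfolding A.twist_mult_deg[OF \<phi> g] A.twist_mult_one[OF \<psi>'] by (rule restrict_ext) (simp add: \<psi>'_def)
  then have "B.twist_mult (F \<phi>) (F \<psi>) = B.twist_mult (F \<psi>') (F \<phi>)"
    using F_facts(2)[OF \<phi>E \<psi>E] F_facts(2)[OF A.deg_ext[OF \<psi>'] \<phi>E] by simp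
  from fun_cong[OF this, of t] have "F \<phi> t * F \<psi> (\<beta> (inv\<^bsub>\<Gamma>\<^esub> (u g)) t) = F \<psi>' t * F \<phi> t"
    using t B.twist_mult_deg[OF _ u_closed[OF g], of "F \<phi>"] dgr_iff[OF \<phi>E g] \<phi> B.twist_mult_one[OF F_dgr_one[OF \<psi>']]
    by simp
  then have "F \<psi> (\<beta> (inv\<^bsub>\<Gamma>\<^esub> (u g)) t) = F \<psi>' t" using nz by simp
  then show "\<psi> (p (\<beta> (inv\<^bsub>\<Gamma>\<^esub> (u g)) t)) = \<psi> (\<alpha> (inv\<^bsub>\<Gamma>\<^esub> g) (p t))"
    using p(2)[OF bt \<psi>] p(2)[OF t \<psi>'] p(1)[OF t] by (simp add: \<psi>'_def)
qed

lemma weakly_equivalent: "weakly_equivalent_actions \<Gamma> G i \<alpha> j \<beta>"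
proof -
  define f where "f C = \<pi> (p (A.sect C))" for C
  have f_\<pi>: "f (\<pi> t) = \<pi> (p t)" if t: "t \<in> carrier G" for t
    unfolding f_def using p_const[OF _ t] A.sect[OF A.\<pi>_mem[OF t]] by simp
  have hom: "f \<in> hom H H"
  proof (rule homI)
    fix C assume "C \<in> carrier H"
    then obtain t where "t \<in> carrier G" "C = \<pi> t" using A.\<pi>_surj by blast
    then show "f C \<in> carrier H" using f_\<pi> p(1) A.\<pi>_mem by simp
  next
    fix C C' assume "C \<in> carrier H" "C' \<in> carrier H"
    then obtain s t where s: "s \<in> carrier G" "C = \<pi> s" and t: "t \<in> carrier G" "C' = \<pi> t" using A.\<pi>_surj by blast
    have "f (C \<otimes>\<^bsub>H\<^esub> C') = \<pi> (p (s \<otimes> t))"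
      using f_\<pi>[OF A.m_closed[OF s(1) t(1)]] A.\<pi>_mult[OF s(1) t(1)] s(2) t(2) by simp
    also have "\<dots> = f C \<otimes>\<^bsub>H\<^esub> f C'"
      using p_mult[OF s(1) t(1)] A.\<pi>_mult[OF p(1)[OF s(1)] p(1)[OF t(1)]] f_\<pi>[OF s(1)] f_\<pi>[OF t(1)] s(2) t(2) by simp
    finally show "f (C \<otimes>\<^bsub>H\<^esub> C') = f C \<otimes>\<^bsub>H\<^esub> f C'" .
  qed
  \<comment> \<open>If a coset were missed, its nonzero indicator would be mapped to 0 by
    \<open>F\<close>.\<close>
  have surj: "f ` carrier H = carrier H"
  proof
    show "carrier H \<subseteq> f ` carrier H"
    proof
      fix C assume C: "C \<in> carrier H"
      show "C \<in> f ` carrier H"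
      proof (rule ccontr)
        assume neg: "C \<notin> f ` carrier H"
        have "A.ind C = (\<lambda>s\<in>carrier G. 0)"
        proof (rule F_eqD)
          fix t assume t: "t \<in> carrier G"
          have "\<pi> (p t) \<noteq> C" using neg f_\<pi>[OF t] A.\<pi>_mem[OF t] by blast
          then show "F (A.ind C) t = F (\<lambda>s\<in>carrier G. 0) t"
            using p[OF t] A.ind_dgr t by (simp add: A.ind_apply F_lin[of "\<lambda>s\<in>carrier G. 0"])
        qed auto
        from fun_cong[OF this, of "A.sect C"] show False using A.sect[OF C] by (simp add: A.ind_apply)
      qed
    qed
  qed (use hom in \<open>auto simp: hom_def\<close>)
  have bij: "bij_betw f (carrier H) (carrier H)"
    using surj eq_card_imp_inj_on[OF A.finite_H, of f] by (simp add: bij_betw_def)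
  show ?thesis
    unfolding weakly_equivalent_actions_def Let_def images_eq
  proof (intro bexI[OF _ u_auto] bexI[of _ f] ballI)
    fix g C assume g: "g \<in> carrier \<Gamma>" and "C \<in> carrier H"
    then obtain t where t: "t \<in> carrier G" "C = \<pi> t" using A.\<pi>_surj by blast
    have bt: "\<beta> (u g) t \<in> carrier G" using g t by simp
    have "\<alpha> g ` f C = \<pi> (\<alpha> g (p t))"
      using f_\<pi>[OF t(1)] \<alpha>_\<pi>[OF g p(1)[OF t(1)]] t(2) by simp
    \<comment> \<open>Equivariance was obtained for inverses, as they occur in the twisted product,
      so it is applied to the inverse of \<open>g\<close>.\<close>
    also have "\<dots> = f (\<pi> (\<beta> (u g) t))"
      using p_equivariant[OF A.\<Gamma>.inv_closed[OF g] t(1)] f_\<pi>[OF bt] u_inv[OF g] g by simp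
    finally show "inv_into (carrier H) f (\<alpha> g ` f C) = \<beta> (u g) ` C"
      using inv_into_f_f[of f "carrier H" "\<pi> (\<beta> (u g) t)"] bij A.\<pi>_mem[OF bt] \<beta>_\<pi>[OF u_closed[OF g] t(1)] t(2)
      by (simp add: bij_betw_def)
  qed (use hom bij in \<open>simp add: iso_def\<close>)
qed

end

lemma (in rigid_pair) hopf_isomorphic_imp_weakly_equivalent:
  assumes "hopf_isomorphic (graded_twist \<Gamma> G i \<alpha>) (graded_twist \<Gamma> G j \<beta>)"
  shows "weakly_equivalent_actions \<Gamma> G i \<alpha> j \<beta>"
proof -
  obtain F where F: "F \<in> hopf_iso (graded_twist \<Gamma> G i \<alpha>) (graded_twist \<Gamma> G j \<beta>)"
    using assms by (auto simp: hopf_isomorphic_def)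
  obtain \<chi> where \<chi>: "\<chi> \<in> carrier A.D" "carrier A.D = (\<lambda>k::nat. \<chi> [^]\<^bsub>A.D\<^esub> k) ` {..<Coset.order A.D}"
    "\<And>k::nat. \<chi> [^]\<^bsub>A.D\<^esub> k = \<one>\<^bsub>A.D\<^esub> \<longleftrightarrow> Coset.order A.D dvd k"
    by (rule A.D.generator) blast
  have ord: "Coset.order A.D = Coset.order \<Gamma>" using A.card_D by (simp add: Coset.order_def)
  interpret hopf_pair G \<Gamma> i j \<alpha> \<beta> F \<chi>
    using F \<chi>(1) \<chi>(2,3)[unfolded ord] by unfold_locales
  show ?thesis by (rule weakly_equivalent)
qed

theorem theorem3p1:
  fixes G :: "('a, 'm) monoid_scheme" and \<Gamma> :: "('g, 'n) monoid_scheme"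
    and i j :: "('g \<Rightarrow> 'k::{alg_closed_field, field_char_0}) \<Rightarrow> 'a"
    and \<alpha> \<beta> :: "'g \<Rightarrow> 'a \<Rightarrow> 'a"
    and \<Gamma>' :: "('g \<Rightarrow> 'k) monoid" and H :: "'a set monoid"
  defines "\<Gamma>' \<equiv> char_group \<Gamma>"
    and "H \<equiv> G Mod (i ` carrier \<Gamma>')"
  assumes "group G" and "finite (carrier G)" and "cyclic_group (G\<lparr>carrier := center G\<rparr>)"
    and "group \<Gamma>" and "finite (carrier \<Gamma>)" and "cyclic_group \<Gamma>"
    and "cocentral_action \<Gamma> G i \<alpha>" and "cocentral_action \<Gamma> G j \<beta>"
    and "card (carrier (H2 H \<Gamma>')) \<le> 2 \<or> H2_actions_trivial H \<Gamma>'"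
    and "\<forall>\<phi> \<in> hom H \<Gamma>'. \<forall>h \<in> carrier H. \<phi> h = \<one>\<^bsub>\<Gamma>'\<^esub>"
  shows "(hopf_isomorphic (graded_twist \<Gamma> G i \<alpha>) (graded_twist \<Gamma> G j \<beta>)
            \<longleftrightarrow> equivalent_actions \<Gamma> G i \<alpha> j \<beta>)
       \<and> (equivalent_actions \<Gamma> G i \<alpha> j \<beta> \<longleftrightarrow> weakly_equivalent_actions \<Gamma> G i \<alpha> j \<beta>)"
proof -
  have fcg: "finite_cyclic_group \<Gamma>"
    using assms(6-8) by (simp add: finite_cyclic_group_def finite_cyclic_group_axioms_def)
  have "cocentral G \<Gamma> i \<alpha>" "cocentral G \<Gamma> j \<beta>"
    using assms(3,4,9,10) fcg by (simp_all add: cocentral_def cocentral_axioms_def)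
  then interpret rigid_pair G \<Gamma> i j \<alpha> \<beta>
    using assms(5,12) unfolding \<Gamma>'_def H_def
    by (intro rigid_pair.intro cocentral_pair.intro rigid_pair_axioms.intro) auto
  show ?thesis
    using hopf_isomorphic_imp_weakly_equivalent equivalent_imp_hopf_isomorphic equivalent_imp_weakly_equivalent
      weakly_equivalent_imp_equivalent assms(11) unfolding \<Gamma>'_def H_def by blast
qed

end
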